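(* Let $\pi(x)$ be the number of primes $\le x$ and $\mathbf{p}(x)=\pi(x)/x$. For every integer $n\ge0$ let $$R_n(x)=\frac{\mathbf{p}(x)-\sum_{k=1}^{n}\frac{(k-1)!}{(\log x)^k}}{\frac{n!}{(\log x)^n}}.$$ Then for every $n\ge 0$ one has, as $x\to\infty$, the asymptotic continued fraction expansions $$R_n(x)\ \sim\ \cfrac{1}{\log x-n-1-\cfrac{n+1}{\log x-n-3-\cfrac{2(n+2)}{\log x-n-5-\cfrac{3(n+3)}{\log x-n-7-\cdots}}}}$$ (the $k$-th partial numerator is $1$ for $k=1$ and $(k-1)(n+k-1)$ for $k\ge2$; the $k$-th partial denominator is $\log x-n-(2k-1)$), and $$R_n(x)\ \sim\ \cfrac{1}{\log x-\cfrac{n+1}{1-\cfrac{1}{\log x-\cfrac{n+2}{1-\cfrac{2}{\log x-\cfrac{n+3}{1-\cfrac{3}{\log x-\cfrac{n+4}{1-\cdots}}}}}}}}$$ (partial numerators $c_1=1$, $c_{2k}=n+k$, $c_{2k+1}=k$; partial denominators alternately $\log x$ and $1$). Moreover, the same two asymptotic continued fraction expansions hold with $R_n(x)$ replaced by $$F_n(x)=\frac{(\log x)^n}{n!}\Big(\frac{\operatorname{li}(x)}{x}-\sum_{k=1}^n\frac{(k-1)!}{(\log x)^k}\Big),$$ and for all integers $n\ge0$ and all real $t>0$, $$R_n(x)=F_n(x)+o\Big(\frac{1}{(\log x)^t}\Big)\quad(x\to\infty).$$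
   Context: $\operatorname{li}(x)=\int_0^x\frac{dt}{\log t}$ (Cauchy principal value at $t=1$). The paper also writes $F_n(x)=(\log x)^n\frac1x\int_0^x\frac{dt}{(\log t)^{n+1}}$. Asymptotic notation ($O,o,\sim$ as $x\to\infty$): $f=o(g)$ means $|f|\le M|g|$ eventually for every $M>0$, $f=O(g)$ for some $M$. Asymptotic continued fraction expansion: if $w_0=0$ and $w_m$ is the $m$-th approximant of a continued fraction $K$, then $f\sim K$ means $\{w_m-w_{m-1}\}_{m\ge1}$ is an asymptotic sequence ($w_{m+1}-w_m=o(w_m-w_{m-1})$) and $f-w_m=O(w_{m+1}-w_m)$ for all $m\ge0$. *)

theory Defs
  imports "HOL-Analysis.Analysis" "HOL-Library.Landau_Symbols" "HOL-Computational_Algebra.Primes"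
begin

definition prime_pi :: "real \<Rightarrow> real" where
  "prime_pi x = real (card {p :: nat. prime p \<and> real p \<le> x})"

definition pdens :: "real \<Rightarrow> real" where
  "pdens x = prime_pi x / x"

text \<open>Logarithmic integral as a Cauchy principal value at t = 1 (meaningful for x > 1).\<close>
definition li :: "real \<Rightarrow> real" where
  "li x = Lim (at_right 0)
     (\<lambda>\<epsilon>. integral {0..1-\<epsilon>} (\<lambda>t. 1 / ln t) + integral {1+\<epsilon>..x} (\<lambda>t. 1 / ln t))"

definition R :: "nat \<Rightarrow> real \<Rightarrow> real" where
  "R n x = (pdens x - (\<Sum>k=1..n. fact (k-1) / (ln x)^k)) / (fact n / (ln x)^n)"

definition F :: "nat \<Rightarrow> real \<Rightarrow> real" where
  "F n x = (ln x)^n / fact n * (li x / x - (\<Sum>k=1..n. fact (k-1) / (ln x)^k))"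

fun cf_eval :: "(nat \<Rightarrow> real \<Rightarrow> real) \<Rightarrow> (nat \<Rightarrow> real \<Rightarrow> real) \<Rightarrow> nat \<Rightarrow> nat \<Rightarrow> real \<Rightarrow> real" where
  "cf_eval a b k 0 x = 0"
| "cf_eval a b k (Suc m) x = a k x / (b k x + cf_eval a b (Suc k) m x)"

definition cf_approx :: "(nat \<Rightarrow> real \<Rightarrow> real) \<Rightarrow> (nat \<Rightarrow> real \<Rightarrow> real) \<Rightarrow> nat \<Rightarrow> real \<Rightarrow> real" where
  "cf_approx a b m x = cf_eval a b 1 m x"

definition cf_asymp :: "(real \<Rightarrow> real) \<Rightarrow> (nat \<Rightarrow> real \<Rightarrow> real) \<Rightarrow> (nat \<Rightarrow> real \<Rightarrow> real) \<Rightarrow> bool" where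
  "cf_asymp f a b \<longleftrightarrow>
     (\<forall>m\<ge>1. (\<lambda>x. cf_approx a b (m+1) x - cf_approx a b m x)
              \<in> o[at_top](\<lambda>x. cf_approx a b m x - cf_approx a b (m-1) x)) \<and>
     (\<forall>m. (\<lambda>x. f x - cf_approx a b m x) \<in> O[at_top](\<lambda>x. cf_approx a b (m+1) x - cf_approx a b m x))"

text \<open>First expansion: 1/(log x - n - 1 - (n+1)/(log x - n - 3 - 2(n+2)/(...))).
  In the "+" form the partial numerators are 1 and -(k-1)(n+k-1).\<close>
definition cfA1 :: "nat \<Rightarrow> nat \<Rightarrow> real \<Rightarrow> real" where
  "cfA1 n k x = (if k = 1 then 1 else - (real (k-1) * real (n+k-1)))"

definition cfB1 :: "nat \<Rightarrow> nat \<Rightarrow> real \<Rightarrow> real" where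
  "cfB1 n k x = ln x - real n - (2 * real k - 1)"

text \<open>Second expansion: 1/(log x - (n+1)/(1 - 1/(log x - (n+2)/(1 - 2/(...))))).
  c_1 = 1, c_(2k) = n+k, c_(2k+1) = k, entering with minus sign.\<close>
definition cfA2 :: "nat \<Rightarrow> nat \<Rightarrow> real \<Rightarrow> real" where
  "cfA2 n k x = (if k = 1 then 1
                 else if even k then - real (n + k div 2) else - real (k div 2))"

definition cfB2 :: "nat \<Rightarrow> nat \<Rightarrow> real \<Rightarrow> real" where
  "cfB2 n k x = (if odd k then ln x else 1)"

end

theory Submission
  imports Defs "HOL-Real_Asymp.Real_Asymp" "HOL-Complex_Analysis.Complex_Analysis"
    "HOL-Number_Theory.Prime_Powers" "HOL-Probability.Probability"
begin

text \<open>
  Put \<open>L = ln x\<close>. Both \<open>L * R n x\<close> and \<open>L * F n x\<close> have the asymptotic expansion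
  \<open>\<Sum>j. (n + 1)(n + 2)...(n + j) / L ^ j\<close>, which is the hypergeometric series
  \<open>2F0(n + 1, 1; 1 / L)\<close>. Dividing successive members of a chain linked by the contiguous
  relations of \<open>2F0\<close> gives exact tails of the second continued fraction, each with known
  leading term, and that is all one needs to compare the function with the approximants.
  The first fraction is the even part of the second.

  The expansion of \<open>R n\<close> rests on \<open>\<pi>(x) = li(x) + O(x / L ^ N)\<close> for every \<open>N\<close>. The
  \<open>3-4-1\<close> inequality and a growth bound for zeta of arbitrarily small exponent show that
  every derivative of \<open>Q(s) = - \<zeta>'(s) / (s \<zeta>(s)) - 1 / (s - 1)\<close> is \<open>O(\<bar>Im s\<bar> powr (- 1 / 2))\<close>,
  uniformly in \<open>1 < Re s \<le> 2\<close>. Since the \<open>k\<close>-th derivative is, up to sign, the Laplace transform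
  of \<open>(\<psi>(exp v) - exp v) * v ^ k\<close>, Levy's inversion formula bounds the integral of
  \<open>(\<psi>(exp v) - exp v) * v ^ k / exp v\<close> over every interval of length at most \<open>1\<close>, and
  the monotonicity of \<open>\<psi>\<close> turns this into \<open>\<psi>(x) - x = O(x / L powr (k / 2))\<close>.
\<close>

text \<open>An error \<open>o(x / ln x)\<close> in the prime number theorem would fix only the first
  term of the expansion, while every further approximant consumes more terms; hence the error
  \<open>O(x / ln x ^ N)\<close> for every \<open>N\<close>. Control of all derivatives of
  \<open>Q\<close> up to the line yields it because a weight \<open>v ^ k\<close> with
  \<open>v = ln x\<close> corresponds to a \<open>k\<close>-fold derivative of the transform. The
  growth exponent of zeta must be arbitrarily small since Cauchy's estimate loses more with each
  derivative. The decay \<open>- 1 / 2\<close> is chosen because the kernel of the inversion formula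
  supplies a further \<open>1 / \<bar>t\<bar>\<close>, which makes the integral absolutely
  convergent. Levy's formula is about positive measures, so \<open>\<psi>(exp v)\<close> and
  \<open>exp v\<close>, damped by \<open>exp (- (r * v))\<close> with \<open>r > 1\<close>, are
  inverted separately and compared inside the limit. All estimates being uniform in
  \<open>r\<close>, no limit \<open>r\<close> to 1 is taken: \<open>r\<close> is fitted to the point
  at which \<open>\<psi>\<close> is studied.\<close>

section \<open>Powers of 1 / ln x as an asymptotic scale\<close>

lemma ln_power_bigo:
  assumes "i \<le> j"
  shows "(\<lambda>x::real. 1 / ln x ^ j) \<in> O(\<lambda>x. 1 / ln x ^ i)"
proof (rule bigoI[where c=1])
  show "\<forall>\<^sub>F x in at_top. norm (1 / ln x ^ j) \<le> 1 * norm (1 / ln x ^ i :: real)"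
    using eventually_ge_at_top[of "exp 1"]
  proof eventually_elim
    case (elim x)
    hence "ln x \<ge> 1"
      by (metis exp_gt_zero ln_exp ln_le_cancel_iff order_less_le_trans)
    thus ?case using assms by (simp add: power_increasing frac_le)
  qed
qed

lemma ln_power_smallo:
  assumes "i < j"
  shows "(\<lambda>x::real. 1 / ln x ^ j) \<in> o(\<lambda>x. 1 / ln x ^ i)"
proof -
  have "(\<lambda>x::real. 1 / ln x ^ j) \<in> O(\<lambda>x. 1 / ln x ^ Suc i)"
    by (rule ln_power_bigo) (use assms in auto)
  also have "(\<lambda>x::real. (1 / ln x) * (1 / ln x ^ i)) \<in> o(\<lambda>x. 1 * (1 / ln x ^ i))"
  proof (rule landau_o.small_big_mult)
    show "(\<lambda>x::real. 1 / ln x) \<in> o(\<lambda>x. 1)" by real_asymp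
  qed simp
  hence "(\<lambda>x::real. 1 / ln x ^ Suc i) \<in> o(\<lambda>x. 1 / ln x ^ i)" by simp
  finally show ?thesis .
qed

section \<open>Continued fractions with logarithmic partial denominators\<close>

text \<open>Exponent of \<open>1 / ln x\<close> in the gap between approximants \<open>m\<close> and
  \<open>m + 1\<close> of the subfraction starting at \<open>k\<close>: each level that the
  difference passes through divides by the square of a denominator, the innermost one by a first
  power.\<close>

fun cf_order :: "(nat \<Rightarrow> nat) \<Rightarrow> nat \<Rightarrow> nat \<Rightarrow> nat" where
  "cf_order \<beta> k 0 = \<beta> k"
| "cf_order \<beta> k (Suc m) = 2 * \<beta> k + cf_order \<beta> (Suc k) m"

text \<open>\<open>\<beta> k\<close> is the degree in \<open>ln x\<close> of a partial denominator,
  constantly 1 for the first fraction and alternately 1 and 0 for the second.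
  \<open>\<beta>_sum\<close> forbids two adjacent bounded denominators, so a subfraction is small
  against the denominator it is added to, and every level gains at least one power of
  \<open>1 / ln x\<close>.\<close>

locale log_cf =
  fixes a b :: "nat \<Rightarrow> real \<Rightarrow> real" and \<alpha> :: "nat \<Rightarrow> real" and \<beta> :: "nat \<Rightarrow> nat"
  assumes a_const: "\<And>k. k \<ge> 1 \<Longrightarrow> a k = (\<lambda>_. \<alpha> k)"
    and \<alpha>_nz: "\<And>k. k \<ge> 1 \<Longrightarrow> \<alpha> k \<noteq> 0"
    and b_theta: "\<And>k. k \<ge> 1 \<Longrightarrow> b k \<in> \<Theta>(\<lambda>x. ln x ^ \<beta> k)"
    and \<beta>_sum: "\<And>k. k \<ge> 1 \<Longrightarrow> \<beta> k + \<beta> (Suc k) \<ge> 1"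
begin

lemma denominator_theta:
  assumes k: "k \<ge> 1" and g: "g \<in> O(\<lambda>x. 1 / ln x ^ \<beta> (Suc k))"
  shows "(\<lambda>x. b k x + g x) \<in> \<Theta>(\<lambda>x. ln x ^ \<beta> k)"
proof -
  have "(\<lambda>x::real. 1 / ln x ^ \<beta> (Suc k)) \<in> o(\<lambda>x. ln x ^ \<beta> k)"
  proof (rule smalloI_tendsto)
    have "0 < \<beta> k + \<beta> (Suc k)" using \<beta>_sum[OF k] by linarith
    hence "((\<lambda>x::real. 1 / ln x ^ (\<beta> k + \<beta> (Suc k)) / (1 / ln x ^ 0)) \<longlongrightarrow> 0) at_top"
      by (intro smalloD_tendsto ln_power_smallo)
    thus "((\<lambda>x::real. 1 / ln x ^ \<beta> (Suc k) / ln x ^ \<beta> k) \<longlongrightarrow> 0) at_top"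
      by (simp add: power_add mult.commute)
    show "\<forall>\<^sub>F x::real in at_top. ln x ^ \<beta> k \<noteq> 0"
      using eventually_gt_at_top[of 1] by eventually_elim simp
  qed
  with g have "g \<in> o(\<lambda>x. ln x ^ \<beta> k)" by (rule landau_o.big_small_trans)
  hence "g \<in> o(b k)"
    by (simp add: landau_o.small.cong_bigtheta[OF b_theta[OF k]])
  hence "\<Theta>(\<lambda>x. b k x + g x) = \<Theta>(b k)" by (rule landau_theta.plus_absorb2)
  moreover have "(\<lambda>x. b k x + g x) \<in> \<Theta>(\<lambda>x. b k x + g x)" by (rule bigtheta_refl)
  ultimately have "(\<lambda>x. b k x + g x) \<in> \<Theta>(b k)" by (simp only:)
  thus ?thesis using b_theta[OF k] by (rule landau_theta.trans)
qed

lemma tail_bigo: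
  assumes k: "k \<ge> 1" and g: "g \<in> O(\<lambda>x. 1 / ln x ^ \<beta> (Suc k))"
  shows "(\<lambda>x. a k x / (b k x + g x)) \<in> O(\<lambda>x. 1 / ln x ^ \<beta> k)"
proof -
  have "(\<lambda>x. a k x / (b k x + g x)) \<in> \<Theta>(\<lambda>x. 1 / ln x ^ \<beta> k)"
    by (intro bigtheta_divide denominator_theta k g) (simp add: a_const[OF k] \<alpha>_nz[OF k])
  thus ?thesis by (rule bigthetaD1)
qed

lemma cf_eval_bigo:
  assumes "k \<ge> 1"
  shows "cf_eval a b k m \<in> O(\<lambda>x. 1 / ln x ^ \<beta> k)"
  using assms
proof (induction m arbitrary: k)
  case (Suc m)
  have "cf_eval a b k (Suc m) = (\<lambda>x. a k x / (b k x + cf_eval a b (Suc k) m x))"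
    by (simp add: fun_eq_iff)
  with tail_bigo[OF Suc.prems Suc.IH[of "Suc k"]] show ?case by simp
next
  case 0
  have "cf_eval a b k 0 = (\<lambda>_. 0)" by (simp add: fun_eq_iff)
  thus ?case by simp
qed

text \<open>Both the gaps between consecutive approximants and the errors of the approximants obey
  the recursion \<open>a/(b+u) - a/(b+v) = -a (u-v) / ((b+u)(b+v))\<close>.\<close>

lemma quotient_diff:
  assumes k: "k \<ge> 1" and u: "u \<in> O(\<lambda>x. 1 / ln x ^ \<beta> (Suc k))"
    and v: "v \<in> O(\<lambda>x. 1 / ln x ^ \<beta> (Suc k))"
  shows "(\<lambda>x. a k x / (b k x + u x) - a k x / (b k x + v x)) \<in>
           \<Theta>(\<lambda>x. (u x - v x) / ln x ^ (2 * \<beta> k))"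
proof -
  note den = denominator_theta[OF k u] denominator_theta[OF k v]
  have nz: "\<forall>\<^sub>F x in at_top. b k x + w x \<noteq> 0"
    if "(\<lambda>x. b k x + w x) \<in> \<Theta>(\<lambda>x. ln x ^ \<beta> k)" for w
  proof -
    have "\<forall>\<^sub>F x::real in at_top. ln x ^ \<beta> k \<noteq> 0"
      using eventually_gt_at_top[of 1] by eventually_elim simp
    thus ?thesis using eventually_nonzero_bigtheta[OF that] by simp
  qed
  have "(\<lambda>x. - a k x * (u x - v x) / ((b k x + u x) * (b k x + v x))) \<in>
           \<Theta>(\<lambda>x. (1 * (u x - v x)) / (ln x ^ \<beta> k * ln x ^ \<beta> k))"
    by (intro bigtheta_divide landau_theta.mult den bigtheta_refl)
       (simp add: a_const[OF k] \<alpha>_nz[OF k])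
  also have "(\<lambda>x. - a k x * (u x - v x) / ((b k x + u x) * (b k x + v x))) \<in> \<Theta>(f) \<longleftrightarrow>
     (\<lambda>x. a k x / (b k x + u x) - a k x / (b k x + v x)) \<in> \<Theta>(f)" for f
    using nz[OF den(1)] nz[OF den(2)]
    by (intro landau_theta.in_cong, eventually_elim) (simp add: field_simps)
  finally show ?thesis by (simp add: power_add mult_2)
qed

lemma cf_eval_gap:
  assumes "k \<ge> 1"
  shows "(\<lambda>x. cf_eval a b k (Suc m) x - cf_eval a b k m x) \<in> \<Theta>(\<lambda>x. 1 / ln x ^ cf_order \<beta> k m)"
  using assms
proof (induction m arbitrary: k)
  case 0
  have "(\<lambda>x. a k x / b k x) \<in> \<Theta>(\<lambda>x. 1 / ln x ^ \<beta> k)"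
    by (intro bigtheta_divide b_theta 0) (simp add: a_const[OF 0] \<alpha>_nz[OF 0])
  thus ?case by simp
next
  case (Suc m)
  have "(\<lambda>x. cf_eval a b k (Suc (Suc m)) x - cf_eval a b k (Suc m) x) \<in>
      \<Theta>(\<lambda>x. (cf_eval a b (Suc k) (Suc m) x - cf_eval a b (Suc k) m x) / ln x ^ (2 * \<beta> k))"
    using quotient_diff[OF Suc.prems cf_eval_bigo[of "Suc k" "Suc m"] cf_eval_bigo[of "Suc k" m]]
    by simp
  also have "(\<lambda>x. (cf_eval a b (Suc k) (Suc m) x - cf_eval a b (Suc k) m x) / ln x ^ (2 * \<beta> k)) \<in>
      \<Theta>(\<lambda>x. (1 / ln x ^ cf_order \<beta> (Suc k) m) / ln x ^ (2 * \<beta> k))"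
    by (intro bigtheta_divide Suc.IH bigtheta_refl) simp
  finally show ?case by (simp add: power_add mult.commute)
qed

text \<open>The same recursion as for the gaps, but started from a mere upper bound for
  \<open>g k\<close>, hence \<open>O\<close> instead of \<open>\<Theta>\<close>.\<close>

lemma tail_error:
  assumes g_rec: "\<And>k. k \<ge> 1 \<Longrightarrow> \<forall>\<^sub>F x in at_top. g k x = a k x / (b k x + g (Suc k) x)"
    and g_bigo: "\<And>k. k \<ge> 1 \<Longrightarrow> g k \<in> O(\<lambda>x. 1 / ln x ^ \<beta> k)"
    and "k \<ge> 1"
  shows "(\<lambda>x. g k x - cf_eval a b k m x) \<in> O(\<lambda>x. 1 / ln x ^ cf_order \<beta> k m)"
  using assms(3)
proof (induction m arbitrary: k)
  case 0
  thus ?case using g_bigo by simp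
next
  case (Suc m)
  have *: "(\<lambda>x. g k x - cf_eval a b k (Suc m) x) \<in> O(f) \<longleftrightarrow>
     (\<lambda>x. a k x / (b k x + g (Suc k) x) - a k x / (b k x + cf_eval a b (Suc k) m x)) \<in> O(f)" for f
    using g_rec[OF Suc.prems] by (intro landau_o.big.in_cong, eventually_elim) simp
  have "(\<lambda>x. a k x / (b k x + g (Suc k) x) - a k x / (b k x + cf_eval a b (Suc k) m x)) \<in>
      O(\<lambda>x. (g (Suc k) x - cf_eval a b (Suc k) m x) / ln x ^ (2 * \<beta> k))"
    by (intro bigthetaD1 quotient_diff Suc.prems g_bigo cf_eval_bigo) auto
  also have "(\<lambda>x. (g (Suc k) x - cf_eval a b (Suc k) m x) * (1 / ln x ^ (2 * \<beta> k))) \<in>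
      O(\<lambda>x. (1 / ln x ^ cf_order \<beta> (Suc k) m) * (1 / ln x ^ (2 * \<beta> k)))"
    by (intro landau_o.big.mult Suc.IH) auto
  hence "(\<lambda>x. (g (Suc k) x - cf_eval a b (Suc k) m x) / ln x ^ (2 * \<beta> k)) \<in>
      O(\<lambda>x. 1 / ln x ^ cf_order \<beta> k (Suc m))"
    by (simp add: power_add mult.commute)
  finally show ?case unfolding * .
qed

lemma cf_order_less:
  "k \<ge> 1 \<Longrightarrow> cf_order \<beta> k m < cf_order \<beta> k (Suc m)"
proof (induction m arbitrary: k)
  case 0
  thus ?case using \<beta>_sum[of k] by (cases "\<beta> k") auto
next
  case (Suc m)
  thus ?case using Suc.IH[of "Suc k"] by simp
qed

text \<open>Exact tails of the expected size suffice: the error of the \<open>m\<close>-th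
  approximant then has at most the order \<open>cf_order \<beta> 1 m\<close>, which by
  \<open>cf_eval_gap\<close> is the exact order of the next gap.\<close>

lemma cf_asymp_if_tails:
  assumes g_rec: "\<And>k. k \<ge> 1 \<Longrightarrow> \<forall>\<^sub>F x in at_top. g k x = a k x / (b k x + g (Suc k) x)"
    and g_bigo: "\<And>k. k \<ge> 1 \<Longrightarrow> g k \<in> O(\<lambda>x. 1 / ln x ^ \<beta> k)"
    and f: "\<forall>\<^sub>F x in at_top. f x = g 1 x"
  shows "cf_asymp f a b"
  unfolding cf_asymp_def cf_approx_def
proof (intro conjI allI impI)
  fix m :: nat assume "m \<ge> 1"
  then obtain m' where m: "m = Suc m'" by (cases m) auto
  have "(\<lambda>x. cf_eval a b 1 (Suc m) x - cf_eval a b 1 m x) \<in> O(\<lambda>x. 1 / ln x ^ cf_order \<beta> 1 m)"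
    using cf_eval_gap[of 1 m] by (intro bigthetaD1) simp
  also have "(\<lambda>x::real. 1 / ln x ^ cf_order \<beta> 1 m) \<in> o(\<lambda>x. 1 / ln x ^ cf_order \<beta> 1 m')"
    by (rule ln_power_smallo) (use cf_order_less[of 1 m'] m in simp)
  also have "(\<lambda>x. 1 / ln x ^ cf_order \<beta> 1 m') \<in> O(\<lambda>x. cf_eval a b 1 m x - cf_eval a b 1 m' x)"
    using cf_eval_gap[of 1 m'] unfolding m by (intro bigthetaD1) (simp add: bigtheta_sym)
  finally show "(\<lambda>x. cf_eval a b 1 (m + 1) x - cf_eval a b 1 m x) \<in>
      o(\<lambda>x. cf_eval a b 1 m x - cf_eval a b 1 (m - 1) x)"
    by (simp add: m)
next
  fix m :: nat
  have "(\<lambda>x. f x - cf_eval a b 1 m x) \<in> O(\<lambda>x. 1 / ln x ^ cf_order \<beta> 1 m) \<longleftrightarrow>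
     (\<lambda>x. g 1 x - cf_eval a b 1 m x) \<in> O(\<lambda>x. 1 / ln x ^ cf_order \<beta> 1 m)"
    using f by (intro landau_o.big.in_cong, eventually_elim) simp
  hence "(\<lambda>x. f x - cf_eval a b 1 m x) \<in> O(\<lambda>x. 1 / ln x ^ cf_order \<beta> 1 m)"
    using tail_error[OF g_rec g_bigo, of 1 m] by simp
  also have "(\<lambda>x. 1 / ln x ^ cf_order \<beta> 1 m) \<in> O(\<lambda>x. cf_eval a b 1 (Suc m) x - cf_eval a b 1 m x)"
    using cf_eval_gap[of 1 m] by (intro bigthetaD1) (simp add: bigtheta_sym)
  finally show "(\<lambda>x. f x - cf_eval a b 1 m x) \<in>
      O(\<lambda>x. cf_eval a b 1 (m + 1) x - cf_eval a b 1 m x)" by simp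
qed

end

section \<open>Tails from asymptotic expansions\<close>

definition expands :: "(real \<Rightarrow> real) \<Rightarrow> (nat \<Rightarrow> real) \<Rightarrow> bool" where
  "expands f c \<longleftrightarrow> (\<forall>N. (\<lambda>x. f x - (\<Sum>j<N. c j / ln x ^ j)) \<in> O(\<lambda>x. 1 / ln x ^ N))"

lemma expands_imp_tendsto:
  assumes "expands f c"
  shows "(f \<longlongrightarrow> c 0) at_top"
proof -
  have "(\<lambda>x. f x - c 0) \<in> O(\<lambda>x. 1 / ln x ^ 1)"
    using assms[unfolded expands_def, rule_format, of 1] by simp
  also have "(\<lambda>x::real. 1 / ln x ^ 1) \<in> o(\<lambda>x. 1 / ln x ^ 0)" by (rule ln_power_smallo) simp
  finally have "((\<lambda>x. (f x - c 0) / (1 / ln x ^ 0)) \<longlongrightarrow> 0) at_top" by (rule smalloD_tendsto)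
  thus ?thesis by (simp add: LIM_zero_iff)
qed

text \<open>Equal constant terms cancel, so the factor \<open>ln x\<close> shifts the coefficients
  by one place; it is paid for by using both expansions at order \<open>Suc N\<close>.\<close>

lemma expands_diff_mult_ln:
  assumes f: "expands f c" and g: "expands g d" and "c 0 = d 0"
  shows "expands (\<lambda>x. (f x - g x) * ln x / r) (\<lambda>j. (c (Suc j) - d (Suc j)) / r)"
  unfolding expands_def
proof
  fix N
  have "(\<lambda>x. (f x - (\<Sum>j<Suc N. c j / ln x ^ j)) - (g x - (\<Sum>j<Suc N. d j / ln x ^ j)))
      \<in> O(\<lambda>x. 1 / ln x ^ Suc N)"
    by (rule sum_in_bigo(2)) (use f g in \<open>unfold expands_def, blast+\<close>)
  hence "(\<lambda>x. ((f x - (\<Sum>j<Suc N. c j / ln x ^ j)) - (g x - (\<Sum>j<Suc N. d j / ln x ^ j)))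
      * (ln x * (1 / r))) \<in> O(\<lambda>x. 1 / ln x ^ Suc N * (ln x * 1))"
    by (intro landau_o.big.mult) auto
  moreover have "(\<lambda>x. ((f x - (\<Sum>j<Suc N. c j / ln x ^ j)) - (g x - (\<Sum>j<Suc N. d j / ln x ^ j)))
      * (ln x * (1 / r))) \<in> O(\<lambda>x. 1 / ln x ^ Suc N * (ln x * 1)) \<longleftrightarrow>
     (\<lambda>x. (f x - g x) * ln x / r - (\<Sum>j<N. (c (Suc j) - d (Suc j)) / r / ln x ^ j))
      \<in> O(\<lambda>x. 1 / ln x ^ N)"
  proof (rule landau_o.big.cong_ex)
    show "\<forall>\<^sub>F x in at_top. ((f x - (\<Sum>j<Suc N. c j / ln x ^ j)) - (g x - (\<Sum>j<Suc N. d j / ln x ^ j)))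
      * (ln x * (1 / r)) =
       (f x - g x) * ln x / r - (\<Sum>j<N. (c (Suc j) - d (Suc j)) / r / ln x ^ j)"
      using eventually_gt_at_top[of 1]
    proof eventually_elim
      case (elim x)
      define s where "s = (\<Sum>j<N. (c (Suc j) - d (Suc j)) / ln x ^ j)"
      have "(\<Sum>j<Suc N. c j / ln x ^ j) - (\<Sum>j<Suc N. d j / ln x ^ j)
          = (\<Sum>j<N. (c (Suc j) - d (Suc j)) / ln x ^ Suc j)"
        unfolding sum.lessThan_Suc_shift using assms(3)
        by (simp add: sum_subtractf diff_divide_distrib)
      also have "\<dots> = s / ln x"
        unfolding s_def sum_divide_distrib by (simp add: field_simps)
      finally have "(f x - (\<Sum>j<Suc N. c j / ln x ^ j)) - (g x - (\<Sum>j<Suc N. d j / ln x ^ j))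
        = f x - g x - s / ln x" by simp
      moreover have "(\<Sum>j<N. (c (Suc j) - d (Suc j)) / r / ln x ^ j) = s / r"
        unfolding s_def sum_divide_distrib by (simp add: field_simps)
      moreover have "(f x - g x - s / ln x) * (ln x * (1 / r)) = (f x - g x) * ln x / r - s / r"
        using elim by (cases "r = 0") (simp_all add: field_simps)
      ultimately show ?case by (simp only:)
    qed
    show "\<forall>\<^sub>F x::real in at_top. 1 / ln x ^ Suc N * (ln x * 1) = 1 / ln x ^ N"
      using eventually_gt_at_top[of 1] by eventually_elim simp
  qed
  ultimately show "(\<lambda>x. (f x - g x) * ln x / r - (\<Sum>j<N. (c (Suc j) - d (Suc j)) / r / ln x ^ j))
      \<in> O(\<lambda>x. 1 / ln x ^ N)" by simp
qed

section \<open>Contiguous hypergeometric series and the chain of tails\<close>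

definition hyp_coeff :: "nat \<Rightarrow> nat \<Rightarrow> nat \<Rightarrow> real" where
  "hyp_coeff A B j = pochhammer (real A) j * pochhammer (real B) j / fact j"

lemma hyp_coeff_0 [simp]: "hyp_coeff A B 0 = 1"
  by (simp add: hyp_coeff_def)

lemma hyp_coeff_commute: "hyp_coeff A B = hyp_coeff B A"
  by (simp add: hyp_coeff_def fun_eq_iff)

text \<open>Both products contain \<open>pochhammer (x + 1) j\<close>; the remaining factors
  \<open>x + 1 + j\<close> and \<open>x\<close> differ by \<open>Suc j\<close>.\<close>

lemma pochhammer_Suc_diff:
  "pochhammer (x + 1) (Suc j) - pochhammer x (Suc j) = real (Suc j) * pochhammer (x + 1) j"
  for x :: real
  unfolding pochhammer_rec[of x] pochhammer_Suc[of "x + 1"] by (simp add: algebra_simps)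

text \<open>As series in \<open>z = 1 / ln x\<close>, this is
  \<open>2F0(A, B + 1) - 2F0(A, B) = A z 2F0(A + 1, B + 1)\<close>; the factor \<open>A\<close>
  becomes a partial numerator.\<close>

lemma hyp_coeff_contiguous:
  "hyp_coeff A (Suc B) (Suc j) - hyp_coeff A B (Suc j) = real A * hyp_coeff (Suc A) (Suc B) j"
proof -
  have "hyp_coeff A (Suc B) (Suc j) - hyp_coeff A B (Suc j) =
     pochhammer (real A) (Suc j) * (pochhammer (real B + 1) (Suc j) - pochhammer (real B) (Suc j))
       / fact (Suc j)"
    by (simp add: hyp_coeff_def diff_divide_distrib right_diff_distrib add.commute)
  also have "\<dots> = real A * pochhammer (real A + 1) j * pochhammer (real B + 1) j / fact j"
    unfolding pochhammer_Suc_diff pochhammer_rec[of "real A"] by (simp del: of_nat_Suc)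
  finally show ?thesis by (simp add: hyp_coeff_def add.commute)
qed

lemma expands_contiguous:
  assumes f: "expands f (hyp_coeff A B)" and g: "expands g (hyp_coeff A (Suc B))" and A: "A > 0"
  shows "expands (\<lambda>x. (f x - g x) * ln x / (- real A)) (hyp_coeff (Suc A) (Suc B))"
proof -
  have "expands (\<lambda>x. (f x - g x) * ln x / (- real A))
      (\<lambda>i. (hyp_coeff A B (Suc i) - hyp_coeff A (Suc B) (Suc i)) / (- real A))"
    using f g by (intro expands_diff_mult_ln) auto
  also have "(\<lambda>i. (hyp_coeff A B (Suc i) - hyp_coeff A (Suc B) (Suc i)) / (- real A)) =
      hyp_coeff (Suc A) (Suc B)"
  proof
    fix i
    show "(hyp_coeff A B (Suc i) - hyp_coeff A (Suc B) (Suc i)) / (- real A) = hyp_coeff (Suc A) (Suc B) i"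
      using hyp_coeff_contiguous[of A B i] A by (simp add: field_simps)
  qed
  finally show ?thesis .
qed

text \<open>The recursion \<open>X (i - 1) = X i + a (i + 1) / ln x * X (i + 1)\<close> solved for
  its last member. The \<open>2F0\<close> series only describe the members asymptotically, so the
  chain is grown from \<open>f\<close> itself; this makes the recursion an exact identity between
  functions.\<close>

fun cf_chain :: "nat \<Rightarrow> (real \<Rightarrow> real) \<Rightarrow> nat \<Rightarrow> real \<Rightarrow> real" where
  "cf_chain n f 0 x = 1"
| "cf_chain n f (Suc 0) x = ln x * f x"
| "cf_chain n f (Suc (Suc i)) x =
     (cf_chain n f i x - cf_chain n f (Suc i) x) * ln x / cfA2 n (Suc (Suc i)) x"

declare cf_chain.simps(3) [simp del]

lemma cfA2_nonzero:
  assumes "k \<ge> 1"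
  shows "cfA2 n k x \<noteq> 0"
proof (cases "k = 1")
  case False
  hence "k div 2 \<ge> 1" using assms by simp
  hence "real (k div 2) \<ge> 1" "real (n + k div 2) \<ge> 1" by linarith+
  thus ?thesis by (auto simp: cfA2_def simp del: of_nat_add)
qed (simp add: cfA2_def)

lemma cfA2_even: "cfA2 n (2 * Suc j) x = - real (n + Suc j)"
  by (simp add: cfA2_def)

lemma cfA2_odd: "cfA2 n (Suc (2 * Suc j)) x = - real (Suc j)"
  by (simp add: cfA2_def)

text \<open>The parameters are raised alternately. The pair \<open>(n + j + 1, j)\<close>,
  \<open>(n + j + 1, j + 1)\<close> produces the numerator \<open>n + j + 1\<close>; for the next
  step the symmetry of \<open>hyp_coeff\<close> exchanges the roles of the parameters, and the
  numerator is \<open>j + 1\<close>. The initial member 1 is the degenerate series with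
  \<open>B = 0\<close>.\<close>

lemma cf_chain_expands:
  assumes f: "expands (\<lambda>x. ln x * f x) (hyp_coeff (Suc n) 1)"
  shows "expands (cf_chain n f (2 * j)) (hyp_coeff (Suc (n + j)) j) \<and>
         expands (cf_chain n f (Suc (2 * j))) (hyp_coeff (Suc (n + j)) (Suc j))"
proof (induction j)
  case 0
  have "(\<Sum>j<N. hyp_coeff (Suc n) 0 j / ln x ^ j) = (if N = 0 then 0 else 1)" for N and x :: real
    by (cases N) (simp_all add: hyp_coeff_def sum.lessThan_Suc_shift pochhammer_rec del: sum.lessThan_Suc)
  hence "expands (\<lambda>_. 1) (hyp_coeff (Suc n) 0)"
    by (simp add: expands_def)
  moreover have "cf_chain n f 0 = (\<lambda>_. 1)" "cf_chain n f (Suc 0) = (\<lambda>x. ln x * f x)"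
    by (simp_all add: fun_eq_iff)
  ultimately show ?case using f by simp
next
  case (Suc j)
  have "cf_chain n f (2 * Suc j) = (\<lambda>x. (cf_chain n f (2 * j) x - cf_chain n f (Suc (2 * j)) x)
      * ln x / (- real (Suc (n + j))))"
    using cfA2_even[of n j] by (simp add: fun_eq_iff cf_chain.simps(3))
  hence even: "expands (cf_chain n f (2 * Suc j)) (hyp_coeff (Suc (n + Suc j)) (Suc j))"
    using Suc.IH expands_contiguous[of _ "Suc (n + j)" j] by simp
  have "cf_chain n f (Suc (2 * Suc j)) =
      (\<lambda>x. (cf_chain n f (Suc (2 * j)) x - cf_chain n f (2 * Suc j) x) * ln x / (- real (Suc j)))"
    using cfA2_odd[of n j] by (simp add: fun_eq_iff cf_chain.simps(3))
  moreover have "expands (cf_chain n f (Suc (2 * j))) (hyp_coeff (Suc j) (Suc (n + j)))"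
    "expands (cf_chain n f (2 * Suc j)) (hyp_coeff (Suc j) (Suc (Suc (n + j))))"
    using Suc.IH even by (simp_all add: hyp_coeff_commute[of "Suc j"])
  from expands_contiguous[OF this] have "expands (\<lambda>x. (cf_chain n f (Suc (2 * j)) x - cf_chain n f (2 * Suc j) x)
      * ln x / (- real (Suc j))) (hyp_coeff (Suc (Suc j)) (Suc (Suc (n + j))))" by simp
  ultimately show ?case using even by (simp only: hyp_coeff_commute[of "Suc (Suc j)"] add_Suc_right)
qed

lemma cf_chain_tendsto:
  assumes f: "expands (\<lambda>x. ln x * f x) (hyp_coeff (Suc n) 1)"
  shows "(cf_chain n f i \<longlongrightarrow> 1) at_top"
proof -
  have "i = 2 * (i div 2) \<or> i = Suc (2 * (i div 2))" by presburger
  thus ?thesis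
    using cf_chain_expands[OF f, of "i div 2"] expands_imp_tendsto hyp_coeff_0 by metis
qed

lemma cf_chain_rec:
  assumes "i \<ge> 1" "x > 1"
  shows "cf_chain n f (i - 1) x = cf_chain n f i x + cfA2 n (Suc i) x / ln x * cf_chain n f (Suc i) x"
proof -
  obtain j where j: "i = Suc j" using assms by (cases i) auto
  have "cfA2 n (Suc (Suc j)) x \<noteq> 0"
    by (rule cfA2_nonzero) simp
  thus ?thesis using assms unfolding j by (simp add: cf_chain.simps(3) field_simps)
qed

lemma ratio_bigo:
  fixes p q :: "real \<Rightarrow> real"
  assumes "(p \<longlongrightarrow> 1) at_top" "(q \<longlongrightarrow> 1) at_top"
  shows "(\<lambda>x. r * p x / (ln x ^ k * q x)) \<in> O(\<lambda>x. 1 / ln x ^ k)"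
proof -
  have "((\<lambda>x. r * p x / q x) \<longlongrightarrow> r * 1 / 1) at_top"
    using assms by (intro tendsto_intros) auto
  hence "(\<lambda>x. r * p x / q x) \<in> O(\<lambda>_. 1)"
    by (intro bigoI_tendsto[where c=r]) auto
  hence "(\<lambda>x. (r * p x / q x) * (1 / ln x ^ k)) \<in> O(\<lambda>x. 1 * (1 / ln x ^ k))"
    by (intro landau_o.big.mult) auto
  thus ?thesis by (simp add: field_simps)
qed

lemma cf_asymp_second:
  assumes f: "expands (\<lambda>x. ln x * f x) (hyp_coeff (Suc n) 1)"
  shows "cf_asymp f (cfA2 n) (cfB2 n)"
proof -
  define \<beta> :: "nat \<Rightarrow> nat" where "\<beta> k = (if odd k then 1 else 0)" for k
  define X where "X = cf_chain n f"
  have X1: "(X i \<longlongrightarrow> 1) at_top" for i unfolding X_def by (rule cf_chain_tendsto[OF f])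
  have B: "cfB2 n k x = ln x ^ \<beta> k" for k x by (simp add: cfB2_def \<beta>_def)
  interpret log_cf "cfA2 n" "cfB2 n" "\<lambda>k. cfA2 n k 0" \<beta>
  proof
    fix k :: nat assume "k \<ge> 1"
    thus "cfA2 n k 0 \<noteq> 0" by (rule cfA2_nonzero)
    show "cfB2 n k \<in> \<Theta>(\<lambda>x. ln x ^ \<beta> k)" by (simp add: B[abs_def])
  qed (simp_all add: fun_eq_iff cfA2_def \<beta>_def)
  \<comment> \<open>Dividing the chain relation by \<open>X k\<close> gives the recursion of the
    tails; it fits both parities because \<open>\<beta> k + \<beta> (Suc k) = 1\<close> matches the
    single factor \<open>1 / ln x\<close>. All members tend to 1, so the divisions are eventually
    legitimate.\<close>
  define g where "g k x = cfA2 n k 0 * X k x / (ln x ^ \<beta> k * X (k - 1) x)" for k x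
  have A: "cfA2 n k x = cfA2 n k 0" for k x by (simp add: cfA2_def)
  show ?thesis
  proof (rule cf_asymp_if_tails)
    fix k :: nat assume k: "k \<ge> 1"
    have pos: "\<forall>\<^sub>F x in at_top. X i x > 0" for i
      using order_tendstoD(1)[OF X1[of i], of 0] by simp
    show "\<forall>\<^sub>F x in at_top. g k x = cfA2 n k x / (cfB2 n k x + g (Suc k) x)"
      using pos[of k] pos[of "k - 1"] pos[of "Suc k"] eventually_gt_at_top[of 1]
    proof eventually_elim
      case (elim x)
      have L: "ln x > 0" using elim by simp
      have rec: "X (k - 1) x = X k x + cfA2 n (Suc k) 0 / ln x * X (Suc k) x"
        using cf_chain_rec[OF k \<open>x > 1\<close>, of n f] unfolding X_def A[of "Suc k" x] .
      have "cfB2 n k x + g (Suc k) x = ln x ^ \<beta> k * X (k - 1) x / X k x"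
        using elim L unfolding rec B g_def by (cases "odd k") (simp_all add: \<beta>_def field_simps)
      thus ?case using elim L by (simp add: g_def A[of k x] mult.commute)
    qed
    show "g k \<in> O(\<lambda>x. 1 / ln x ^ \<beta> k)"
      unfolding g_def[abs_def] by (intro ratio_bigo X1)
  next
    show "\<forall>\<^sub>F x in at_top. f x = g 1 x"
      using eventually_gt_at_top[of 1]
      by eventually_elim (simp add: g_def X_def \<beta>_def cfA2_def)
  qed
qed

text \<open>Eliminates \<open>X2\<close>, the member that the even part of the fraction
  skips.\<close>

lemma contract_recurrence:
  fixes X0 X1 X2 X3 c d L :: real
  assumes "X0 = X1 + (- c) / L * X2" "X1 = X2 + (- d) / L * X3"
  shows "X0 = (1 - c / L) * X1 + (- (c * d)) / L\<^sup>2 * X3"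
proof -
  have X2: "X2 = X1 + d / L * X3" using assms(2) by simp
  show ?thesis unfolding assms(1) X2 by (simp add: algebra_simps power2_eq_square)
qed

text \<open>Extends the contracted relation one member to the left. The numerators \<open>s\<close>
  and \<open>d\<close> add up, which is where the shift \<open>n + 2 * k - 1\<close> in the
  denominators of the first fraction comes from.\<close>

lemma contract_step:
  fixes X0 X1 X2 X3 d s L :: real
  assumes "X0 = X1 + (- d) / L * X2" "X1 = (1 - s / L) * X2 + r / L\<^sup>2 * X3"
  shows "X0 = (1 - (s + d) / L) * X2 + r / L\<^sup>2 * X3"
  unfolding assms by (simp add: algebra_simps add_divide_distrib)

lemma tail_step:
  fixes L :: real
  assumes "Z = (1 - s / L) * X + r / L\<^sup>2 * Y" "L \<noteq> 0" "X \<noteq> 0"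
  shows "(L - s) + r * Y / (L * X) = L * Z / X"
  unfolding assms(1) using assms(2,3) by (simp add: field_simps power2_eq_square)

lemma cf_asymp_first:
  assumes f: "expands (\<lambda>x. ln x * f x) (hyp_coeff (Suc n) 1)"
  shows "cf_asymp f (cfA1 n) (cfB1 n)"
proof -
  text \<open>The first continued fraction is the even part of the second one; eliminating the
    even-indexed members of the chain contracts its recursion.\<close>
  define Y where "Y i = (if i = 0 then cf_chain n f 0 else cf_chain n f (2 * i - 1))" for i
  have Y1: "(Y i \<longlongrightarrow> 1) at_top" for i unfolding Y_def using cf_chain_tendsto[OF f] by simp
  interpret log_cf "cfA1 n" "cfB1 n" "\<lambda>k. cfA1 n k 0" "\<lambda>_. 1"
  proof
    fix k :: nat assume "k \<ge> 1"
    thus "cfA1 n k 0 \<noteq> 0" by (auto simp: cfA1_def)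
    show "cfB1 n k \<in> \<Theta>(\<lambda>x. ln x ^ 1)" unfolding cfB1_def[abs_def] by real_asymp
  qed (simp_all add: fun_eq_iff cfA1_def)
  define g where "g k x = cfA1 n k 0 * Y k x / (ln x ^ 1 * Y (k - 1) x)" for k x
  have A: "cfA1 n k x = cfA1 n k 0" for k x by (simp add: cfA1_def)
  have rec: "Y (k - 1) x = (1 - (real n + 2 * real k - 1) / ln x) * Y k x
      + cfA1 n (Suc k) x / (ln x)\<^sup>2 * Y (Suc k) x" if k: "k \<ge> 1" and x: "x > 1" for k x
  proof -
    obtain j where j: "k = Suc j" using k by (cases k) auto
    let ?X = "\<lambda>i. cf_chain n f i x"
    have L: "ln x > 0" using x by simp
    have e1: "?X (Suc (2*j)) = ?X (2 * Suc j) + (- real (Suc j)) / ln x * ?X (Suc (2 * Suc j))"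
      using cf_chain_rec[of "2 * Suc j" x n f] x cfA2_odd[of n j] by simp
    have e0: "?X (2 * j) = ?X (Suc (2 * j)) + (- real (n + Suc j)) / ln x * ?X (2 * Suc j)"
      using cf_chain_rec[of "Suc (2 * j)" x n f] x cfA2_even[of n j] by simp
    have e2: "?X (2 * j) = (1 - real (n + Suc j) / ln x) * ?X (Suc (2*j))
       + (- (real (n + Suc j) * real (Suc j))) / (ln x)\<^sup>2 * ?X (Suc (2 * Suc j))"
      by (rule contract_recurrence[OF e0 e1])
    have Yk: "Y k x = ?X (Suc (2 * j))" "Y (Suc k) x = ?X (Suc (2 * Suc j))"
      by (simp_all add: Y_def j)
    \<comment> \<open>\<open>Y 0\<close> is the only member with even index in the chain, so for
      \<open>j = 0\<close> the relation \<open>e2\<close> is already the claim; otherwise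
      \<open>e3\<close> leads back to the previous odd member.\<close>
    show ?thesis
    proof (cases j)
      case 0
      thus ?thesis using e2 unfolding Yk by (simp add: Y_def j cfA1_def)
    next
      case (Suc i)
      have e3: "?X (Suc (2*i)) = ?X (2 * j) + (- real j) / ln x * ?X (Suc (2 * j))"
        using cf_chain_rec[of "2 * j" x n f] x cfA2_odd[of n i] Suc by simp
      moreover have "Y (k - 1) x = ?X (Suc (2 * i))" by (simp add: Y_def j Suc)
      moreover note contract_step[OF e3 e2]
      ultimately show ?thesis unfolding Yk
        by (simp add: j cfA1_def algebra_simps)
    qed
  qed
  show ?thesis
  proof (rule cf_asymp_if_tails)
    fix k :: nat assume k: "k \<ge> 1"
    have pos: "\<forall>\<^sub>F x in at_top. Y i x > 0" for i
      using order_tendstoD(1)[OF Y1[of i], of 0] by simp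
    show "\<forall>\<^sub>F x in at_top. g k x = cfA1 n k x / (cfB1 n k x + g (Suc k) x)"
      using pos[of k] pos[of "k - 1"] pos[of "Suc k"] eventually_gt_at_top[of 1]
    proof eventually_elim
      case (elim x)
      have L: "ln x > 0" using elim by simp
      have "ln x - (real n + 2 * real k - 1) + cfA1 n (Suc k) x * Y (Suc k) x / (ln x * Y k x)
          = ln x * Y (k - 1) x / Y k x"
        by (rule tail_step[OF rec[OF k \<open>x > 1\<close>]]) (use elim L in auto)
      hence "cfB1 n k x + g (Suc k) x = ln x * Y (k - 1) x / Y k x"
        by (simp add: g_def cfB1_def A[of _ x] algebra_simps)
      thus ?case using elim L by (simp add: g_def A[of k x] mult.commute)
    qed
    show "g k \<in> O(\<lambda>x. 1 / ln x ^ 1)"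
      unfolding g_def[abs_def] by (intro ratio_bigo Y1)
  next
    show "\<forall>\<^sub>F x in at_top. f x = g 1 x"
      using eventually_gt_at_top[of 1]
      by eventually_elim (simp add: g_def Y_def cfA1_def)
  qed
qed

section \<open>The zeta function near the line of convergence\<close>

text \<open>\<open>x powr - s\<close> for \<open>x > 0\<close>, written so that it is entire in
  \<open>s\<close>. At \<open>x = 0\<close> the convention \<open>ln 0 = 0\<close> makes it 1, so
  the coefficients of the Dirichlet series below are required to vanish at 0.\<close>

definition negpow :: "real \<Rightarrow> complex \<Rightarrow> complex" where
  "negpow x s = exp (- (s * of_real (ln x)))"

lemma norm_negpow: "x > 0 \<Longrightarrow> norm (negpow x s) = x powr (- Re s)"
  by (simp add: negpow_def powr_def)

lemma negpow_1 [simp]: "negpow 1 s = 1"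
  by (simp add: negpow_def)

lemma negpow_mult: "x > 0 \<Longrightarrow> y > 0 \<Longrightarrow> negpow (x * y) s = negpow x s * negpow y s"
proof -
  assume "x > 0" "y > 0"
  hence "- (s * complex_of_real (ln (x * y))) = - (s * of_real (ln x)) + - (s * of_real (ln y))"
    by (simp add: ln_mult algebra_simps)
  thus ?thesis unfolding negpow_def by (simp only: exp_add)
qed

lemma negpow_holomorphic [holomorphic_intros]: "negpow x holomorphic_on A"
  unfolding negpow_def[abs_def] by (intro holomorphic_intros)

lemma negpow_deriv:
  "(negpow x has_field_derivative (- of_real (ln x) * negpow x s)) (at s within A)"
  unfolding negpow_def[abs_def] by (auto intro!: derivative_eq_intros)

lemma real_segment_bound:
  fixes f f' :: "complex \<Rightarrow> complex"
  assumes "a \<le> b" "x \<in> {a..b}" "y \<in> {a..b}"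
    and "\<And>u. u \<in> {a..b} \<Longrightarrow> (f has_field_derivative f' (of_real u)) (at (of_real u))"
    and "\<And>u. u \<in> {a..b} \<Longrightarrow> norm (f' (of_real u)) \<le> B"
  shows "norm (f (of_real y) - f (of_real x)) \<le> B * \<bar>y - x\<bar>"
proof -
  let ?S = "closed_segment (of_real a) (of_real b :: complex)"
  have S: "?S = of_real ` {a..b}"
    using assms(1) by (simp add: closed_segment_of_real closed_segment_eq_real_ivl)
  have "norm (f (of_real y) - f (of_real x)) \<le> B * norm (of_real y - of_real x :: complex)"
  proof (rule field_differentiable_bound[of ?S f f'])
    fix z assume "z \<in> ?S"
    then obtain u where "u \<in> {a..b}" "z = of_real u" unfolding S by auto
    thus "(f has_field_derivative f' z) (at z within ?S)" "norm (f' z) \<le> B"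
      using assms(4,5) by (auto intro: has_field_derivative_at_within)
  next
    show "convex ?S" by (rule convex_closed_segment)
    show "of_real y \<in> ?S" "of_real x \<in> ?S" unfolding S using assms(2,3) by blast+
  qed
  thus ?thesis by (simp flip: of_real_diff)
qed

lemma negpow_powr: "x > 0 \<Longrightarrow> negpow x s = of_real x powr (- s)"
  by (simp add: negpow_def powr_def Ln_of_real mult.commute)

lemma negpow_diff_bound:
  assumes "0 < a" "a \<le> b" "Re s \<ge> 0"
  shows "norm (negpow b s - negpow a s) \<le> norm s * a powr (- Re s - 1) * (b - a)"
proof -
  have "norm ((of_real b powr (- s) :: complex) - of_real a powr (- s))
      \<le> (norm s * a powr (- Re s - 1)) * \<bar>b - a\<bar>"
  proof (rule real_segment_bound[where f = "\<lambda>z. z powr (- s)" and f' = "\<lambda>z. - s * z powr (- s - 1)"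
        and a = a and b = b])
    fix u assume u: "u \<in> {a..b}"
    show "((\<lambda>z. z powr (- s)) has_field_derivative - s * of_real u powr (- s - 1)) (at (of_real u))"
      using u assms by (intro has_field_derivative_powr) auto
    have "norm (of_real u powr (- s - 1) :: complex) = u powr (- Re s - 1)"
      using u assms by (subst norm_powr_real_powr) auto
    also have "\<dots> \<le> a powr (- Re s - 1)"
      using u assms by (intro powr_mono2') auto
    finally show "norm (- s * of_real u powr (- s - 1)) \<le> norm s * a powr (- Re s - 1)"
      by (simp add: norm_mult mult_left_mono)
  qed (use assms in auto)
  thus ?thesis using assms by (simp add: negpow_powr)
qed

text \<open>With \<open>m = n + 1\<close> this is \<open>s - 1\<close> times the integral of
  \<open>m powr - s - u powr - s\<close> over \<open>u\<close> from \<open>m\<close> to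
  \<open>m + 1\<close>. The first summand belongs to \<open>(s - 1) * zeta s\<close>, the other two
  telescope.\<close>

definition zterm :: "nat \<Rightarrow> complex \<Rightarrow> complex" where
  "zterm n s = (s - 1) * negpow (Suc n) s - of_nat (Suc n) * negpow (Suc n) s
     + of_nat (Suc (Suc n)) * negpow (Suc (Suc n)) s"

lemma zterm_bound_min:
  assumes "Re s \<ge> 0"
  shows "norm (zterm n s) \<le> norm (s - 1) * (real (Suc n) powr (- Re s) * min (norm s / real (Suc n)) 2)"
proof -
  define m where "m = real (Suc n)"
  have m: "m \<ge> 1" "m > 0" by (auto simp: m_def)
  \<comment> \<open>\<open>?h\<close> is a primitive of
    \<open>(s - 1) * (m powr - s - z powr - s)\<close> in \<open>z\<close>; its increment from
    \<open>m\<close> to \<open>m + 1\<close> is \<open>zterm n s\<close>, also at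
    \<open>s = 1\<close>.\<close>
  let ?h = "\<lambda>z. (s - 1) * negpow m s * z + z * z powr (- s)"
  let ?h' = "\<lambda>z. (s - 1) * negpow m s + (z * (- s * z powr (- s - 1)) + z powr (- s))"
  have "norm (?h (of_real (m + 1)) - ?h (of_real m))
      \<le> norm (s - 1) * (m powr (- Re s) * min (norm s / m) 2) * \<bar>(m + 1) - m\<bar>"
  proof (rule real_segment_bound[where f' = ?h' and a = m and b = "m + 1"])
    fix u assume u: "u \<in> {m..m+1}"
    hence u0: "u > 0" using m by auto
    have pos: "complex_of_real u \<notin> \<real>\<^sub>\<le>\<^sub>0" using u0 by auto
    show "(?h has_field_derivative ?h' (of_real u)) (at (of_real u))"
      using pos by (auto intro!: derivative_eq_intros simp: algebra_simps)
    have "of_real u * (of_real u powr (- s - 1)) = of_real u powr (- s)"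
      using u0 by (simp add: powr_diff)
    hence "?h' (of_real u) = (s - 1) * negpow m s - (s - 1) * of_real u powr (- s)"
      by (simp add: algebra_simps)
    also have "\<dots> = (s - 1) * (negpow m s - negpow u s)"
      using u0 by (simp add: negpow_powr algebra_simps)
    finally have eq: "norm (?h' (of_real u)) = norm (s - 1) * norm (negpow u s - negpow m s)"
      by (simp add: norm_mult norm_minus_commute)
    have "norm (negpow u s - negpow m s) \<le> norm s * m powr (- Re s - 1) * (u - m)"
      using negpow_diff_bound[of m u s] u m assms by auto
    also have "\<dots> \<le> norm s * m powr (- Re s - 1) * 1"
      using u by (intro mult_left_mono) auto
    also have "\<dots> = m powr (- Re s) * (norm s / m)"
      using m by (simp add: powr_diff)
    finally have b1: "norm (negpow u s - negpow m s) \<le> m powr (- Re s) * (norm s / m)" .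
    have "norm (negpow u s - negpow m s) \<le> u powr (- Re s) + m powr (- Re s)"
      using norm_triangle_ineq4[of "negpow u s" "negpow m s"] u0 m by (simp add: norm_negpow)
    also have "u powr (- Re s) \<le> m powr (- Re s)" using u m assms by (intro powr_mono2') auto
    finally have b2: "norm (negpow u s - negpow m s) \<le> m powr (- Re s) * 2" by simp
    have "norm (negpow u s - negpow m s) \<le> m powr (- Re s) * min (norm s / m) 2"
      using b1 b2 by (simp add: min_def)
    thus "norm (?h' (of_real u)) \<le> norm (s - 1) * (m powr (- Re s) * min (norm s / m) 2)"
      unfolding eq by (intro mult_left_mono) auto
  qed auto
  moreover have "zterm n s = ?h (of_real (m + 1)) - ?h (of_real m)"
    using m by (simp add: zterm_def m_def negpow_powr algebra_simps)
  ultimately show ?thesis by (simp add: m_def)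
qed

text \<open>Interpolation by \<open>min y 2 \<le> 2 * y powr \<theta>\<close>. The choice
  \<open>\<theta> = 1\<close> gives convergence for \<open>Re s > 0\<close>; a small
  \<open>\<theta>\<close> trades room to the left for slower growth in \<open>s\<close>.\<close>

lemma zterm_bound:
  assumes "Re s \<ge> 0" "0 \<le> \<theta>" "\<theta> \<le> 1"
  shows "norm (zterm n s) \<le> 2 * norm (s - 1) * norm s powr \<theta> * real (Suc n) powr (- Re s - \<theta>)"
proof -
  define m where "m = real (Suc n)"
  have m: "m \<ge> 1" "m > 0" by (auto simp: m_def)
  have "min (norm s / m) 2 \<le> 2 * (norm s / m) powr \<theta>"
  proof (cases "norm s / m \<le> 1")
    case True
    have "norm s / m \<le> (norm s / m) powr \<theta>"
    proof (cases "s = 0")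
      case False
      thus ?thesis using powr_mono'[of \<theta> 1 "norm s / m"] True assms m by auto
    qed simp
    also have "\<dots> \<le> 2 * (norm s / m) powr \<theta>" by simp
    finally show ?thesis by (simp add: min.coboundedI1)
  next
    case False
    hence "(norm s / m) powr \<theta> \<ge> 1" using assms by (intro ge_one_powr_ge_zero) auto
    thus ?thesis by simp
  qed
  hence "norm (s - 1) * (m powr (- Re s) * min (norm s / m) 2) \<le>
      norm (s - 1) * (m powr (- Re s) * (2 * (norm s / m) powr \<theta>))"
    by (intro mult_left_mono) auto
  also have "\<dots> = 2 * norm (s - 1) * norm s powr \<theta> * m powr (- Re s - \<theta>)"
    using m by (simp add: powr_divide powr_diff)
  finally show ?thesis using zterm_bound_min[OF assms(1), of n] by (simp add: m_def)
qed

lemma summable_Suc_powr: "p < -1 \<Longrightarrow> summable (\<lambda>n. real (Suc n) powr p)"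
  using summable_real_powr_iff[of p] summable_Suc_iff[of "\<lambda>n. real n powr p"] by blast

text \<open>The function \<open>(s - 1) * zeta s\<close> continued to \<open>Re s > 0\<close>, with
  the pole of zeta removed.\<close>

definition Zeta1 :: "complex \<Rightarrow> complex" where
  "Zeta1 s = 1 + (\<Sum>n. zterm n s)"

lemma zterm_summable:
  assumes "Re s > 0"
  shows "summable (\<lambda>n. norm (zterm n s))"
proof (rule summable_comparison_test')
  show "summable (\<lambda>n. 2 * norm (s - 1) * norm s powr 1 * real (Suc n) powr (- Re s - 1))"
    using assms by (intro summable_mult summable_Suc_powr) auto
  show "norm (norm (zterm n s)) \<le> 2 * norm (s - 1) * norm s powr 1 * real (Suc n) powr (- Re s - 1)"
    for n unfolding real_norm_def abs_norm_cancel by (rule zterm_bound) (use assms in auto)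
qed

lemma Zeta1_holomorphic: "Zeta1 holomorphic_on {s. Re s > 0}"
proof (rule holomorphic_uniform_sequence[where f = "\<lambda>N s. 1 + (\<Sum>n<N. zterm n s)"])
  show "open {s. 0 < Re s}" by (rule open_halfspace_Re_gt)
  show "(\<lambda>s. 1 + (\<Sum>n<N. zterm n s)) holomorphic_on {s. 0 < Re s}" for N
    unfolding zterm_def[abs_def] by (intro holomorphic_intros)
  fix z :: complex assume z: "z \<in> {s. 0 < Re s}"
  define d where "d = Re z / 2"
  have d: "d > 0" using z by (auto simp: d_def)
  define K where "K = norm z + d + 1"
  have near: "Re w \<ge> d" "norm w \<le> K" "norm (w - 1) \<le> K" if "w \<in> cball z d" for w
  proof -
    have *: "norm (w - z) \<le> d" using that by (simp add: dist_norm norm_minus_commute)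
    have "\<bar>Re (w - z)\<bar> \<le> d" using abs_Re_le_cmod[of "w - z"] * by linarith
    thus "Re w \<ge> d" unfolding d_def minus_complex.sel by linarith
    have "norm w \<le> norm z + d" using * norm_triangle_ineq2[of w z] by linarith
    thus "norm w \<le> K" "norm (w - 1) \<le> K"
      using norm_triangle_ineq4[of w 1] by (simp_all add: K_def)
  qed
  have K: "K \<ge> 0" using d by (simp add: K_def)
  have "uniform_limit (cball z d) (\<lambda>N s. \<Sum>n<N. zterm n s) (\<lambda>s. \<Sum>n. zterm n s) sequentially"
  proof (rule Weierstrass_m_test[where M = "\<lambda>n. 2 * K * K * real (Suc n) powr (- d - 1)"])
    fix n w assume w: "w \<in> cball z d"
    have "norm (zterm n w) \<le> 2 * norm (w - 1) * norm w powr 1 * real (Suc n) powr (- Re w - 1)"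
      using near(1)[OF w] d by (intro zterm_bound) auto
    also have "\<dots> \<le> 2 * K * K * real (Suc n) powr (- d - 1)"
      using near[OF w] K by (intro mult_mono powr_mono) auto
    finally show "norm (zterm n w) \<le> 2 * K * K * real (Suc n) powr (- d - 1)" .
  qed (use d in \<open>intro summable_mult summable_Suc_powr, auto\<close>)
  hence "uniform_limit (cball z d) (\<lambda>N s. 1 + (\<Sum>n<N. zterm n s)) Zeta1 sequentially"
    unfolding Zeta1_def[abs_def] by (intro uniform_limit_intros)
  moreover have "cball z d \<subseteq> {s. 0 < Re s}" using near(1) d by fastforce
  ultimately show "\<exists>d>0. cball z d \<subseteq> {s. 0 < Re s} \<and>
      uniform_limit (cball z d) (\<lambda>N s. 1 + (\<Sum>n<N. zterm n s)) Zeta1 sequentially"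
    using d by blast
qed

lemma Zeta1_1 [simp]: "Zeta1 1 = 1"
proof -
  have "of_nat (Suc n) * negpow (Suc n) 1 = 1" for n
    using of_nat_neq_0[of n, where ?'a = complex]
    by (simp add: negpow_powr powr_minus del: of_nat_Suc)
  hence "zterm n 1 = 0" for n
    by (simp add: zterm_def del: of_nat_Suc)
  thus ?thesis by (simp add: Zeta1_def)
qed

text \<open>For \<open>\<theta> = 2 e\<close> the bound of the terms gives polynomial growth of arbitrarily small exponent
  to the right of \<open>Re s = 1 - e\<close>.\<close>

lemma Zeta1_growth:
  assumes "0 < e" "e \<le> 1 / 2"
  obtains C where "C > 0"
    "\<And>s. Re s \<ge> 1 - e \<Longrightarrow> norm (Zeta1 s - 1) \<le> C * norm (s - 1) * norm s powr (2 * e)"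
proof -
  define S where "S = (\<Sum>n. real (Suc n) powr (- 1 - e))"
  have sm: "summable (\<lambda>n. real (Suc n) powr (- 1 - e))"
    using assms by (intro summable_Suc_powr) auto
  have S: "S \<ge> 0" unfolding S_def by (intro suminf_nonneg sm) auto
  have "norm (Zeta1 s - 1) \<le> (2 * S + 1) * norm (s - 1) * norm s powr (2 * e)"
    if s: "Re s \<ge> 1 - e" for s
  proof -
    let ?c = "2 * norm (s - 1) * norm s powr (2 * e)"
    have Re: "Re s > 0" using s assms by auto
    have "norm (Zeta1 s - 1) = norm (\<Sum>n. zterm n s)" by (simp add: Zeta1_def)
    also have "\<dots> \<le> (\<Sum>n. norm (zterm n s))"
      by (intro summable_norm zterm_summable Re)
    also have "\<dots> \<le> (\<Sum>n. ?c * real (Suc n) powr (- 1 - e))"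
    proof (intro suminf_le zterm_summable Re summable_mult sm)
      fix n
      have "norm (zterm n s) \<le> ?c * real (Suc n) powr (- Re s - 2 * e)"
        using assms Re by (intro zterm_bound) auto
      also have "\<dots> \<le> ?c * real (Suc n) powr (- 1 - e)"
        using s by (intro mult_left_mono powr_mono) auto
      finally show "norm (zterm n s) \<le> ?c * real (Suc n) powr (- 1 - e)" .
    qed
    also have "\<dots> = ?c * S" unfolding S_def by (intro suminf_mult sm)
    also have "\<dots> \<le> (2 * S + 1) * norm (s - 1) * norm s powr (2 * e)"
      by (simp add: algebra_simps)
    finally show ?thesis .
  qed
  with S show ?thesis by (intro that[of "2 * S + 1"]) auto
qed

section \<open>Dirichlet series\<close>

definition dseries :: "(nat \<Rightarrow> real) \<Rightarrow> complex \<Rightarrow> complex" where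
  "dseries c s = (\<Sum>n. of_real (c n) * negpow n s)"

locale dirichlet_coeffs =
  fixes c :: "nat \<Rightarrow> real"
  assumes c0: "c 0 = 0"
    and c_summable: "\<And>r. r > 1 \<Longrightarrow> summable (\<lambda>n. \<bar>c n\<bar> * real n powr (- r))"
begin

lemma norm_term: "norm (of_real (c n) * negpow n s) = \<bar>c n\<bar> * real n powr (- Re s)"
proof (cases "n = 0")
  case False
  hence "norm (negpow (real n) s) = real n powr (- Re s)" by (intro norm_negpow) simp
  thus ?thesis by (simp only: norm_mult norm_of_real)
qed (simp add: c0)

lemma summable_norm_term:
  "Re s > 1 \<Longrightarrow> summable (\<lambda>n. norm (of_real (c n) * negpow n s))"
  unfolding norm_term by (rule c_summable)

lemma dseries_sums:
  "Re s > 1 \<Longrightarrow> (\<lambda>n. of_real (c n) * negpow n s) sums dseries c s"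
  unfolding dseries_def by (rule summable_sums, rule summable_norm_cancel, rule summable_norm_term)

lemma dseries_deriv:
  assumes s: "Re s > 1"
  shows "(dseries c has_field_derivative dseries (\<lambda>n. - c n * ln n) s) (at s)"
proof -
  let ?S = "{s. Re s > 1}"
  have "\<exists>g g'. \<forall>x\<in>?S. (\<lambda>n. of_real (c n) * negpow n x) sums g x \<and>
     (\<lambda>n. of_real (c n) * (- of_real (ln n) * negpow n x)) sums g' x \<and>
     (g has_field_derivative g' x) (at x)"
  proof (rule series_and_derivative_comparison_complex)
    show "open ?S" by (rule open_halfspace_Re_gt)
    show "((\<lambda>s. of_real (c n) * negpow n s) has_field_derivative
        of_real (c n) * (- of_real (ln n) * negpow n x)) (at x)" for n x
      by (intro DERIV_cmult negpow_deriv)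
    fix x assume "x \<in> ?S"
    hence x: "Re x > 1" by simp
    define d where "d = (Re x - 1) / 2"
    define h where "h n = \<bar>c n\<bar> * real n powr (- (1 + d))" for n
    have d: "d > 0" using x by (simp add: d_def)
    have "norm (of_real (c n) * negpow n y) \<le> norm (of_real (h n) :: complex)" if "y \<in> ball x d" for n y
    proof -
      have "\<bar>Re (x - y)\<bar> < d"
        using that abs_Re_le_cmod[of "x - y"] by (simp add: dist_norm)
      hence y: "Re y \<ge> 1 + d" unfolding d_def minus_complex.sel by argo
      show ?thesis
      proof (cases "n = 0")
        case False
        hence "real n powr (- Re y) \<le> real n powr (- (1 + d))" using y by (intro powr_mono) auto
        thus ?thesis unfolding norm_term norm_of_real h_def abs_mult by (simp add: mult_left_mono)
      qed (simp add: c0)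
    qed
    moreover have "summable (\<lambda>n. complex_of_real (h n))"
      unfolding h_def by (intro summable_of_real c_summable) (use d in auto)
    moreover have "range (\<lambda>n. complex_of_real (h n)) \<subseteq> \<real>\<^sub>\<ge>\<^sub>0"
      by (auto simp: h_def)
    ultimately show "\<exists>d (h :: nat \<Rightarrow> complex). 0 < d \<and> summable h \<and> range h \<subseteq> \<real>\<^sub>\<ge>\<^sub>0 \<and>
        (\<forall>\<^sub>F n in sequentially. \<forall>y\<in>ball x d \<inter> ?S. norm (of_real (c n) * negpow n y) \<le> norm (h n))"
      using d by (intro exI[of _ d] exI[of _ "\<lambda>n. complex_of_real (h n)"]) auto
  qed
  then obtain g g' where g: "\<And>x. Re x > 1 \<Longrightarrow> (\<lambda>n. of_real (c n) * negpow n x) sums g x"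
     "\<And>x. Re x > 1 \<Longrightarrow> (\<lambda>n. of_real (c n) * (- of_real (ln n) * negpow n x)) sums g' x"
     "\<And>x. Re x > 1 \<Longrightarrow> (g has_field_derivative g' x) (at x)" by auto
  have eq: "g x = dseries c x" if "Re x > 1" for x
    using g(1)[OF that] dseries_sums[OF that] by (rule sums_unique2)
  have "g' s = dseries (\<lambda>n. - c n * ln n) s"
    using sums_unique[OF g(2)[OF s]] unfolding dseries_def by (simp add: mult_ac)
  hence "(g has_field_derivative dseries (\<lambda>n. - c n * ln n) s) (at s)" using g(3)[OF s] by simp
  thus ?thesis
    by (rule has_field_derivative_transform_within_open[where S = ?S])
       (use s eq in \<open>auto simp: open_halfspace_Re_gt\<close>)
qed

lemma dseries_holomorphic: "dseries c holomorphic_on {s. Re s > 1}"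
  using dseries_deriv by (auto simp: holomorphic_on_def field_differentiable_def
      intro: has_field_derivative_at_within)

end

definition unit_coeff :: "nat \<Rightarrow> real" where
  "unit_coeff n = (if n = 0 then 0 else 1)"

interpretation unit: dirichlet_coeffs unit_coeff
proof
  fix r :: real assume "r > 1"
  hence "summable (\<lambda>n. real n powr (- r))" using summable_real_powr_iff[of "- r"] by simp
  thus "summable (\<lambda>n. \<bar>unit_coeff n\<bar> * real n powr (- r))"
    by (rule summable_cong[THEN iffD2, rotated]) (auto simp: unit_coeff_def eventually_sequentially)
qed (simp add: unit_coeff_def)

abbreviation "zeta \<equiv> dseries unit_coeff"

lemma mangoldt_nonneg: "(mangoldt n :: real) \<ge> 0"
proof (cases "primepow n")
  case True
  hence "aprimedivisor n > 0" using primepow_gt_Suc_0[of n] by (intro aprimedivisor_pos_nat) simp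
  thus ?thesis by (simp add: mangoldt_def)
qed (simp add: mangoldt_def)

lemma mangoldt_le_ln: "n > 0 \<Longrightarrow> (mangoldt n :: real) \<le> ln n"
proof -
  assume n: "n > 0"
  have "(mangoldt n :: real) \<le> (\<Sum>d | d dvd n. mangoldt d)"
    using n by (intro member_le_sum) (auto simp: mangoldt_nonneg)
  thus ?thesis using mangoldt_sum[of n, where ?'a = real] n by simp
qed

lemma summable_ln_powr:
  assumes "r > 1"
  shows "summable (\<lambda>n. ln (real n) * real n powr (- r))"
proof -
  define \<delta> where "\<delta> = (r - 1) / 2"
  have \<delta>: "\<delta> > 0" using assms by (simp add: \<delta>_def)
  show ?thesis
  proof (rule summable_comparison_test')
    show "summable (\<lambda>n. 1 / \<delta> * real n powr (\<delta> - r))"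
      using summable_real_powr_iff[of "\<delta> - r"] assms
      by (intro summable_mult) (auto simp: \<delta>_def field_simps)
    show "norm (ln (real n) * real n powr (- r)) \<le> 1 / \<delta> * real n powr (\<delta> - r)" if "n \<ge> 1" for n
    proof -
      have "ln (real n) \<le> real n powr \<delta> / \<delta>" using that \<delta> by (intro ln_powr_bound) auto
      hence "ln (real n) * real n powr (- r) \<le> real n powr \<delta> / \<delta> * real n powr (- r)"
        by (intro mult_right_mono) auto
      also have "\<dots> = 1 / \<delta> * real n powr (\<delta> - r)"
        by (simp add: powr_diff powr_minus field_simps)
      finally show ?thesis using that by simp
    qed
  qed
qed

interpretation mangoldt: dirichlet_coeffs mangoldt
proof
  fix r :: real assume r: "r > 1"
  show "summable (\<lambda>n. \<bar>mangoldt n\<bar> * real n powr (- r))"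
  proof (rule summable_comparison_test')
    show "summable (\<lambda>n. ln (real n) * real n powr (- r))" by (rule summable_ln_powr[OF r])
    show "norm (\<bar>mangoldt n\<bar> * real n powr (- r)) \<le> ln (real n) * real n powr (- r)" if "n \<ge> 1" for n
      using mangoldt_nonneg[of n] mangoldt_le_ln[of n] that by (simp add: mult_right_mono abs_mult)
  qed
qed simp

lemma Zeta1_eq:
  assumes s: "Re s > 1"
  shows "Zeta1 s = (s - 1) * zeta s"
proof -
  let ?a = "\<lambda>n. of_real (unit_coeff n) * negpow n s"
  have "?a sums zeta s" by (rule unit.dseries_sums[OF s])
  hence "(\<lambda>n. ?a (Suc n)) sums zeta s"
    by (subst sums_Suc_iff) (simp add: unit_coeff_def)
  hence 1: "(\<lambda>n. (s - 1) * negpow (Suc n) s) sums ((s - 1) * zeta s)"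
    by (intro sums_mult) (simp add: unit_coeff_def)
  have "(\<lambda>n. of_nat (Suc n) * negpow (Suc n) s) \<longlonglongrightarrow> 0"
  proof (rule Lim_null_comparison)
    show "\<forall>\<^sub>F n in sequentially. norm (of_nat (Suc n) * negpow (Suc n) s) \<le> real (Suc n) powr (1 - Re s)"
      by (intro always_eventually allI)
         (simp add: norm_mult norm_negpow powr_diff powr_minus field_simps del: of_nat_Suc)
    have "(\<lambda>n. real (Suc n) powr - (Re s - 1)) \<longlonglongrightarrow> 0"
      using s by (intro tendsto_neg_powr filterlim_compose[OF filterlim_real_sequentially filterlim_Suc]) auto
    thus "(\<lambda>n. real (Suc n) powr (1 - Re s)) \<longlonglongrightarrow> 0" by simp
  qed
  hence "(\<lambda>n. of_nat (Suc (Suc n)) * negpow (Suc (Suc n)) s - of_nat (Suc n) * negpow (Suc n) s)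
     sums (0 - of_nat (Suc 0) * negpow (Suc 0) s)"
    by (rule telescope_sums)
  from sums_add[OF 1 this] have "(\<lambda>n. zterm n s) sums ((s - 1) * zeta s - 1)"
    by (simp add: zterm_def algebra_simps)
  thus ?thesis by (simp add: Zeta1_def sums_iff)
qed

text \<open>The convolution identity that sums \<open>mangoldt\<close> over divisors to
  \<open>ln\<close>: the double series converges absolutely and is regrouped by the product of the
  two indices.\<close>

lemma unit_times_mangoldt:
  assumes s: "Re s > 1"
  shows "zeta s * dseries mangoldt s = dseries (\<lambda>n. unit_coeff n * ln n) s"
proof -
  let ?u = "\<lambda>n. of_real (unit_coeff n) * negpow n s"
  let ?v = "\<lambda>n. of_real (mangoldt n) * negpow n s"
  let ?f = "\<lambda>(d, m). ?v d * ?u m"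
  have u: "(?u has_sum zeta s) UNIV" and v: "(?v has_sum dseries mangoldt s) UNIV"
    by (intro norm_summable_imp_has_sum unit.summable_norm_term mangoldt.summable_norm_term
          unit.dseries_sums mangoldt.dseries_sums s)+
  have nu: "(\<lambda>n. norm (?u n)) summable_on UNIV" and nv: "(\<lambda>n. norm (?v n)) summable_on UNIV"
    using unit.summable_norm_term[OF s] mangoldt.summable_norm_term[OF s]
    by (auto intro!: summable_nonneg_imp_summable_on)
  have "(\<lambda>x. norm (?f x)) summable_on UNIV \<times> UNIV"
  proof (subst Infinite_Sum.abs_summable_on_Sigma_iff, intro conjI ballI)
    show "(\<lambda>y. norm (case (x, y) of (d, m) \<Rightarrow> ?v d * ?u m)) summable_on UNIV" for x
      using nu by (simp add: norm_mult summable_on_cmult_right)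
    have "infsum (\<lambda>y. norm (case (x, y) of (d, m) \<Rightarrow> ?v d * ?u m)) UNIV =
        norm (?v x) * infsum (\<lambda>n. norm (?u n)) UNIV" for x
      by (simp add: norm_mult infsum_cmult_right' mult.assoc)
    hence "(\<lambda>x. norm (infsum (\<lambda>y. norm (case (x, y) of (d, m) \<Rightarrow> ?v d * ?u m)) UNIV)) =
        (\<lambda>x. norm (?v x) * infsum (\<lambda>n. norm (?u n)) UNIV)"
      by (simp add: infsum_nonneg fun_eq_iff)
    thus "(\<lambda>x. norm (infsum (\<lambda>y. norm (case (x, y) of (d, m) \<Rightarrow> ?v d * ?u m)) UNIV)) summable_on UNIV"
      using summable_on_cmult_left[OF nv] by simp
  qed
  hence "?f summable_on UNIV \<times> UNIV" by (rule Infinite_Sum.abs_summable_summable)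
  then obtain S where S: "(?f has_sum S) (UNIV \<times> UNIV)" by (auto simp: summable_on_def)
  have "((\<lambda>d. ?v d * zeta s) has_sum S) UNIV"
    by (rule has_sum_SigmaD[OF S]) (auto intro!: has_sum_cmult_right u)
  moreover have "((\<lambda>d. ?v d * zeta s) has_sum dseries mangoldt s * zeta s) UNIV"
    by (intro has_sum_cmult_left v)
  ultimately have S_eq: "S = dseries mangoldt s * zeta s" by (rule has_sum_unique)
  \<comment> \<open>Pairs with a zero index, whose terms vanish, are dropped before reindexing: 0
    has infinitely many divisors, and \<open>negpow\<close> is multiplicative at positive arguments
    only.\<close>
  have "(?f has_sum S) ({0<..} \<times> {0<..})"
    by (rule has_sum_cong_neutral[THEN iffD1, OF _ _ _ S])
       (auto simp: unit_coeff_def intro!: Nat.gr0I split: if_splits)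
  also have "?this \<longleftrightarrow> ((\<lambda>(n :: nat, d). of_real (mangoldt d) * negpow (real n) s) has_sum S)
      (Sigma {0<..} (\<lambda>n. {d. d dvd n}))"
    by (rule has_sum_reindex_bij_witness[where j = "\<lambda>(d, m). (d * m, d)" and i = "\<lambda>(n, d). (d, n div d)"])
       (auto simp: negpow_mult unit_coeff_def dvd_pos_nat dvd_imp_le div_greater_zero_iff)
  finally have "((\<lambda>n::nat. (\<Sum>d | d dvd n. of_real (mangoldt d) * negpow (real n) s)) has_sum S) {0<..}"
    by (rule has_sum_SigmaD) (auto intro!: has_sum_finite finite_divisors_nat)
  also have "?this \<longleftrightarrow> ((\<lambda>n. of_real (unit_coeff n * ln n) * negpow n s) has_sum S) UNIV"
  proof (rule has_sum_cong_neutral)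
    fix n :: nat assume "n \<in> {0<..} \<inter> UNIV"
    hence "(\<Sum>d | d dvd n. complex_of_real (mangoldt d)) = of_real (ln n)"
      using mangoldt_sum[of n, where ?'a = real] by (simp flip: of_real_sum del: of_real_mangoldt)
    thus "(\<Sum>d | d dvd n. of_real (mangoldt d) * negpow (real n) s) = of_real (unit_coeff n * ln n) * negpow n s"
      using \<open>n \<in> {0<..} \<inter> UNIV\<close> by (simp add: unit_coeff_def flip: sum_distrib_right)
  qed (auto simp: unit_coeff_def)
  finally have "(\<lambda>n. of_real (unit_coeff n * ln n) * negpow n s) sums S"
    by (rule has_sum_imp_sums)
  thus ?thesis unfolding dseries_def using S_eq unfolding dseries_def
    by (simp add: sums_iff mult.commute)
qed

section \<open>Non-vanishing and lower bounds for zeta\<close>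

lemma zeta_deriv:
  assumes s: "Re s > 1"
  shows "(zeta has_field_derivative - zeta s * dseries mangoldt s) (at s)"
proof -
  interpret lg: dirichlet_coeffs "\<lambda>n. unit_coeff n * ln n"
  proof
    fix r :: real assume "r > 1"
    hence "summable (\<lambda>n. ln (real n) * real n powr (- r))" by (rule summable_ln_powr)
    thus "summable (\<lambda>n. \<bar>unit_coeff n * ln n\<bar> * real n powr (- r))"
      by (rule summable_comparison_test'[where N = 1]) (auto simp: unit_coeff_def)
  qed (simp add: unit_coeff_def)
  have "(\<lambda>n. - (of_real (unit_coeff n * ln n) * negpow n s)) sums - dseries (\<lambda>n. unit_coeff n * ln n) s"
    by (intro sums_minus lg.dseries_sums s)
  hence "dseries (\<lambda>n. - unit_coeff n * ln n) s = - dseries (\<lambda>n. unit_coeff n * ln n) s"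
    unfolding dseries_def[of "\<lambda>n. - unit_coeff n * ln n"] by (simp add: sums_iff)
  thus ?thesis using unit.dseries_deriv[OF s] by (simp flip: unit_times_mangoldt[OF s])
qed

text \<open>Starting value for the \<open>3-4-1\<close> argument. The telescoping majorant
  \<open>1 / (k - 1) - 1 / k\<close> of \<open>1 / k ^ 2\<close> would sum to 1, too weak to
  separate \<open>zeta s\<close> from 0; taking the term \<open>k = 2\<close> at its true value
  \<open>1 / 4\<close> saves another \<open>1 / 4\<close>.\<close>

lemma zeta_near_1:
  assumes s: "Re s = 2"
  shows "norm (zeta s - 1) \<le> 3 / 4"
proof -
  let ?b = "\<lambda>n. (1 / real (Suc n) - 1 / real (Suc (Suc n))) - (if n = 0 then 1 / 4 else 0)"
  let ?a = "\<lambda>n. of_real (unit_coeff n) * negpow n s"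
  have "?a sums zeta s" using s by (intro unit.dseries_sums) auto
  hence "(\<lambda>n. ?a (n + 2)) sums (zeta s - (\<Sum>i<2. ?a i))"
    by (subst sums_iff_shift) simp
  also have "(\<Sum>i<2. ?a i) = 1" by (simp add: unit_coeff_def numeral_2_eq_2)
  finally have sums: "(\<lambda>n. ?a (n + 2)) sums (zeta s - 1)" .
  have norm_a: "norm (?a (n + 2)) = 1 / (real n + 2) ^ 2" for n
  proof -
    have "norm (negpow (real (n + 2)) s) = real (n + 2) powr (- 2)" using s by (simp add: norm_negpow)
    also have "\<dots> = 1 / (real n + 2) ^ 2" by (simp add: powr_minus divide_inverse add_ac)
    finally show ?thesis by (simp add: unit_coeff_def norm_mult)
  qed
  have "(\<lambda>n. 1 / real (Suc (Suc n))) \<longlonglongrightarrow> 0"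
    by (intro LIMSEQ_Suc lim_1_over_n) 
  hence "(\<lambda>n. 1 / real (Suc n) - 1 / real (Suc (Suc n))) sums (1 / real (Suc 0) - 0)"
    by (intro telescope_sums') (rule LIMSEQ_imp_Suc)
  moreover have "(\<lambda>n. if n = 0 then 1 / 4 else 0 :: real) sums (1 / 4)"
    using sums_single[of 0 "\<lambda>_. 1 / 4 :: real"] by simp
  ultimately have major: "?b
      sums (3 / 4)"
    using sums_diff by fastforce
  have le: "norm (?a (n + 2)) \<le> ?b n" for n
  proof (cases "n = 0")
    case False
    have "1 / (real n + 2) ^ 2 \<le> 1 / ((real n + 1) * (real n + 2))"
      by (intro divide_left_mono) (auto simp: power2_eq_square)
    also have "\<dots> = 1 / real (Suc n) - 1 / real (Suc (Suc n))" by (simp add: field_simps)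
    finally show ?thesis using False unfolding norm_a by simp
  next
    case True
    show ?thesis unfolding norm_a using True by simp
  qed
  have "norm (zeta s - 1) = norm (\<Sum>n. ?a (n + 2))" using sums by (simp add: sums_iff)
  also have "\<dots> \<le> (\<Sum>n. ?b n)"
    using le by (intro norm_suminf_le sums_summable[OF major])
  also have "\<dots> = 3 / 4" using major by (simp add: sums_iff)
  finally show ?thesis .
qed

text \<open>\<open>P\<close> is a primitive of \<open>- \<zeta>' / \<zeta>\<close>, so
  \<open>zeta s * exp (P s)\<close> has derivative 0 on the convex half-plane. This makes zeta
  zero-free there and turns norms of products into sums of real parts of \<open>P\<close>.\<close>

lemma zeta_log:
  "\<exists>P K. K \<noteq> 0 \<and> (\<forall>s. Re s > 1 \<longrightarrow> (P has_field_derivative dseries mangoldt s) (at s) \<and>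
     zeta s = K * exp (- P s))"
proof -
  let ?S = "{s. Re s > 1}"
  have S: "convex ?S" "open ?S" by (rule convex_halfspace_Re_gt, rule open_halfspace_Re_gt)
  obtain P where P: "\<And>s. s \<in> ?S \<Longrightarrow> (P has_field_derivative dseries mangoldt s) (at s within ?S)"
    using holomorphic_convex_primitive'[OF S mangoldt.dseries_holomorphic] by blast
  have P': "(P has_field_derivative dseries mangoldt s) (at s)" if "Re s > 1" for s
    using P[of s] that at_within_open[of s ?S] S(2) by simp
  have "((\<lambda>s. zeta s * exp (P s)) has_field_derivative 0) (at s within ?S)"
    if "s \<in> ?S" for s
    using that
    by (auto intro!: derivative_eq_intros has_field_derivative_at_within[OF zeta_deriv]
          has_field_derivative_at_within[OF P'])
  from has_field_derivative_zero_constant[OF S(1) this]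
  obtain K where K: "\<And>s. Re s > 1 \<Longrightarrow> zeta s * exp (P s) = K" by blast
  have eq: "zeta s = K * exp (- P s)" if "Re s > 1" for s
    using K[OF that] by (simp add: exp_minus field_simps)
  have "K \<noteq> 0"
  proof
    assume "K = 0"
    hence "zeta 2 = 0" using eq[of 2] by simp
    thus False using zeta_near_1[of 2] by simp
  qed
  with P' eq show ?thesis by (intro exI[of _ P] exI[of _ K]) simp
qed

lemma zeta_nonzero: "Re s > 1 \<Longrightarrow> zeta s \<noteq> 0"
  using zeta_log by fastforce

lemma mangoldt_341:
  assumes "r > 1"
  shows "0 \<le> 3 * Re (dseries mangoldt (Complex r 0)) + 4 * Re (dseries mangoldt (Complex r t))
     + Re (dseries mangoldt (Complex r (2 * t)))"
proof -
  let ?D = "\<lambda>u. dseries mangoldt (Complex r u)"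
  define a :: "real \<Rightarrow> nat \<Rightarrow> real" where
    "a u n = mangoldt n * (exp (- (r * ln (real n))) * cos (u * ln (real n)))" for u n
  have sums: "a u sums Re (?D u)" for u
  proof -
    have "(\<lambda>n. of_real (mangoldt n) * negpow n (Complex r u)) sums ?D u"
      using assms by (intro mangoldt.dseries_sums) auto
    hence "(\<lambda>n. Re (of_real (mangoldt n) * negpow n (Complex r u))) sums Re (?D u)"
      by (rule sums_Re)
    moreover have "Re (of_real (mangoldt n) * negpow n (Complex r u)) = a u n" for n
      by (simp add: a_def negpow_def Re_exp del: of_real_mangoldt)
    ultimately show ?thesis by (simp del: of_real_mangoldt)
  qed
  have nonneg: "0 \<le> 3 * a 0 n + 4 * a t n + a (2 * t) n" for n
  proof -
    define x where "x = t * ln (real n)"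
    have "3 * a 0 n + 4 * a t n + a (2 * t) n =
        mangoldt n * exp (- (r * ln (real n))) * (3 + 4 * cos x + cos (2 * x))"
      by (simp add: a_def x_def algebra_simps)
    also have "3 + 4 * cos x + cos (2 * x) = 2 * (1 + cos x)\<^sup>2"
      unfolding cos_double_cos by (simp add: power2_eq_square algebra_simps)
    finally show ?thesis using mangoldt_nonneg[of n] by simp
  qed
  have "(\<lambda>n. 3 * a 0 n + 4 * a t n + a (2 * t) n) sums (3 * Re (?D 0) + 4 * Re (?D t) + Re (?D (2 * t)))"
    by (intro sums_add sums_mult sums)
  from sums_le[OF _ sums_zero this] nonneg show ?thesis by auto
qed

text \<open>The product is nonincreasing in \<open>r\<close>, since its logarithmic derivative is minus the sum
  in \<open>mangoldt_341\<close>; so it suffices to bound it from below at \<open>r = 2\<close>.\<close>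

lemma zeta_341:
  assumes "1 < r" "r \<le> 2"
  shows "(1 / 4) ^ 8 \<le> norm (zeta (Complex r 0)) ^ 3 *
     norm (zeta (Complex r t)) ^ 4 * norm (zeta (Complex r (2 * t)))"
proof -
  from zeta_log obtain P K where "K \<noteq> 0 \<and> (\<forall>s. Re s > 1 \<longrightarrow>
    (P has_field_derivative dseries mangoldt s) (at s) \<and> zeta s = K * exp (- P s))"
    by (elim exE)
  hence PK: "(P has_field_derivative dseries mangoldt s) (at s)"
    "zeta s = K * exp (- P s)" if "Re s > 1" for s
    using that by simp_all
  define g where "g y = 3 * Re (P (Complex y 0)) + 4 * Re (P (Complex y t)) + Re (P (Complex y (2 * t)))" for y
  define h where "h y = norm (zeta (Complex y 0)) ^ 3 *
     norm (zeta (Complex y t)) ^ 4 * norm (zeta (Complex y (2 * t)))" for y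
  have h: "h y = norm K ^ 8 * exp (- g y)" if "y > 1" for y
  proof -
    have "norm (zeta (Complex y u)) = norm K * exp (- Re (P (Complex y u)))" for u
      using that by (simp add: PK(2) norm_mult)
    hence "h y = norm K ^ 8 * (exp (- Re (P (Complex y 0))) ^ 3 * exp (- Re (P (Complex y t))) ^ 4 *
       exp (- Re (P (Complex y (2 * t)))))"
      by (simp add: h_def power_mult_distrib eval_nat_numeral mult_ac)
    also have "\<dots> = norm K ^ 8 * exp (- g y)"
      by (simp add: g_def flip: exp_of_nat_mult exp_add) 
    finally show ?thesis .
  qed
  have deriv: "((\<lambda>y. Re (P (Complex y u))) has_real_derivative Re (dseries mangoldt (Complex y u))) (at y)"
    if "y > 1" for y u
  proof -
    have "((\<lambda>y. Complex y u) has_vector_derivative 1) (at y)"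
      unfolding Complex_eq by (auto intro!: derivative_eq_intros)
    from field_vector_diff_chain_at[OF this PK(1)] that
    have "((\<lambda>y. P (Complex y u)) has_vector_derivative dseries mangoldt (Complex y u)) (at y)"
      by (simp add: o_def)
    from bounded_linear.has_vector_derivative[OF bounded_linear_Re this]
    show ?thesis by (simp add: has_real_derivative_iff_has_vector_derivative)
  qed
  have "g r \<le> g 2"
  proof (rule DERIV_nonneg_imp_nondecreasing[where f = g])
    fix y assume "r \<le> y" "y \<le> 2"
    hence y: "y > 1" using assms by simp
    have "(g has_real_derivative 3 * Re (dseries mangoldt (Complex y 0)) +
        4 * Re (dseries mangoldt (Complex y t)) + Re (dseries mangoldt (Complex y (2 * t)))) (at y)"
      unfolding g_def by (intro DERIV_add DERIV_cmult deriv y)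
    thus "\<exists>d. (g has_real_derivative d) (at y) \<and> 0 \<le> d"
      using mangoldt_341[OF y, of t] by blast
  qed (use assms in auto)
  hence "h 2 \<le> h r" using assms by (simp add: h mult_left_mono)
  moreover have "(1 / 4) ^ 8 \<le> h 2"
  proof -
    have "1 / 4 \<le> norm (zeta (Complex 2 u))" for u
    proof -
      have "1 \<le> norm (zeta (Complex 2 u)) + norm (zeta (Complex 2 u) - 1)"
        using norm_triangle_ineq4[of "zeta (Complex 2 u)" "zeta (Complex 2 u) - 1"]
        by simp
      thus ?thesis using zeta_near_1[of "Complex 2 u"] by simp
    qed
    hence "(1 / 4) ^ 3 * (1 / 4) ^ 4 * (1 / 4) \<le> h 2"
      unfolding h_def by (intro mult_mono power_mono) auto
    thus ?thesis by (simp add: power_divide)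
  qed
  ultimately show ?thesis unfolding h_def by simp
qed

section \<open>Bounds for zeta and its logarithmic derivative near Re s = 1\<close>

definition zeta_ext :: "complex \<Rightarrow> complex" where
  "zeta_ext s = Zeta1 s / (s - 1)"

lemma zeta_ext_eq: "Re s > 1 \<Longrightarrow> zeta_ext s = zeta s"
  by (auto simp: zeta_ext_def Zeta1_eq)

lemma zeta_ext_holomorphic: "zeta_ext holomorphic_on {s. Re s > 0} - {1}"
  unfolding zeta_ext_def[abs_def]
  by (intro holomorphic_intros holomorphic_on_subset[OF Zeta1_holomorphic]) auto

text \<open>The exponent \<open>e / 2\<close> keeps all bounds integer powers: the growth exponent
  \<open>2 * e\<close> of \<open>Zeta1_growth\<close> becomes \<open>hgt e s ^ 4\<close>, whose
  fourth root in the \<open>3-4-1\<close> argument is \<open>hgt e s\<close>.\<close>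

definition hgt :: "real \<Rightarrow> complex \<Rightarrow> real" where
  "hgt e s = (1 + \<bar>Im s\<bar>) powr (e / 2)"

lemma hgt_ge_1: "e \<ge> 0 \<Longrightarrow> hgt e s \<ge> 1"
  unfolding hgt_def by (intro ge_one_powr_ge_zero) auto

lemma hgt_power: "hgt e s ^ n = (1 + \<bar>Im s\<bar>) powr (e / 2 * real n)"
  unfolding hgt_def by (subst powr_realpow[symmetric]) (auto simp: powr_powr)

lemma hgt_double:
  assumes "0 < e" "e \<le> 1 / 2" "1 + \<bar>Im w\<bar> \<le> 2 * (1 + \<bar>Im s\<bar>)"
  shows "hgt e w ^ 4 \<le> 2 * hgt e s ^ 4"
proof -
  have "hgt e w ^ 4 = (1 + \<bar>Im w\<bar>) powr (2 * e)" by (simp add: hgt_power)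
  also have "\<dots> \<le> (2 * (1 + \<bar>Im s\<bar>)) powr (2 * e)" using assms by (intro powr_mono2) auto
  also have "\<dots> = 2 powr (2 * e) * (1 + \<bar>Im s\<bar>) powr (2 * e)" by (rule powr_mult)
  also have "\<dots> \<le> 2 powr 1 * (1 + \<bar>Im s\<bar>) powr (2 * e)"
    using assms by (intro mult_right_mono powr_mono) auto
  also have "\<dots> = 2 * hgt e s ^ 4" by (simp add: hgt_power)
  finally show ?thesis .
qed

text \<open>The bounds hold at height at least \<open>\<delta>\<close>, away from the pole, and
  \<open>e \<le> \<delta> / 8\<close> keeps discs of radius \<open>e\<close> off the real axis. The
  value \<open>\<delta> = 1\<close> serves the growth estimates, a small one the non-vanishing at a
  given point of the line.\<close>

locale strip =
  fixes \<delta> e :: real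
  assumes \<delta>: "0 < \<delta>" "\<delta> \<le> 1" and e: "0 < e" "e \<le> \<delta> / 8"
begin

lemma e': "e \<le> 1 / 8" using \<delta> e by simp

lemma hgt1: "hgt e s \<ge> 1" using e by (intro hgt_ge_1) simp

lemma zeta_upper:
  obtains C where "C > 0"
    "\<And>s. 1 - e \<le> Re s \<Longrightarrow> Re s \<le> 3 \<Longrightarrow> \<delta> / 4 \<le> \<bar>Im s\<bar> \<Longrightarrow> norm (zeta_ext s) \<le> C * hgt e s ^ 4"
proof -
  obtain C where C: "C > 0"
    "\<And>s. Re s \<ge> 1 - e \<Longrightarrow> norm (Zeta1 s - 1) \<le> C * norm (s - 1) * norm s powr (2 * e)"
    using Zeta1_growth[of e] e e' by auto
  have "norm (zeta_ext s) \<le> (4 / \<delta> + 3 * C) * hgt e s ^ 4"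
    if s: "1 - e \<le> Re s" "Re s \<le> 3" "\<delta> / 4 \<le> \<bar>Im s\<bar>" for s
  proof -
    let ?\<tau> = "1 + \<bar>Im s\<bar>"
    have d: "\<delta> / 4 \<le> norm (s - 1)" using s(3) abs_Im_le_cmod[of "s - 1"] by simp
    hence d0: "norm (s - 1) > 0" using \<delta> by linarith
    have "norm s \<le> \<bar>Re s\<bar> + \<bar>Im s\<bar>" by (rule cmod_le)
    also have "\<dots> \<le> 3 * ?\<tau>" using s e' by auto
    finally have "norm s powr (2 * e) \<le> (3 * ?\<tau>) powr (2 * e)" using e by (intro powr_mono2) auto
    also have "\<dots> = 3 powr (2 * e) * ?\<tau> powr (2 * e)" by (rule powr_mult)
    also have "\<dots> \<le> 3 powr 1 * ?\<tau> powr (2 * e)" using e' by (intro mult_right_mono powr_mono) auto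
    also have "\<dots> = 3 * hgt e s ^ 4" by (simp add: hgt_power)
    finally have ns: "norm s powr (2 * e) \<le> 3 * hgt e s ^ 4" .
    have "norm (Zeta1 s) \<le> 1 + norm (Zeta1 s - 1)"
      using norm_triangle_ineq[of 1 "Zeta1 s - 1"] by simp
    also have "\<dots> \<le> 1 + C * norm (s - 1) * norm s powr (2 * e)" using C(2)[OF s(1)] by simp
    also have "\<dots> \<le> 1 + C * norm (s - 1) * (3 * hgt e s ^ 4)"
      using ns C(1) by (intro add_left_mono mult_left_mono) auto
    finally have "norm (zeta_ext s) \<le> (1 + C * norm (s - 1) * (3 * hgt e s ^ 4)) / norm (s - 1)"
      unfolding zeta_ext_def norm_divide using d0 by (intro divide_right_mono) auto
    also have "\<dots> = 1 / norm (s - 1) + 3 * C * hgt e s ^ 4" using d0 by (simp add: field_simps)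
    also have "1 / norm (s - 1) \<le> 4 / \<delta> * 1" using d \<delta> d0 by (simp add: field_simps)
    also have "4 / \<delta> * 1 \<le> 4 / \<delta> * hgt e s ^ 4"
      using hgt1[of s] \<delta> by (intro mult_left_mono one_le_power) auto
    finally show ?thesis by (simp add: algebra_simps)
  qed
  moreover have "4 / \<delta> + 3 * C > 0" using C(1) \<delta>(1) by (intro add_pos_pos) auto
  ultimately show ?thesis using that by blast
qed

text \<open>Cauchy's estimate on discs of radius \<open>e / 2\<close>; the region shrinks
  accordingly, from the margins \<open>1 - e\<close>, \<open>3\<close>, \<open>\<delta> / 4\<close>
  to \<open>1 - e / 2\<close>, \<open>5 / 2\<close>, \<open>\<delta> / 2\<close>.\<close>

lemma zeta_deriv_upper:
  obtains C where "C > 0"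
    "\<And>s. 1 - e / 2 \<le> Re s \<Longrightarrow> Re s \<le> 5 / 2 \<Longrightarrow> \<delta> / 2 \<le> \<bar>Im s\<bar> \<Longrightarrow>
       norm (deriv zeta_ext s) \<le> C * hgt e s ^ 4"
proof -
  obtain C where C: "C > 0"
    "\<And>s. 1 - e \<le> Re s \<Longrightarrow> Re s \<le> 3 \<Longrightarrow> \<delta> / 4 \<le> \<bar>Im s\<bar> \<Longrightarrow> norm (zeta_ext s) \<le> C * hgt e s ^ 4"
    using zeta_upper by blast
  have "norm (deriv zeta_ext s) \<le> (4 * C / e) * hgt e s ^ 4"
    if s: "1 - e / 2 \<le> Re s" "Re s \<le> 5 / 2" "\<delta> / 2 \<le> \<bar>Im s\<bar>" for s
  proof -
    have near: "1 - e \<le> Re w" "Re w \<le> 3" "\<delta> / 4 \<le> \<bar>Im w\<bar>" "\<bar>Im w\<bar> \<le> \<bar>Im s\<bar> + 1"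
      if "norm (s - w) \<le> e / 2" for w
    proof -
      have "\<bar>Re s - Re w\<bar> \<le> e / 2" "\<bar>Im s - Im w\<bar> \<le> e / 2"
        using abs_Re_le_cmod[of "s - w"] abs_Im_le_cmod[of "s - w"] that by auto
      thus "1 - e \<le> Re w" "Re w \<le> 3" "\<delta> / 4 \<le> \<bar>Im w\<bar>" "\<bar>Im w\<bar> \<le> \<bar>Im s\<bar> + 1"
        using s e e' \<delta> by linarith+
    qed
    have sub: "cball s (e / 2) \<subseteq> {s. Re s > 0} - {1}"
    proof
      fix w assume "w \<in> cball s (e / 2)"
      hence "norm (s - w) \<le> e / 2" by (simp add: dist_norm)
      from near[OF this] show "w \<in> {s. Re s > 0} - {1}" using e' \<delta> by auto
    qed
    have hol: "zeta_ext holomorphic_on cball s (e / 2)"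
      by (rule holomorphic_on_subset[OF zeta_ext_holomorphic sub])
    have "norm ((deriv ^^ 1) zeta_ext s) \<le> fact 1 * (C * (2 * hgt e s ^ 4)) / (e / 2) ^ 1"
    proof (rule Cauchy_inequality)
      fix w assume "norm (s - w) = e / 2"
      hence w: "norm (s - w) \<le> e / 2" by simp
      have "norm (zeta_ext w) \<le> C * hgt e w ^ 4" using near[OF w] by (intro C)
      also have "\<dots> \<le> C * (2 * hgt e s ^ 4)"
        using near(4)[OF w] C(1) e e' by (intro mult_left_mono hgt_double) auto
      finally show "norm (zeta_ext w) \<le> C * (2 * hgt e s ^ 4)" .
    qed (use e hol holomorphic_on_imp_continuous_on[OF hol] in
        \<open>auto intro: holomorphic_on_subset[OF hol]\<close>)
    thus ?thesis by (simp add: mult_ac)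
  qed
  moreover have "4 * C / e > 0" using C e by simp
  ultimately show ?thesis using that by blast
qed

text \<open>The half-plane without the pole is not convex, so the mean value inequality is applied
  on a rectangle around the height of \<open>s\<close> with half height \<open>e\<close>. It stays
  off the real axis and reaches left of \<open>Re s = 1\<close>.\<close>

lemma zeta_diff_bound:
  assumes C: "C > 0"
    "\<And>s. 1 - e / 2 \<le> Re s \<Longrightarrow> Re s \<le> 5 / 2 \<Longrightarrow> \<delta> / 2 \<le> \<bar>Im s\<bar> \<Longrightarrow>
       norm (deriv zeta_ext s) \<le> C * hgt e s ^ 4"
  assumes s: "1 < Re s" "Re s \<le> 2" "\<delta> \<le> \<bar>Im s\<bar>"
  assumes w: "1 - e / 2 \<le> Re w" "Re w \<le> 5 / 2" "\<bar>Im w - Im s\<bar> \<le> e"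
  shows "norm (zeta_ext w - zeta_ext s) \<le> C * (2 * hgt e s ^ 4) * norm (w - s)"
    and "norm (deriv zeta_ext w) \<le> C * (2 * hgt e s ^ 4)"
proof -
  define S where "S = {z. 1 - e / 2 \<le> Re z} \<inter> {z. Re z \<le> 5 / 2} \<inter>
     ({z. Im s - e \<le> Im z} \<inter> {z. Im z \<le> Im s + e})"
  have S_iff: "z \<in> S \<longleftrightarrow> 1 - e / 2 \<le> Re z \<and> Re z \<le> 5 / 2 \<and> \<bar>Im z - Im s\<bar> \<le> e" for z
    by (auto simp: S_def abs_le_iff)
  have cvx: "convex S"
    unfolding S_def by (intro convex_Int convex_halfspace_Re_ge convex_halfspace_Re_le
        convex_halfspace_Im_ge convex_halfspace_Im_le)
  have bd: "norm (deriv zeta_ext z) \<le> C * (2 * hgt e s ^ 4)" if "z \<in> S" for z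
  proof -
    have z: "1 - e / 2 \<le> Re z" "Re z \<le> 5 / 2" "\<bar>Im z - Im s\<bar> \<le> e"
      using that by (auto simp: S_iff)
    have "\<bar>Im z\<bar> \<le> \<bar>Im s\<bar> + e" "\<bar>Im s\<bar> \<le> \<bar>Im z\<bar> + e" using z(3) by linarith+
    hence "\<delta> / 2 \<le> \<bar>Im z\<bar>" and dbl: "1 + \<bar>Im z\<bar> \<le> 2 * (1 + \<bar>Im s\<bar>)"
      using s(3) e e' \<delta> by auto
    hence "norm (deriv zeta_ext z) \<le> C * hgt e z ^ 4" using z by (intro C(2))
    also have "\<dots> \<le> C * (2 * hgt e s ^ 4)"
      using dbl e e' C(1) by (intro mult_left_mono hgt_double) auto
    finally show ?thesis .
  qed
  have op: "open ({s. Re s > 0} - {1 :: complex})"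
    by (intro open_Diff open_halfspace_Re_gt) auto
  have der: "(zeta_ext has_field_derivative deriv zeta_ext z) (at z within S)" if "z \<in> S" for z
  proof -
    have "Re z > 0" "Im z \<noteq> 0" using that s(3) e e' \<delta> unfolding S_iff by linarith+
    hence "z \<in> {s. Re s > 0} - {1}" by auto
    from holomorphic_derivI[OF zeta_ext_holomorphic op this] show ?thesis
      by (rule has_field_derivative_at_within)
  qed
  have "s \<in> S" "w \<in> S" using s w e by (auto simp: S_iff)
  thus "norm (zeta_ext w - zeta_ext s) \<le> C * (2 * hgt e s ^ 4) * norm (w - s)"
    and "norm (deriv zeta_ext w) \<le> C * (2 * hgt e s ^ 4)"
    using field_differentiable_bound[OF cvx der bd] bd by blast+
qed

text \<open>In the \<open>3-4-1\<close> product the factor at the real point is at most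
  \<open>B / (Re s - 1)\<close> and the one at double height at most
  \<open>2 * C * hgt e s ^ 4\<close>; solving for the middle factor gives the claim. The constant is
  a fourth power in view of the root taken later.\<close>

lemma zeta_lower_341:
  obtains c where "c > 0"
    "\<And>s. 1 < Re s \<Longrightarrow> Re s \<le> 2 \<Longrightarrow> \<delta> \<le> \<bar>Im s\<bar> \<Longrightarrow> c ^ 4 * (Re s - 1) ^ 3 \<le> norm (zeta_ext s) ^ 4 * hgt e s ^ 4"
proof -
  obtain C where C: "C > 0"
    "\<And>s. 1 - e \<le> Re s \<Longrightarrow> Re s \<le> 3 \<Longrightarrow> \<delta> / 4 \<le> \<bar>Im s\<bar> \<Longrightarrow> norm (zeta_ext s) \<le> C * hgt e s ^ 4"
    using zeta_upper by blast
  obtain A where A: "A > 0"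
    "\<And>s. Re s \<ge> 1 - 1 / 2 \<Longrightarrow> norm (Zeta1 s - 1) \<le> A * norm (s - 1) * norm s powr (2 * (1 / 2))"
    using Zeta1_growth[of "1 / 2"] by auto
  define B where "B = 1 + 2 * A"
  have B: "B > 0" using A by (simp add: B_def)
  define c where "c = ((1 / 4) ^ 8 / (B ^ 3 * (C * 2))) powr (1 / 4)"
  have "c > 0" unfolding c_def using B C by simp
  have c4: "c ^ 4 = (1 / 4) ^ 8 / (B ^ 3 * (C * 2))"
    unfolding c_def using B C by (simp add: powr_power)
  have "c ^ 4 * (Re s - 1) ^ 3 \<le> norm (zeta_ext s) ^ 4 * hgt e s ^ 4"
    if s: "1 < Re s" "Re s \<le> 2" "\<delta> \<le> \<bar>Im s\<bar>" for s
  proof -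
    define r t where "r = Re s" and "t = Im s"
    have s_eq: "s = Complex r t" by (simp add: r_def t_def)
    have r: "1 < r" "r \<le> 2" using s by (auto simp: r_def)
    let ?z = "\<lambda>u. zeta (Complex r u)"
    have z: "zeta_ext (Complex r u) = ?z u" for u using r by (intro zeta_ext_eq) auto
    have "norm (Zeta1 (Complex r 0)) \<le> B"
    proof -
      have cx: "Complex r 0 = of_real r" by (simp add: complex_of_real_def)
      have "(of_real r - 1 :: complex) = of_real (r - 1)" by simp
      hence n1: "norm (of_real r - 1 :: complex) = r - 1" using r by (simp only: norm_of_real)
      have "norm (Zeta1 (of_real r) - 1) \<le> A * norm (of_real r - 1 :: complex) * norm (of_real r :: complex)"
        using A(2)[of "of_real r"] r by simp
      also have "\<dots> = A * ((r - 1) * r)"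
        unfolding n1 using r by simp
      also have "\<dots> \<le> A * (1 * 2)" using r A by (intro mult_left_mono mult_mono) auto
      finally show ?thesis
        using norm_triangle_ineq[of 1 "Zeta1 (of_real r) - 1"] by (simp add: cx B_def)
    qed
    moreover have "norm (Complex r 0 - 1) = r - 1"
      using r by (simp add: cmod_def)
    ultimately have b1: "norm (?z 0) \<le> B / (r - 1)"
      using r unfolding z[symmetric] zeta_ext_def norm_divide by (simp add: divide_right_mono)
    have "norm (?z (2 * t)) \<le> C * hgt e (Complex r (2 * t)) ^ 4"
      unfolding z[symmetric] using r s(3) e \<delta> by (intro C) (auto simp: t_def)
    also have "\<dots> \<le> C * (2 * hgt e s ^ 4)"
      using C e e' by (intro mult_left_mono hgt_double) (auto simp: t_def)
    finally have b2: "norm (?z (2 * t)) \<le> C * (2 * hgt e s ^ 4)" .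
    have "(1 / 4) ^ 8 \<le> norm (?z 0) ^ 3 * norm (?z t) ^ 4 * norm (?z (2 * t))"
      using r by (rule zeta_341)
    also have "\<dots> \<le> (B / (r - 1)) ^ 3 * norm (?z t) ^ 4 * (C * (2 * hgt e s ^ 4))"
      using b1 b2 B r by (intro mult_mono power_mono) auto
    finally have "(1 / 4) ^ 8 \<le> (B ^ 3 * (C * 2)) * (norm (?z t) ^ 4 * hgt e s ^ 4) / (r - 1) ^ 3"
      by (simp add: power_divide mult_ac)
    hence "(1 / 4) ^ 8 * (r - 1) ^ 3 \<le> (B ^ 3 * (C * 2)) * (norm (?z t) ^ 4 * hgt e s ^ 4)"
      using r by (subst (asm) pos_le_divide_eq) auto
    hence "c ^ 4 * (r - 1) ^ 3 \<le> norm (?z t) ^ 4 * hgt e s ^ 4"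
      unfolding c4 using B C by (simp add: pos_divide_le_eq mult_ac)
    thus ?thesis by (simp add: s_eq z)
  qed
  with \<open>c > 0\<close> show ?thesis using that by blast
qed

text \<open>The \<open>3-4-1\<close> inequality is used at distance \<open>\<theta>\<^sup>4\<close> from the line \<open>Re s = 1\<close>, and
  the derivative bound bridges the remaining gap; \<open>\<theta>\<close> is chosen to balance the two.\<close>

lemma zeta_lower:
  obtains c where "c > 0"
    "\<And>s. 1 < Re s \<Longrightarrow> Re s \<le> 2 \<Longrightarrow> \<delta> \<le> \<bar>Im s\<bar> \<Longrightarrow> c / hgt e s ^ 16 \<le> norm (zeta_ext s)"
proof -
  obtain C where C: "C > 0"
    "\<And>s. 1 - e / 2 \<le> Re s \<Longrightarrow> Re s \<le> 5 / 2 \<Longrightarrow> \<delta> / 2 \<le> \<bar>Im s\<bar> \<Longrightarrow>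
       norm (deriv zeta_ext s) \<le> C * hgt e s ^ 4"
    using zeta_deriv_upper by blast
  obtain c where c: "c > 0"
    "\<And>s. 1 < Re s \<Longrightarrow> Re s \<le> 2 \<Longrightarrow> \<delta> \<le> \<bar>Im s\<bar> \<Longrightarrow> c ^ 4 * (Re s - 1) ^ 3 \<le> norm (zeta_ext s) ^ 4 * hgt e s ^ 4"
    using zeta_lower_341 by blast
  \<comment> \<open>At real part \<open>1 + \<theta> ^ 4\<close> the \<open>3-4-1\<close> bound
    gives \<open>c * \<theta> ^ 3 / T\<close>, and moving from there to \<open>s\<close> loses at
    most \<open>2 * C * T ^ 4 * \<theta> ^ 4\<close>. With \<open>\<theta> = \<mu> / T ^ 5\<close>
    both carry the factor \<open>1 / T ^ 16\<close>, and \<open>\<mu>\<close> is small enough for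
    the loss to be at most half.\<close>
  define \<mu> where "\<mu> = min 1 (c / (4 * C))"
  have \<mu>: "0 < \<mu>" "\<mu> \<le> 1" "2 * C * \<mu> \<le> c / 2" using c C by (auto simp: \<mu>_def min_def field_simps)
  have "c * \<mu> ^ 3 / 2 / hgt e s ^ 16 \<le> norm (zeta_ext s)"
    if s: "1 < Re s" "Re s \<le> 2" "\<delta> \<le> \<bar>Im s\<bar>" for s
  proof -
    define T where "T = hgt e s"
    have T: "T \<ge> 1" unfolding T_def by (rule hgt1)
    define \<theta> where "\<theta> = \<mu> / T ^ 5"
    have \<theta>: "0 < \<theta>" "\<theta> \<le> 1"
    proof -
      have "1 \<le> T ^ 5" using T by (rule one_le_power)
      hence "\<mu> \<le> 1 * T ^ 5" using \<mu> by linarith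
      thus "\<theta> \<le> 1" unfolding \<theta>_def using T by (subst pos_divide_le_eq) auto
    qed (use \<mu> T in \<open>auto simp: \<theta>_def\<close>)
    have \<theta>4: "\<theta> ^ 4 \<le> 1" "0 < \<theta> ^ 4" using \<theta> by (auto intro: power_le_one)
    have far: "c * \<mu> ^ 3 / T ^ 16 \<le> norm (zeta_ext z)"
      if z: "1 + \<theta> ^ 4 \<le> Re z" "Re z \<le> 2" "Im z = Im s" for z
    proof -
      have hz: "hgt e z = T" using z by (simp add: hgt_def T_def)
      have "(c * \<mu> ^ 3 / T ^ 16) ^ 4 * T ^ 4 = c ^ 4 * (\<theta> ^ 4) ^ 3"
        using T by (simp add: \<theta>_def power_divide power_mult_distrib field_simps
              flip: power_mult power_add)
      also have "\<dots> \<le> c ^ 4 * (Re z - 1) ^ 3"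
        using c z \<theta>4 by (intro mult_left_mono power_mono) auto
      also have "\<dots> \<le> norm (zeta_ext z) ^ 4 * T ^ 4"
        using c(2)[of z] z \<theta>4 s unfolding hz by auto
      finally have "(c * \<mu> ^ 3 / T ^ 16) ^ 4 \<le> norm (zeta_ext z) ^ 4"
        using T by simp
      thus ?thesis using c(1) \<mu>(1) T by (subst (asm) power_mono_iff) auto
    qed
    show ?thesis
    proof (cases "1 + \<theta> ^ 4 \<le> Re s")
      case True
      have "c * \<mu> ^ 3 / 2 / T ^ 16 \<le> c * \<mu> ^ 3 / T ^ 16"
        using c \<mu> T by (intro divide_right_mono) auto
      also have "\<dots> \<le> norm (zeta_ext s)" using True s by (intro far) auto
      finally show ?thesis by (simp add: T_def)
    next
      case False
      define w where "w = Complex (1 + \<theta> ^ 4) (Im s)"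
      have wsub: "w - s = of_real (1 + \<theta> ^ 4 - Re s)" by (simp add: w_def complex_eq_iff)
      have ws: "norm (w - s) \<le> \<theta> ^ 4"
        unfolding wsub norm_of_real using s False by simp
      have "norm (zeta_ext w - zeta_ext s) \<le> C * (2 * T ^ 4) * norm (w - s)"
        unfolding T_def using s \<theta>4 e
        by (intro zeta_diff_bound[OF C]) (unfold w_def complex.sel diff_self abs_zero, linarith+)
      also have "\<dots> \<le> C * (2 * T ^ 4) * \<theta> ^ 4"
        using ws C T by (intro mult_left_mono) auto
      also have "\<dots> = 2 * C * \<mu> * (\<mu> ^ 3 / T ^ 16)"
        using T by (simp add: \<theta>_def power_divide field_simps flip: power_mult power_add)
          (simp add: numeral_eq_Suc)
      also have "\<dots> \<le> c / 2 * (\<mu> ^ 3 / T ^ 16)" using \<mu> T by (intro mult_right_mono) auto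
      finally have "norm (zeta_ext w - zeta_ext s) \<le> c * \<mu> ^ 3 / 2 / T ^ 16" by simp
      moreover have "c * \<mu> ^ 3 / T ^ 16 \<le> norm (zeta_ext w)"
        using \<theta>4 by (intro far) (auto simp: w_def)
      moreover have "norm (zeta_ext w) \<le> norm (zeta_ext s) + norm (zeta_ext w - zeta_ext s)"
        by (rule norm_triangle_sub)
      moreover have "A - B \<le> z" if "n \<le> B" "A \<le> y" "y \<le> z + n" for A B n y z :: real
        using that by linarith
      ultimately have "c * \<mu> ^ 3 / T ^ 16 - c * \<mu> ^ 3 / 2 / T ^ 16 \<le> norm (zeta_ext s)" by blast
      thus ?thesis by (simp add: T_def field_simps)
    qed
  qed
  moreover have "c * \<mu> ^ 3 / 2 > 0" using c \<mu> by simp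
  ultimately show ?thesis using that by blast
qed

text \<open>\<open>zeta_ext s\<close> has norm at least \<open>c / T ^ 16\<close> and the derivative
  nearby is of order at most \<open>T ^ 4\<close>, so within distance \<open>\<rho> / T ^ 20\<close>
  the norm keeps at least half of this lower bound. The radius depends on the height only: close to
  \<open>Re s = 1\<close> the disc crosses the line, which keeps Cauchy estimates uniform as
  \<open>Re s\<close> tends to 1.\<close>

lemma zeta_log_deriv_bound:
  "\<exists>\<rho> C. C > 0 \<and> 0 < \<rho> \<and> \<rho> \<le> e / 4 \<and>
    (\<forall>s w. 1 < Re s \<longrightarrow> Re s \<le> 2 \<longrightarrow> \<delta> \<le> \<bar>Im s\<bar> \<longrightarrow> norm (w - s) \<le> \<rho> / hgt e s ^ 20 \<longrightarrow>
        zeta_ext w \<noteq> 0 \<and> norm (deriv zeta_ext w / zeta_ext w) \<le> C * hgt e s ^ 20)"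
proof -
  obtain C where C: "C > 0"
    "\<And>s. 1 - e / 2 \<le> Re s \<Longrightarrow> Re s \<le> 5 / 2 \<Longrightarrow> \<delta> / 2 \<le> \<bar>Im s\<bar> \<Longrightarrow>
       norm (deriv zeta_ext s) \<le> C * hgt e s ^ 4"
    using zeta_deriv_upper by blast
  obtain c where c: "c > 0"
    "\<And>s. 1 < Re s \<Longrightarrow> Re s \<le> 2 \<Longrightarrow> \<delta> \<le> \<bar>Im s\<bar> \<Longrightarrow> c / hgt e s ^ 16 \<le> norm (zeta_ext s)"
    using zeta_lower by blast
  define \<rho> where "\<rho> = min (e / 4) (c / (4 * C))"
  have \<rho>: "0 < \<rho>" "\<rho> \<le> e / 4" "2 * C * \<rho> \<le> c / 2"
    using c C e by (auto simp: \<rho>_def min_def field_simps)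
  have "zeta_ext w \<noteq> 0 \<and> norm (deriv zeta_ext w / zeta_ext w) \<le> (4 * C / c) * hgt e s ^ 20"
    if s: "1 < Re s" "Re s \<le> 2" "\<delta> \<le> \<bar>Im s\<bar>" and ws: "norm (w - s) \<le> \<rho> / hgt e s ^ 20" for s w
  proof -
    define T where "T = hgt e s"
    have T: "T \<ge> 1" unfolding T_def by (rule hgt1)
    have "\<rho> / T ^ 20 \<le> \<rho>" using T \<rho> one_le_power[OF T, of 20] by (simp add: pos_divide_le_eq)
    hence "norm (w - s) \<le> e / 4" using ws \<rho> by (simp add: T_def)
    hence *: "\<bar>Re w - Re s\<bar> \<le> e / 4" "\<bar>Im w - Im s\<bar> \<le> e / 4"
      using abs_Re_le_cmod[of "w - s"] abs_Im_le_cmod[of "w - s"] by auto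
    hence w: "1 - e / 2 \<le> Re w" "Re w \<le> 5 / 2" "\<bar>Im w - Im s\<bar> \<le> e"
      using s e e' by linarith+
    note d = zeta_diff_bound[OF C s w, folded T_def]
    have "C * (2 * T ^ 4) * norm (w - s) \<le> C * (2 * T ^ 4) * (\<rho> / T ^ 20)"
      using ws C(1) T by (intro mult_left_mono) (auto simp: T_def)
    with d(1) have "norm (zeta_ext w - zeta_ext s) \<le> C * (2 * T ^ 4) * (\<rho> / T ^ 20)"
      by linarith
    also have "\<dots> = 2 * C * \<rho> / T ^ 16"
      using T by (simp add: field_simps flip: power_add)
    also have "\<dots> \<le> c / 2 / T ^ 16" using \<rho> T by (intro divide_right_mono) auto
    finally have "norm (zeta_ext w - zeta_ext s) \<le> c / 2 / T ^ 16" .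
    moreover have "c / T ^ 16 \<le> norm (zeta_ext s)" unfolding T_def by (rule c(2)[OF s])
    moreover have "norm (zeta_ext s) \<le> norm (zeta_ext w) + norm (zeta_ext w - zeta_ext s)"
      by (metis norm_minus_commute norm_triangle_sub)
    moreover have "c / T ^ 16 = c / 2 / T ^ 16 + c / 2 / T ^ 16" by (simp add: field_simps)
    ultimately have low: "c / 2 / T ^ 16 \<le> norm (zeta_ext w)" by linarith
    have pos: "c / 2 / T ^ 16 > 0" using c T by simp
    have "norm (deriv zeta_ext w / zeta_ext w) \<le> C * (2 * T ^ 4) / (c / 2 / T ^ 16)"
      unfolding norm_divide using d(2) low pos C T by (intro frac_le) auto
    also have "\<dots> = (4 * C / c) * T ^ 20"
      using c T by (simp add: field_simps flip: power_add)
    finally show ?thesis using low pos unfolding T_def by auto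
  qed
  moreover have "4 * C / c > 0" using C(1) c(1) by simp
  ultimately show ?thesis using \<rho>(1,2) by (intro exI[of _ \<rho>] exI[of _ "4 * C / c"]) simp
qed

end

text \<open>On the line the lower bound of \<open>zeta_lower\<close> depends on \<open>Im s\<close>
  alone and therefore survives the limit from the right.\<close>

lemma Zeta1_nonzero:
  assumes "Re s \<ge> 1"
  shows "Zeta1 s \<noteq> 0"
proof -
  consider "Re s > 1" | "s = 1" | "Re s = 1" "Im s \<noteq> 0"
    using assms by (cases "Re s = 1"; cases "Im s = 0") (auto simp: complex_eq_iff)
  thus ?thesis
  proof cases
    case 1
    thus ?thesis using zeta_nonzero[of s] by (auto simp: Zeta1_eq)
  next
    case 3
    define \<delta> where "\<delta> = min 1 \<bar>Im s\<bar>"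
    interpret strip \<delta> "\<delta> / 8" by standard (use 3 in \<open>auto simp: \<delta>_def\<close>)
    obtain c where c: "c > 0"
      "\<And>s. 1 < Re s \<Longrightarrow> Re s \<le> 2 \<Longrightarrow> \<delta> \<le> \<bar>Im s\<bar> \<Longrightarrow> c / hgt (\<delta> / 8) s ^ 16 \<le> norm (zeta_ext s)"
      using zeta_lower by blast
    define b where "b = c / hgt (\<delta> / 8) s ^ 16"
    have "b > 0" using c hgt1[of s] unfolding b_def by (intro divide_pos_pos zero_less_power) linarith+
    have "isCont zeta_ext s"
    proof -
      have "open ({s. Re s > 0} - {1 :: complex})" by (intro open_Diff open_halfspace_Re_gt) auto
      moreover have "s \<in> {s. Re s > 0} - {1}" using 3 by auto
      ultimately show ?thesis
        using holomorphic_on_imp_continuous_on[OF zeta_ext_holomorphic] continuous_on_eq_continuous_at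
        by blast
    qed
    moreover have "((\<lambda>n. s + of_real (1 / real (Suc n))) \<longlongrightarrow> s + of_real 0) sequentially"
      by (intro tendsto_intros LIMSEQ_Suc lim_1_over_n)
    ultimately have "(\<lambda>n. zeta_ext (s + of_real (1 / real (Suc n)))) \<longlonglongrightarrow> zeta_ext s"
      using isCont_tendsto_compose[of s zeta_ext] by simp
    hence "(\<lambda>n. norm (zeta_ext (s + of_real (1 / real (Suc n))))) \<longlonglongrightarrow> norm (zeta_ext s)"
      by (rule tendsto_norm)
    moreover have "b \<le> norm (zeta_ext (s + of_real (1 / real (Suc n))))" for n
    proof -
      have "1 / real (Suc n) > 0" "1 / real (Suc n) \<le> 1" by auto
      thus ?thesis using c(2)[of "s + of_real (1 / real (Suc n))"] 3
        by (simp add: b_def hgt_def \<delta>_def del: of_nat_Suc)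
    qed
    ultimately have "b \<le> norm (zeta_ext s)" by (intro LIMSEQ_le_const) auto
    thus ?thesis using \<open>b > 0\<close> by (auto simp: zeta_ext_def)
  qed simp
qed

section \<open>The function Q and its derivatives up to the line Re s = 1\<close>

text \<open>Since \<open>1 / (s - 1) + 1 = s / (s - 1)\<close>, this is the function of the
  overview, with the poles at \<open>s = 1\<close> cancelled beforehand.\<close>

definition Qfun :: "complex \<Rightarrow> complex" where
  "Qfun s = - (deriv Zeta1 s / Zeta1 s + 1) / s"

lemma Qfun_domain_open: "open ({s. Re s > 0} - {s. Zeta1 s = 0})"
proof -
  have "open ({s. Re s > 0} \<inter> Zeta1 -` (- {0}))"
    by (intro continuous_open_preimage holomorphic_on_imp_continuous_on Zeta1_holomorphic
          open_halfspace_Re_gt) auto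
  also have "{s. Re s > 0} \<inter> Zeta1 -` (- {0}) = {s. Re s > 0} - {s. Zeta1 s = 0}" by auto
  finally show ?thesis .
qed

lemma Qfun_holomorphic: "Qfun holomorphic_on {s. Re s > 0} - {s. Zeta1 s = 0}"
proof -
  have "deriv Zeta1 holomorphic_on {s. Re s > 0}"
    by (intro holomorphic_deriv Zeta1_holomorphic open_halfspace_Re_gt)
  hence 1: "deriv Zeta1 holomorphic_on {s. Re s > 0} - {s. Zeta1 s = 0}"
    by (rule holomorphic_on_subset) auto
  have 2: "Zeta1 holomorphic_on {s. Re s > 0} - {s. Zeta1 s = 0}"
    by (rule holomorphic_on_subset[OF Zeta1_holomorphic]) auto
  show ?thesis unfolding Qfun_def[abs_def]
    by (intro holomorphic_on_divide holomorphic_on_minus holomorphic_on_add 1 2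
          holomorphic_on_const holomorphic_on_ident) auto
qed

lemma Qfun_eq:
  assumes s: "Re s > 1"
  shows "Qfun s = dseries mangoldt s / s - 1 / (s - 1)"
proof -
  have ne: "s - 1 \<noteq> 0" "s \<noteq> 0" using s by auto
  have "((\<lambda>s. (s - 1) * zeta s) has_field_derivative
      zeta s - (s - 1) * (zeta s * dseries mangoldt s)) (at s)"
    by (auto intro!: derivative_eq_intros zeta_deriv s)
  hence "(Zeta1 has_field_derivative
      zeta s - (s - 1) * (zeta s * dseries mangoldt s)) (at s)"
    by (rule has_field_derivative_transform_within_open[where S = "{s. Re s > 1}"])
       (use s Zeta1_eq in \<open>auto simp: open_halfspace_Re_gt\<close>)
  hence d: "deriv Zeta1 s = zeta s * (1 - (s - 1) * dseries mangoldt s)"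
    by (simp add: DERIV_imp_deriv algebra_simps)
  have eq: "deriv Zeta1 s / Zeta1 s = 1 / (s - 1) - dseries mangoldt s"
    unfolding Zeta1_eq[OF s] d using zeta_nonzero[OF s] ne by (simp add: divide_simps)
  show ?thesis unfolding Qfun_def eq using ne by (simp add: field_simps)
qed

lemma Qfun_eq_zeta_ext:
  assumes "Re s > 0" "s \<noteq> 1" "zeta_ext s \<noteq> 0"
  shows "Qfun s = - (1 / (s - 1) + deriv zeta_ext s / zeta_ext s + 1) / s"
proof -
  have op: "open ({s. Re s > 0} - {1 :: complex})" by (intro open_Diff open_halfspace_Re_gt) auto
  have "(zeta_ext has_field_derivative deriv zeta_ext s) (at s)"
    using assms by (intro holomorphic_derivI[OF zeta_ext_holomorphic op]) auto
  hence "((\<lambda>s. (s - 1) * zeta_ext s) has_field_derivative zeta_ext s + (s - 1) * deriv zeta_ext s) (at s)"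
    by (auto intro!: derivative_eq_intros)
  hence "(Zeta1 has_field_derivative zeta_ext s + (s - 1) * deriv zeta_ext s) (at s)"
    by (rule has_field_derivative_transform_within_open[OF _ op])
       (use assms in \<open>auto simp: zeta_ext_def\<close>)
  hence d: "deriv Zeta1 s = zeta_ext s + (s - 1) * deriv zeta_ext s" by (rule DERIV_imp_deriv)
  have z: "Zeta1 s = (s - 1) * zeta_ext s" using assms by (simp add: zeta_ext_def)
  have "deriv Zeta1 s / Zeta1 s = 1 / (s - 1) + deriv zeta_ext s / zeta_ext s"
    unfolding d z using assms by (simp add: divide_simps)
  thus ?thesis by (simp add: Qfun_def)
qed

theorem Qfun_deriv_bound:
  obtains C where "C > 0"
    "\<And>s. 1 < Re s \<Longrightarrow> Re s \<le> 2 \<Longrightarrow> norm ((deriv ^^ k) Qfun s) \<le> C * (1 + \<bar>Im s\<bar>) powr (- 1 / 2)"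
proof -
  \<comment> \<open>The logarithmic derivative is of order \<open>T ^ 20\<close> on discs of radius
    \<open>\<rho> / T ^ 20\<close>, so the \<open>k\<close>-th derivative costs
    \<open>T ^ (20 * (k + 1))\<close> in all. This \<open>e\<close> makes that the square root of
    \<open>1 + \<bar>Im s\<bar>\<close>, and the factor \<open>1 / s\<close> in \<open>Qfun\<close>
    leaves the exponent \<open>- 1 / 2\<close>.\<close>
  define e where "e = 1 / (20 * (real k + 1))"
  have e8: "0 < e" "e \<le> 1 / 8" by (auto simp: e_def field_simps)
  interpret strip 1 e by standard (use e8 in auto)
  from zeta_log_deriv_bound obtain \<rho> C where C': "C > 0 \<and> 0 < \<rho> \<and> \<rho> \<le> e / 4 \<and>
    (\<forall>s w. 1 < Re s \<longrightarrow> Re s \<le> 2 \<longrightarrow> 1 \<le> \<bar>Im s\<bar> \<longrightarrow> norm (w - s) \<le> \<rho> / hgt e s ^ 20 \<longrightarrow>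
        zeta_ext w \<noteq> 0 \<and> norm (deriv zeta_ext w / zeta_ext w) \<le> C * hgt e s ^ 20)"
    by (elim exE)
  hence C: "C > 0" "0 < \<rho>" "\<rho> \<le> e / 4" by simp_all
  from C' have log_deriv: "zeta_ext w \<noteq> 0" "norm (deriv zeta_ext w / zeta_ext w) \<le> C * hgt e s ^ 20"
    if "1 < Re s" "Re s \<le> 2" "1 \<le> \<bar>Im s\<bar>" "norm (w - s) \<le> \<rho> / hgt e s ^ 20" for s w
    using that by simp_all
  define A where "A = fact k * (4 * (C + 3)) / \<rho> ^ k"
  have A: "A > 0" unfolding A_def using C by simp
  have high: "norm ((deriv ^^ k) Qfun s) \<le> A * (1 + \<bar>Im s\<bar>) powr (- 1 / 2)"
    if s: "1 < Re s" "Re s \<le> 2" "1 \<le> \<bar>Im s\<bar>" for s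
  proof -
    define T where "T = hgt e s"
    define r where "r = \<rho> / T ^ 20"
    define \<tau> where "\<tau> = 1 + \<bar>Im s\<bar>"
    have T: "T \<ge> 1" unfolding T_def by (rule hgt1)
    have r: "r > 0" "r \<le> \<rho>" using T C one_le_power[OF T, of 20] by (auto simp: r_def pos_divide_le_eq)
    have near: "\<bar>Re w - Re s\<bar> \<le> 1 / 8" "\<bar>Im w - Im s\<bar> \<le> 1 / 8" if "norm (w - s) \<le> r" for w
      using abs_Re_le_cmod[of "w - s"] abs_Im_le_cmod[of "w - s"] that r C(3) e8 by auto
    have bound: "norm (Qfun w) \<le> 4 * (C + 3) * T ^ 20 / \<tau>"
      and dom: "w \<in> {s. Re s > 0} - {s. Zeta1 s = 0}" if w: "norm (w - s) \<le> r" for w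
    proof -
      let ?q = "norm (1 / (w - 1) + deriv zeta_ext w / zeta_ext w + 1)"
      have "\<bar>Im s\<bar> \<le> \<bar>Im w\<bar> + 1 / 8" "Re s \<le> Re w + 1 / 8" using near[OF w] by linarith+
      hence Re: "Re w > 0" and Im: "\<bar>Im w\<bar> \<ge> 1 / 2" and Im': "\<bar>Im w\<bar> \<ge> \<tau> / 4"
        using s by (auto simp: \<tau>_def)
      have w1: "norm (w - 1) \<ge> 1 / 2" using Im abs_Im_le_cmod[of "w - 1"] by simp
      hence ne: "w \<noteq> 1" by auto
      have z: "zeta_ext w \<noteq> 0" "norm (deriv zeta_ext w / zeta_ext w) \<le> C * T ^ 20"
        using log_deriv[OF s, of w] w by (auto simp: r_def T_def)
      show "w \<in> {s. Re s > 0} - {s. Zeta1 s = 0}" using Re z(1) by (auto simp: zeta_ext_def)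
      have "?q \<le>
          norm (1 / (w - 1)) + norm (deriv zeta_ext w / zeta_ext w) + norm (1 :: complex)"
        by (intro norm_triangle_mono order_refl)
      also have "norm (1 / (w - 1)) \<le> 2"
        unfolding norm_divide using w1 ne by (subst pos_divide_le_eq) auto
      finally have "?q \<le> C * T ^ 20 + 3 * 1"
        using z(2) by simp
      also have "\<dots> \<le> C * T ^ 20 + 3 * T ^ 20" using T by (intro add_left_mono mult_left_mono one_le_power) auto
      finally have num: "?q \<le> (C + 3) * T ^ 20"
        by (simp add: algebra_simps)
      have den: "\<tau> / 4 \<le> norm w" using Im' abs_Im_le_cmod[of w] by linarith
      have "norm (Qfun w) = ?q / norm w"
        unfolding Qfun_eq_zeta_ext[OF Re ne z(1)] by (simp only: norm_divide norm_minus_cancel)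
      also have "\<dots> \<le> (C + 3) * T ^ 20 / (\<tau> / 4)"
        using num den C(1) T by (intro frac_le) (auto simp: \<tau>_def)
      finally show "norm (Qfun w) \<le> 4 * (C + 3) * T ^ 20 / \<tau>" by (simp add: field_simps)
    qed
    have "cball s r \<subseteq> {s. Re s > 0} - {s. Zeta1 s = 0}"
      using dom by (auto simp: dist_norm norm_minus_commute)
    hence hol: "Qfun holomorphic_on cball s r" by (rule holomorphic_on_subset[OF Qfun_holomorphic])
    have "norm ((deriv ^^ k) Qfun s) \<le> fact k * (4 * (C + 3) * T ^ 20 / \<tau>) / r ^ k"
    proof (rule Cauchy_inequality)
      show "norm (Qfun w) \<le> 4 * (C + 3) * T ^ 20 / \<tau>" if "norm (s - w) = r" for w
        using that by (intro bound) (simp add: norm_minus_commute)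
    qed (use r hol holomorphic_on_imp_continuous_on[OF hol] in
        \<open>auto intro: holomorphic_on_subset[OF hol]\<close>)
    also have "\<dots> = A * (T ^ 20 * (T ^ 20) ^ k) / \<tau>"
      using T C(2) by (simp add: A_def r_def power_divide mult_ac)
    also have "T ^ 20 * (T ^ 20) ^ k = T ^ (20 * (k + 1))"
      by (simp flip: power_mult power_add)
    also have "T ^ (20 * (k + 1)) = \<tau> powr (e / 2 * real (20 * (k + 1)))"
      unfolding T_def \<tau>_def by (rule hgt_power)
    also have "e / 2 * real (20 * (k + 1)) = 1 / 2" by (simp add: e_def field_simps)
    also have "A * \<tau> powr (1 / 2) / \<tau> = A * \<tau> powr (1 / 2 - 1)"
      by (subst powr_diff) (auto simp: \<tau>_def)
    finally show ?thesis by (simp add: \<tau>_def)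
  qed
  \<comment> \<open>Low heights are settled by compactness. The rectangle includes its edge on
    \<open>Re s = 1\<close>, where \<open>Zeta1_nonzero\<close> makes \<open>Qfun\<close>
    holomorphic, so the bound is uniform up to the line.\<close>
  define K where "K = {Complex x y | x y. x \<in> {1..2} \<and> y \<in> {-1..1}}"
  have K_eq: "K = cbox (Complex 1 (- 1)) (Complex 2 1)"
    by (auto simp: K_def in_cbox_complex_iff complex_eq_iff intro!: exI)
  have cK: "compact K" unfolding K_eq by (rule compact_cbox)
  have K_sub: "K \<subseteq> {s. Re s > 0} - {s. Zeta1 s = 0}"
    using Zeta1_nonzero by (auto simp: K_def)
  have "(deriv ^^ k) Qfun holomorphic_on {s. Re s > 0} - {s. Zeta1 s = 0}"
    by (intro holomorphic_higher_deriv Qfun_holomorphic Qfun_domain_open)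
  hence "continuous_on K ((deriv ^^ k) Qfun)"
    by (intro holomorphic_on_imp_continuous_on holomorphic_on_subset[OF _ K_sub])
  hence "bounded ((deriv ^^ k) Qfun ` K)" using cK by (intro compact_imp_bounded compact_continuous_image)
  then obtain B where B: "B > 0" "\<And>s. s \<in> K \<Longrightarrow> norm ((deriv ^^ k) Qfun s) \<le> B"
    unfolding bounded_pos by auto
  have low: "norm ((deriv ^^ k) Qfun s) \<le> (2 * B) * (1 + \<bar>Im s\<bar>) powr (- 1 / 2)"
    if s: "1 < Re s" "Re s \<le> 2" "\<bar>Im s\<bar> < 1" for s
  proof -
    have "s \<in> K" using s by (auto simp: K_eq in_cbox_complex_iff)
    hence "norm ((deriv ^^ k) Qfun s) \<le> B * 1" using B by simp
    also have "1 \<le> 2 * (1 + \<bar>Im s\<bar>) powr (- 1 / 2)"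
    proof -
      have "(1 + \<bar>Im s\<bar>) powr (- 1) \<le> (1 + \<bar>Im s\<bar>) powr (- 1 / 2)" by (intro powr_mono) auto
      moreover have "(1 + \<bar>Im s\<bar>) powr (- 1) \<ge> 1 / 2" using s by (simp add: powr_minus field_simps)
      ultimately show ?thesis by linarith
    qed
    finally show ?thesis using B by (simp add: mult_ac)
  qed
  have "norm ((deriv ^^ k) Qfun s) \<le> (A + 2 * B) * (1 + \<bar>Im s\<bar>) powr (- 1 / 2)"
    if "1 < Re s" "Re s \<le> 2" for s
    using high[OF that] low[OF that] A B
    by (cases "1 \<le> \<bar>Im s\<bar>")
       (auto simp: ring_distribs intro: order_trans add_increasing add_increasing2)
  moreover have "A + 2 * B > 0" using A B by simp
  ultimately show ?thesis using that by blast
qed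

section \<open>Fourier inversion for densities\<close>

text \<open>The Fourier transform of the indicator of \<open>{a<..b}\<close>, as it occurs in Levy's
  formula. At \<open>t = 0\<close> division by zero gives 0 instead of \<open>b - a\<close>, which
  integrals over \<open>t\<close> do not notice.\<close>

definition wave :: "real \<Rightarrow> real \<Rightarrow> real \<Rightarrow> complex" where
  "wave a b t = (iexp (- (t * a)) - iexp (- (t * b))) / (\<i> * t)"

definition ftrans :: "(real \<Rightarrow> real) \<Rightarrow> real \<Rightarrow> complex" where
  "ftrans f t = (CLINT v|lborel. f v *\<^sub>R iexp (t * v))"

text \<open>\<open>f\<close> is divided by its mass to obtain a probability distribution, and the
  mass cancels by linearity. A distribution with a density has no atoms, so both endpoints are
  admissible in Levy's formula.\<close>

lemma density_inversion:
  fixes f :: "real \<Rightarrow> real"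
  assumes int: "integrable lborel f" and nonneg: "\<And>v. f v \<ge> 0"
    and pos: "integral\<^sup>L lborel f > 0" and ab: "a \<le> b"
  shows "(\<lambda>T::nat. 1 / (2 * pi) * (CLBINT t=-T..T. wave a b t * ftrans f t))
     \<longlonglongrightarrow> of_real (LBINT v:{a<..b}. f v)"
proof -
  define m where "m = integral\<^sup>L lborel f"
  define g where "g v = f v / m" for v
  have m: "m > 0" using pos by (simp add: m_def)
  have [measurable]: "f \<in> borel_measurable borel" using borel_measurable_integrable[OF int] by simp
  have [measurable]: "g \<in> borel_measurable borel" unfolding g_def[abs_def] by measurable
  have g0: "g v \<ge> 0" for v using nonneg m by (simp add: g_def)
  have gint: "integrable lborel g" unfolding g_def[abs_def] using int by simp
  define M where "M = density lborel (\<lambda>v. ennreal (g v))"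
  have "emeasure M (space M) = (\<integral>\<^sup>+v. ennreal (g v) \<partial>lborel)"
    by (simp add: M_def emeasure_density)
  also have "\<dots> = ennreal (integral\<^sup>L lborel g)"
    using gint g0 by (intro nn_integral_eq_integral) auto
  also have "integral\<^sup>L lborel g = 1" using m by (simp add: g_def[abs_def] m_def)
  finally have "prob_space M" by (intro prob_spaceI) simp
  then interpret real_distribution M
    by (intro real_distribution.intro real_distribution_axioms.intro) (simp_all add: M_def)
  have char: "char M t = ftrans f t / m" for t
  proof -
    have "char M t = (CLINT v|lborel. g v *\<^sub>R iexp (t * v))"
      unfolding char_def M_def by (intro integral_density) (auto simp: g0)
    also have "\<dots> = (CLINT v|lborel. (f v *\<^sub>R iexp (t * v)) / m)"
      by (simp add: g_def scaleR_conv_of_real mult_ac)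
    finally show ?thesis by (simp add: ftrans_def)
  qed
  have meas: "measure M A = (LBINT v:A. f v) / m" if [measurable]: "A \<in> sets borel" for A
  proof -
    have "measure M A = (\<integral>v. indicator A v \<partial>M)" by simp
    also have "\<dots> = (LINT v|lborel. g v *\<^sub>R indicator A v)"
      unfolding M_def by (intro integral_density) (auto simp: g0)
    also have "\<dots> = (LINT v|lborel. (indicator A v *\<^sub>R f v) / m)"
      by (simp add: g_def mult_ac)
    finally show ?thesis by (simp add: set_lebesgue_integral_def)
  qed
  have null: "measure M {c} = 0" for c
  proof -
    have "AE v in lborel. indicator {c} v *\<^sub>R f v = 0"
      using AE_lborel_singleton[of c] by eventually_elim auto
    hence "(LBINT v:{c}. f v) = 0"
      unfolding set_lebesgue_integral_def by (rule integral_eq_zero_AE)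
    thus ?thesis by (simp add: meas)
  qed
  have "(\<lambda>T::nat. 1 / (2 * pi) * (CLBINT t=-T..T. wave a b t * (ftrans f t / m)))
     \<longlonglongrightarrow> of_real ((LBINT v:{a<..b}. f v) / m)"
    using Levy_Inversion[OF ab null null] unfolding char wave_def by (simp add: meas)
  moreover have "(CLBINT t=-T..T. wave a b t * (ftrans f t / m)) =
      (CLBINT t=-T..T. wave a b t * ftrans f t) / m" for T
    by simp
  ultimately have "(\<lambda>T::nat. of_real m * (1 / (2 * pi) * ((CLBINT t=-T..T. wave a b t * ftrans f t) / m)))
     \<longlonglongrightarrow> of_real m * of_real ((LBINT v:{a<..b}. f v) / m)"
    by (intro tendsto_mult_left) simp
  thus ?thesis using m by simp
qed

lemma ftrans_measurable [measurable]:
  assumes [measurable]: "f \<in> borel_measurable borel"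
  shows "ftrans f \<in> borel_measurable borel"
  unfolding ftrans_def[abs_def] by measurable

lemma wave_measurable [measurable]: "wave a b \<in> borel_measurable borel"
  unfolding wave_def[abs_def] by measurable

lemma wave_bound:
  assumes "a \<le> b" "b \<le> a + 1"
  shows "norm (wave a b t) \<le> 4 / (1 + \<bar>t\<bar>)"
proof (cases "t = 0")
  case False
  have "wave a b t = (iexp (t * (- a)) - iexp (t * (- b))) / (\<i> * t)" by (simp add: wave_def)
  hence 1: "norm (wave a b t) \<le> 1"
    using Levy_Inversion_aux2[of "- b" "- a" t] False assms by simp
  have "norm (iexp (- (t * a)) - iexp (- (t * b))) \<le> 1 + 1"
    by (rule order_trans[OF norm_triangle_ineq4]) simp
  hence 2: "norm (wave a b t) \<le> 2 / \<bar>t\<bar>"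
    unfolding wave_def norm_divide using False by (simp add: norm_mult divide_right_mono)
  show ?thesis
  proof (cases "\<bar>t\<bar> \<le> 1")
    case True
    hence "1 \<le> 4 / (1 + \<bar>t\<bar>)" by (simp add: field_simps)
    with 1 show ?thesis by linarith
  next
    case far: False
    hence "2 / \<bar>t\<bar> \<le> 4 / (1 + \<bar>t\<bar>)" by (simp add: field_simps)
    with 2 show ?thesis by linarith
  qed
qed (simp add: wave_def)

lemma integrable_decay: "integrable lborel (\<lambda>t::real. (1 + \<bar>t\<bar>) powr (- 3 / 2))"
proof -
  let ?f = "\<lambda>t::real. (1 + \<bar>t\<bar>) powr (- 3 / 2)"
  have "(\<integral>\<^sup>+t. ennreal (?f t) * indicator {0..} t \<partial>lborel) = ennreal (0 - (- 2 * (1 + 0) powr (- 1 / 2)))"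
  proof (rule nn_integral_FTC_atLeast)
    fix t :: real assume "0 \<le> t"
    hence "((\<lambda>t. - 2 * (1 + t) powr (- 1 / 2)) has_real_derivative
        - 2 * ((- 1 / 2) * (1 + t) powr (- 1 / 2 - 1))) (at t)"
      by (auto intro!: derivative_eq_intros)
    moreover have "- 2 * ((- 1 / 2) * (1 + t) powr (- 1 / 2 - 1)) = ?f t" using \<open>0 \<le> t\<close> by simp
    ultimately show "((\<lambda>t. - 2 * (1 + t) powr (- 1 / 2)) has_real_derivative ?f t) (at t)" by simp
  next
    have "((\<lambda>t::real. (1 + t) powr (- (1 / 2))) \<longlongrightarrow> 0) at_top"
      by (intro tendsto_neg_powr filterlim_tendsto_add_at_top[OF tendsto_const] filterlim_ident) auto
    from tendsto_mult_left[OF this, of "- 2"]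
    show "((\<lambda>t::real. - 2 * (1 + t) powr (- 1 / 2)) \<longlongrightarrow> 0) at_top" by simp
  qed auto
  hence "(\<integral>\<^sup>+t. ennreal (indicator {0..} t *\<^sub>R ?f t) \<partial>lborel) < \<infinity>"
    by (simp add: indicator_mult_ennreal mult.commute)
  hence "integrable lborel (\<lambda>t. indicator {0..} t *\<^sub>R ?f t)"
    by (intro integrableI_nonneg) auto
  hence "has_bochner_integral lborel (\<lambda>t. indicator {0..} t *\<^sub>R ?f t)
      (integral\<^sup>L lborel (\<lambda>t. indicator {0..} t *\<^sub>R ?f t))"
    by (rule has_bochner_integral_integrable)
  from has_bochner_integral_even_function[OF this] show ?thesis
    by (auto simp: has_bochner_integral_iff)
qed

text \<open>Only the difference of the transforms is known to decay; together with
  \<open>wave_bound\<close> it is dominated by an integrable function, uniformly in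
  \<open>T\<close>. The factor \<open>4\<close> of that bound is absorbed by
  \<open>4 / (2 * pi) \<le> 1\<close>.\<close>

lemma density_difference_bound:
  fixes f g :: "real \<Rightarrow> real"
  assumes f: "integrable lborel f" "\<And>v. f v \<ge> 0" "integral\<^sup>L lborel f > 0"
    and g: "integrable lborel g" "\<And>v. g v \<ge> 0" "integral\<^sup>L lborel g > 0"
    and ab: "a \<le> b" "b \<le> a + 1"
    and C: "C \<ge> 0" "\<And>t. norm (ftrans f t - ftrans g t) \<le> C * (1 + \<bar>t\<bar>) powr (- 1 / 2)"
  shows "\<bar>LBINT v:{a<..b}. f v - g v\<bar> \<le> C * (LBINT t. (1 + \<bar>t\<bar>) powr (- 3 / 2))"
proof -
  define I where "I = (LBINT t. (1 + \<bar>t\<bar>) powr (- 3 / 2) :: real)"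
  have [measurable]: "f \<in> borel_measurable borel" "g \<in> borel_measurable borel"
    using borel_measurable_integrable[OF f(1)] borel_measurable_integrable[OF g(1)] by simp_all
  have int: "set_integrable lborel {- real T..real T} (\<lambda>t. wave a b t * ftrans h t)"
    if h: "integrable lborel h" "h \<in> borel_measurable borel" for h and T :: nat
    unfolding set_integrable_def
  proof (rule integrableI_bounded_set_indicator)
    have "norm (wave a b t * ftrans h t) \<le> 4 * integral\<^sup>L lborel (\<lambda>v. \<bar>h v\<bar>)" for t
    proof -
      have "norm (wave a b t) \<le> 4 / (1 + \<bar>t\<bar>)" using ab by (rule wave_bound)
      also have "\<dots> \<le> 4" by (simp add: field_simps)
      finally have "norm (wave a b t) \<le> 4" .
      moreover have "norm (ftrans h t) \<le> integral\<^sup>L lborel (\<lambda>v. norm (h v *\<^sub>R iexp (t * v)))"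
        unfolding ftrans_def by (rule integral_norm_bound)
      hence "norm (ftrans h t) \<le> integral\<^sup>L lborel (\<lambda>v. \<bar>h v\<bar>)" by simp
      ultimately show ?thesis unfolding norm_mult by (intro mult_mono) auto
    qed
    thus "AE t in lborel. t \<in> {- real T..real T} \<longrightarrow>
        norm (wave a b t * ftrans h t) \<le> 4 * integral\<^sup>L lborel (\<lambda>v. \<bar>h v\<bar>)" by simp
  qed (use h(2) in auto)
  have bound: "norm (1 / (2 * pi) * (CLBINT t=-T..T. wave a b t * ftrans f t) -
      1 / (2 * pi) * (CLBINT t=-T..T. wave a b t * ftrans g t)) \<le> C * I" for T :: nat
  proof -
    let ?J = "{- real T..real T}"
    let ?h = "\<lambda>t. wave a b t * (ftrans f t - ftrans g t)"
    have fg: "set_integrable lborel ?J (\<lambda>t. wave a b t * ftrans f t)"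
       "set_integrable lborel ?J (\<lambda>t. wave a b t * ftrans g t)"
      by (intro int f g; simp)+
    have "(CLBINT t=-T..T. wave a b t * ftrans f t) - (CLBINT t=-T..T. wave a b t * ftrans g t) =
        (CLBINT t:?J. wave a b t * ftrans f t) - (CLBINT t:?J. wave a b t * ftrans g t)"
      using interval_integral_Icc[of "- real T" "real T" "\<lambda>t. wave a b t * ftrans f t"]
        interval_integral_Icc[of "- real T" "real T" "\<lambda>t. wave a b t * ftrans g t"] by simp
    also have "\<dots> = (CLBINT t:?J. ?h t)"
      using set_integral_diff(2)[OF fg] by (simp add: algebra_simps)
    finally have eq: "(CLBINT t=-T..T. wave a b t * ftrans f t) - (CLBINT t=-T..T. wave a b t * ftrans g t)
        = (CLBINT t:?J. ?h t)" .
    have hint: "set_integrable lborel ?J ?h"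
      using set_integral_diff(1)[OF fg] by (simp add: algebra_simps)
    have "norm (CLBINT t:?J. ?h t) \<le> (LBINT t. 4 * C * (1 + \<bar>t\<bar>) powr (- 3 / 2))"
      unfolding set_lebesgue_integral_def
    proof (rule Bochner_Integration.integral_norm_bound_integral)
      show "integrable lborel (\<lambda>t. indicator ?J t *\<^sub>R ?h t)"
        using hint by (simp add: set_integrable_def)
      show "integrable lborel (\<lambda>t::real. 4 * C * (1 + \<bar>t\<bar>) powr (- 3 / 2))"
        using integrable_decay by simp
      fix t :: real
      have "norm (?h t) \<le> 4 / (1 + \<bar>t\<bar>) * (C * (1 + \<bar>t\<bar>) powr (- 1 / 2))"
        unfolding norm_mult using C ab by (intro mult_mono wave_bound) auto
      also have "\<dots> = 4 * C * ((1 + \<bar>t\<bar>) powr (- 1 / 2) / (1 + \<bar>t\<bar>) powr 1)" by simp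
      also have "\<dots> = 4 * C * (1 + \<bar>t\<bar>) powr (- 3 / 2)" by (subst powr_diff[symmetric]) simp
      finally have "norm (?h t) \<le> 4 * C * (1 + \<bar>t\<bar>) powr (- 3 / 2)" .
      moreover have "norm (indicator ?J t *\<^sub>R ?h t) \<le> norm (?h t)"
        by (simp add: indicator_def)
      ultimately show "norm (indicator ?J t *\<^sub>R ?h t) \<le> 4 * C * (1 + \<bar>t\<bar>) powr (- 3 / 2)"
        by linarith
    qed
    also have "\<dots> = 4 * C * I" by (simp add: I_def)
    finally have le: "norm (CLBINT t:?J. ?h t) \<le> 4 * C * I" .
    have I0: "I \<ge> 0" unfolding I_def by (intro integral_nonneg_AE) auto
    have "norm (1 / (2 * pi) * (CLBINT t=-T..T. wave a b t * ftrans f t) -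
      1 / (2 * pi) * (CLBINT t=-T..T. wave a b t * ftrans g t)) =
      1 / (2 * pi) * norm (CLBINT t:?J. ?h t)"
      unfolding eq[symmetric] right_diff_distrib[symmetric] norm_mult by (simp add: norm_divide)
    also have "\<dots> \<le> 1 / (2 * pi) * (4 * C * I)" using le by (intro mult_left_mono) auto
    also have "\<dots> = (2 / pi) * (C * I)" by simp
    also have "\<dots> \<le> 1 * (C * I)"
      using pi_ge_two C(1) I0 by (intro mult_right_mono) auto
    finally show ?thesis by simp
  qed
  have "(\<lambda>T::nat. 1 / (2 * pi) * (CLBINT t=-T..T. wave a b t * ftrans f t) -
      1 / (2 * pi) * (CLBINT t=-T..T. wave a b t * ftrans g t)) \<longlonglongrightarrow>
      of_real (LBINT v:{a<..b}. f v) - of_real (LBINT v:{a<..b}. g v)"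
    by (intro tendsto_diff density_inversion f g ab)
  hence "norm (complex_of_real (LBINT v:{a<..b}. f v) - of_real (LBINT v:{a<..b}. g v)) \<le> C * I"
    using bound by (intro tendsto_upperbound[OF tendsto_norm]) auto
  moreover have "(LBINT v:{a<..b}. f v - g v) = (LBINT v:{a<..b}. f v) - (LBINT v:{a<..b}. g v)"
    by (intro set_integral_diff(2)) (unfold set_integrable_def, (intro integrable_mult_indicator f g; simp)+)
  ultimately show ?thesis by (simp add: I_def flip: of_real_diff)
qed

section \<open>Laplace transforms\<close>

lemma exp_tail_integral:
  fixes s :: complex
  assumes s: "Re s > 0"
  shows "integrable lborel (\<lambda>v. indicator {a..} v *\<^sub>R exp (- (s * of_real v)))"
    and "(CLINT v|lborel. indicator {a..} v *\<^sub>R exp (- (s * of_real v))) = exp (- (s * of_real a)) / s"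
    and "integrable lborel (\<lambda>v. indicator {a..} v * exp (- (Re s * v)))"
    and "(LINT v|lborel. indicator {a..} v * exp (- (Re s * v))) = exp (- (Re s * a)) / Re s"
proof -
  let ?r = "\<lambda>v. indicator {a..} v * exp (- (Re s * v))"
  have decay: "((\<lambda>v::real. exp (- (Re s * v))) \<longlongrightarrow> 0) at_top"
    using s by (intro filterlim_compose[OF exp_at_bot] filterlim_uminus_at_bot_at_top[THEN filterlim_compose]
          filterlim_tendsto_pos_mult_at_top[OF tendsto_const] filterlim_ident)
  have "(\<integral>\<^sup>+v. ennreal (exp (- (Re s * v))) * indicator {a..} v \<partial>lborel) =
     ennreal (0 - (- exp (- (Re s * a)) / Re s))"
  proof (rule nn_integral_FTC_atLeast)
    from tendsto_mult_left[OF decay, of "- 1 / Re s"]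
    show "((\<lambda>v::real. - exp (- (Re s * v)) / Re s) \<longlongrightarrow> 0) at_top" by simp
  qed (use s in \<open>auto intro!: derivative_eq_intros\<close>)
  hence nn: "(\<integral>\<^sup>+v. ennreal (?r v) \<partial>lborel) = ennreal (exp (- (Re s * a)) / Re s)"
    by (simp add: indicator_mult_ennreal mult.commute)
  have "has_bochner_integral lborel ?r (exp (- (Re s * a)) / Re s)"
    using nn s by (intro has_bochner_integral_nn_integral) auto
  thus r: "integrable lborel ?r" and "(LINT v|lborel. ?r v) = exp (- (Re s * a)) / Re s"
    by (auto simp: has_bochner_integral_iff)
  show c: "integrable lborel (\<lambda>v. indicator {a..} v *\<^sub>R exp (- (s * of_real v)))"
    by (rule Bochner_Integration.integrable_bound[OF r]) (auto simp: indicator_def norm_exp_eq_Re)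
  have s0: "s \<noteq> 0" using s by auto
  have o: "set_integrable lborel {a<..} (\<lambda>v. exp (- (s * of_real v)))"
    by (rule set_integrable_subset[where A = "{a..}"]) (use c in \<open>auto simp: set_integrable_def\<close>)
  have "(LBINT v=ereal a..\<infinity>. exp (- (s * of_real v))) = 0 - (- exp (- (s * of_real a)) / s)"
  proof (rule interval_integral_FTC_integrable)
    fix v :: real
    have "((\<lambda>z. - exp (- (s * z)) / s) has_field_derivative exp (- (s * of_real v))) (at (of_real v))"
      using s0 by (auto intro!: derivative_eq_intros)
    thus "((\<lambda>v. - exp (- (s * of_real v)) / s) has_vector_derivative exp (- (s * of_real v))) (at v)"
      by (rule has_vector_derivative_real_field)
    show "isCont (\<lambda>v. exp (- (s * complex_of_real v))) v" by (intro continuous_intros)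
  next
    show "set_integrable lborel (einterval (ereal a) \<infinity>) (\<lambda>v. exp (- (s * of_real v)))"
      using o by simp
    have "((\<lambda>v. - exp (- (s * of_real v)) / s) \<longlongrightarrow> - exp (- (s * of_real a)) / s) (at_right a)"
      using s0 by (intro tendsto_intros)
    thus "(((\<lambda>v. - exp (- (s * of_real v)) / s) \<circ> real_of_ereal) \<longlongrightarrow> - exp (- (s * of_real a)) / s)
        (at_right (ereal a))"
      by (simp add: ereal_tendsto_simps)
    have "((\<lambda>v. - exp (- (s * of_real v)) / s) \<longlongrightarrow> 0) at_top"
    proof (rule tendsto_norm_zero_cancel)
      from tendsto_mult_left[OF decay, of "1 / norm s"]
      show "((\<lambda>v. norm (- exp (- (s * of_real v)) / s)) \<longlongrightarrow> 0) at_top"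
        by (simp add: norm_divide norm_exp_eq_Re)
    qed
    thus "(((\<lambda>v. - exp (- (s * of_real v)) / s) \<circ> real_of_ereal) \<longlongrightarrow> 0) (at_left \<infinity>)"
      by (simp add: ereal_tendsto_simps)
  qed simp
  hence "(CLBINT v:{a<..}. exp (- (s * of_real v))) = exp (- (s * of_real a)) / s"
    by (simp add: interval_integral_to_infinity_eq)
  moreover have "(CLBINT v:{a<..}. exp (- (s * of_real v))) = (CLBINT v:{a..}. exp (- (s * of_real v)))"
    unfolding set_lebesgue_integral_def
  proof (rule integral_cong_AE)
    show "AE v in lborel. indicator {a<..} v *\<^sub>R exp (- (s * complex_of_real v)) =
        indicator {a..} v *\<^sub>R exp (- (s * complex_of_real v))"
      using AE_lborel_singleton[of a] by eventually_elim (auto simp: indicator_def)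
  qed auto
  ultimately show "(CLINT v|lborel. indicator {a..} v *\<^sub>R exp (- (s * of_real v))) = exp (- (s * of_real a)) / s"
    by (simp add: set_lebesgue_integral_def)
qed

text \<open>The weight \<open>v ^ k\<close> keeps derivatives in \<open>s\<close> inside the
  family.\<close>

definition laplace :: "(real \<Rightarrow> real) \<Rightarrow> nat \<Rightarrow> complex \<Rightarrow> complex" where
  "laplace e k s = (CLINT v|lborel. (e v * v ^ k) *\<^sub>R exp (- (s * of_real v)))"

text \<open>The growth condition covers \<open>psi (exp v)\<close>, by the elementary
  \<open>psi x \<le> x * ln x\<close>, as well as \<open>exp v\<close> and the difference of the
  two.\<close>

locale laplace_kernel =
  fixes e :: "real \<Rightarrow> real"
  assumes e_measurable [measurable]: "e \<in> borel_measurable borel"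
    and e_neg: "\<And>v. v < 0 \<Longrightarrow> e v = 0"
    and e_bound: "\<And>v. v \<ge> 0 \<Longrightarrow> \<bar>e v\<bar> \<le> (v + 1) * exp v"
begin

lemma integrable_real:
  assumes "\<sigma> > 1"
  shows "integrable lborel (\<lambda>v. \<bar>e v\<bar> * v ^ k * exp (- (\<sigma> * v)))"
proof -
  \<comment> \<open>Half of the excess \<open>\<sigma> - 1\<close> absorbs the polynomial factors,
    the other half supplies the decay.\<close>
  define c where "c = (\<sigma> - 1) / 2"
  have c: "c > 0" using assms by (simp add: c_def)
  define K where "K = fact (Suc k) / c ^ Suc k + fact k / c ^ k"
  have pw: "v ^ j \<le> fact j / c ^ j * exp (c * v)" if "v \<ge> 0" for v j
  proof -
    have "(c * v) ^ j / fact j \<le> exp (c * v)"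
    proof -
      have "(\<lambda>n. (c * v) ^ n / fact n) sums exp (c * v)"
        using exp_converges[of "c * v"] by (simp add: divide_inverse mult.commute)
      hence "(\<Sum>n\<in>{j}. (c * v) ^ n / fact n) \<le> exp (c * v)"
        using that c sum_le_suminf[of "\<lambda>n. (c * v) ^ n / fact n" "{j}"] by (simp add: sums_iff)
      thus ?thesis by simp
    qed
    thus ?thesis using c by (simp add: power_mult_distrib field_simps)
  qed
  show ?thesis
  proof (rule Bochner_Integration.integrable_bound)
    show "integrable lborel (\<lambda>v. K * (indicator {0..} v * exp (- (Re (of_real c) * v))))"
      using exp_tail_integral(3)[of "of_real c" 0] c by (intro integrable_mult_right) auto
    show "AE v in lborel. norm (\<bar>e v\<bar> * v ^ k * exp (- (\<sigma> * v))) \<le>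
        norm (K * (indicator {0..} v * exp (- (Re (of_real c) * v))))"
    proof (intro AE_I2)
      fix v :: real
      show "norm (\<bar>e v\<bar> * v ^ k * exp (- (\<sigma> * v))) \<le>
        norm (K * (indicator {0..} v * exp (- (Re (of_real c) * v))))"
      proof (cases "v < 0")
        case False
        hence v: "v \<ge> 0" by simp
        have "\<bar>e v\<bar> * v ^ k * exp (- (\<sigma> * v)) \<le> ((v + 1) * exp v) * v ^ k * exp (- (\<sigma> * v))"
          using v e_bound by (intro mult_right_mono) auto
        also have "\<dots> = (v ^ Suc k + v ^ k) * (exp v * exp (- (\<sigma> * v)))"
          by (simp add: algebra_simps)
        also have "exp v * exp (- (\<sigma> * v)) = exp (- (2 * c * v))"
        proof -
          have "2 * c = \<sigma> - 1" by (simp add: c_def)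
          hence "v + - (\<sigma> * v) = - (2 * c * v)" by (simp only:) (simp add: algebra_simps)
          thus ?thesis by (simp only: exp_add[symmetric])
        qed
        also have "(v ^ Suc k + v ^ k) * exp (- (2 * c * v)) \<le> (K * exp (c * v)) * exp (- (2 * c * v))"
          using pw[OF v, of k] pw[OF v, of "Suc k"] by (intro mult_right_mono) (auto simp: K_def ring_distribs)
        also have "\<dots> = K * exp (- (c * v))" by (simp add: mult.assoc flip: exp_add)
        finally show ?thesis using v c by (simp add: K_def abs_mult)
      qed (simp add: e_neg)
    qed
  qed measurable
qed

lemma integrable_complex:
  assumes "Re s > 1"
  shows "integrable lborel (\<lambda>v. (e v * v ^ k) *\<^sub>R exp (- (s * of_real v)))"
proof (rule Bochner_Integration.integrable_bound[OF integrable_real[OF assms, of k]])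
  show "AE v in lborel. norm ((e v * v ^ k) *\<^sub>R exp (- (s * of_real v))) \<le>
      norm (\<bar>e v\<bar> * v ^ k * exp (- (Re s * v)))"
    by (intro AE_I2) (simp add: norm_exp_eq_Re abs_mult)
qed measurable

text \<open>The second order Taylor bound for \<open>exp\<close> makes the error of the difference
  quotient at most \<open>K * norm h\<close>. Keeping \<open>h\<close> within half of the distance
  \<open>Re s - 1\<close> leaves the majorant with weight \<open>v ^ (k + 2)\<close>
  integrable.\<close>

lemma laplace_deriv:
  assumes s: "Re s > 1"
  shows "(laplace e k has_field_derivative - laplace e (Suc k) s) (at s)"
proof -
  define r where "r = (Re s - 1) / 2"
  have r: "r > 0" using s by (simp add: r_def)
  define K where "K = (LINT v|lborel. \<bar>e v\<bar> * v ^ (k + 2) * exp (- ((Re s - r) * v)))"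
  have sr: "Re s - r > 1" using s by (simp add: r_def field_simps)
  have quot: "norm ((laplace e k (s + h) - laplace e k s) / h - (- laplace e (Suc k) s)) \<le> K * norm h"
    if h: "norm h < r" "h \<noteq> 0" for h
  proof -
    have sh: "Re (s + h) > 1" using abs_Re_le_cmod[of h] h sr by simp
    let ?t = "\<lambda>v. (e v * v ^ k) *\<^sub>R exp (- ((s + h) * of_real v)) - (e v * v ^ k) *\<^sub>R exp (- (s * of_real v))
        + h * ((e v * v ^ Suc k) *\<^sub>R exp (- (s * of_real v)))"
    have "laplace e k (s + h) - laplace e k s + h * laplace e (Suc k) s = (CLINT v|lborel. ?t v)"
    proof -
      note i1 = integrable_complex[OF sh, of k] and i2 = integrable_complex[OF s, of k]
      have i3: "integrable lborel (\<lambda>v. h * ((e v * v ^ Suc k) *\<^sub>R exp (- (s * of_real v))))"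
        by (intro integrable_mult_right integrable_complex s)
      show ?thesis unfolding laplace_def
        by (simp only: Bochner_Integration.integral_add[OF Bochner_Integration.integrable_diff[OF i1 i2] i3]
            Bochner_Integration.integral_diff[OF i1 i2] integral_mult_right_zero)
    qed
    also have "norm \<dots> \<le> (LINT v|lborel. (norm h)\<^sup>2 * (\<bar>e v\<bar> * v ^ (k + 2) * exp (- ((Re s - r) * v))))"
    proof (rule Bochner_Integration.integral_norm_bound_integral)
      show "integrable lborel ?t"
        by (intro Bochner_Integration.integrable_add Bochner_Integration.integrable_diff
            integrable_mult_right integrable_complex s sh)
      show "integrable lborel (\<lambda>v. (norm h)\<^sup>2 * (\<bar>e v\<bar> * v ^ (k + 2) * exp (- ((Re s - r) * v))))"
        by (intro integrable_mult_right integrable_real sr)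
      fix v :: real
      show "norm (?t v) \<le> (norm h)\<^sup>2 * (\<bar>e v\<bar> * v ^ (k + 2) * exp (- ((Re s - r) * v)))"
      proof (cases "v < 0")
        case False
        hence v: "v \<ge> 0" by simp
        define z where "z = - (h * of_real v)"
        have "?t v = (e v * v ^ k) *\<^sub>R (exp (- (s * of_real v)) * (exp z - (1 + z)))"
          by (simp add: z_def scaleR_conv_of_real algebra_simps flip: exp_add)
        hence "norm (?t v) = \<bar>e v\<bar> * v ^ k * (exp (- (Re s * v)) * norm (exp z - (1 + z)))"
          using v by (simp add: norm_mult norm_exp_eq_Re abs_mult)
        also have "\<dots> \<le> \<bar>e v\<bar> * v ^ k * (exp (- (Re s * v)) * (exp (r * v) * (norm h * v)\<^sup>2))"
        proof (intro mult_left_mono)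
          have "norm (exp z - (1 + z)) \<le> exp \<bar>Re z\<bar> * norm z ^ Suc 1 / fact 1"
            using Taylor_exp[of z 1] by simp
          also have "\<dots> = exp \<bar>Re z\<bar> * (norm h * v)\<^sup>2" using v by (simp add: z_def norm_mult power2_eq_square)
          also have "\<dots> \<le> exp (r * v) * (norm h * v)\<^sup>2"
          proof (intro mult_right_mono, subst exp_le_cancel_iff)
            have "\<bar>Re z\<bar> = \<bar>Re h\<bar> * v" using v by (simp add: z_def abs_mult)
            also have "\<dots> \<le> r * v" using abs_Re_le_cmod[of h] h v by (intro mult_right_mono) auto
            finally show "\<bar>Re z\<bar> \<le> r * v" .
          qed auto
          finally show "norm (exp z - (1 + z)) \<le> exp (r * v) * (norm h * v)\<^sup>2" .
        qed (use v in auto)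
        also have "\<dots> = (norm h)\<^sup>2 * (\<bar>e v\<bar> * v ^ (k + 2) * exp (- ((Re s - r) * v)))"
        proof -
          have "exp (- ((Re s - r) * v)) = exp (- (Re s * v)) * exp (r * v)"
            by (simp add: algebra_simps flip: exp_add)
          thus ?thesis by (simp add: power_mult_distrib power_add power2_eq_square mult_ac)
        qed
        finally show ?thesis .
      qed (simp add: e_neg)
    qed
    also have "\<dots> = (norm h)\<^sup>2 * K" by (simp add: K_def)
    finally have "norm (laplace e k (s + h) - laplace e k s + h * laplace e (Suc k) s) \<le> (norm h)\<^sup>2 * K" .
    moreover have "(laplace e k (s + h) - laplace e k s) / h - (- laplace e (Suc k) s) =
        (laplace e k (s + h) - laplace e k s + h * laplace e (Suc k) s) / h"
      using h by (simp add: field_simps)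
    ultimately show ?thesis
      using h unfolding norm_divide by (simp add: pos_divide_le_eq norm_divide power2_eq_square mult_ac)
  qed
  have "((\<lambda>h. (laplace e k (s + h) - laplace e k s) / h - (- laplace e (Suc k) s)) \<longlongrightarrow> 0) (at 0)"
  proof (rule Lim_null_comparison)
    show "\<forall>\<^sub>F h in at 0. norm ((laplace e k (s + h) - laplace e k s) / h - (- laplace e (Suc k) s)) \<le> K * norm h"
      unfolding eventually_at using quot r by (intro exI[of _ r]) (simp add: dist_norm)
    show "((\<lambda>h::complex. K * norm h) \<longlongrightarrow> 0) (at 0)"
      by (auto intro!: tendsto_eq_intros)
  qed
  thus ?thesis unfolding DERIV_def by (rule LIM_zero_cancel)
qed

lemma laplace_higher_deriv:
  assumes "\<And>s. Re s > 1 \<Longrightarrow> laplace e 0 s = q s" "Re s > 1"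
  shows "(deriv ^^ k) q s = (- 1) ^ k * laplace e k s"
  using assms(2)
proof (induction k arbitrary: s)
  case 0
  thus ?case using assms(1) by simp
next
  case (Suc k)
  have "((\<lambda>s. (- 1) ^ k * laplace e k s) has_field_derivative (- 1) ^ k * (- laplace e (Suc k) s)) (at s)"
    by (intro DERIV_cmult laplace_deriv Suc.prems)
  hence "((deriv ^^ k) q has_field_derivative (- 1) ^ k * (- laplace e (Suc k) s)) (at s)"
    by (rule has_field_derivative_transform_within_open[where S = "{s. Re s > 1}"])
       (use Suc in \<open>auto simp: open_halfspace_Re_gt\<close>)
  thus ?case by (simp add: DERIV_imp_deriv)
qed

end

section \<open>The prime number theorem with error term\<close>

definition psi :: "real \<Rightarrow> real" where
  "psi x = (\<Sum>n\<le>nat \<lfloor>x\<rfloor>. mangoldt n)"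

lemma psi_nonneg: "psi x \<ge> 0"
  unfolding psi_def by (intro sum_nonneg mangoldt_nonneg)

lemma psi_mono: "x \<le> y \<Longrightarrow> psi x \<le> psi y"
  unfolding psi_def by (intro sum_mono2 mangoldt_nonneg) (auto intro: nat_mono floor_mono)

lemma psi_le:
  assumes "x \<ge> 1"
  shows "psi x \<le> x * ln x"
proof -
  have "psi x = (\<Sum>n\<in>{1..nat \<lfloor>x\<rfloor>}. mangoldt n)"
    unfolding psi_def by (intro sum.mono_neutral_right) (auto simp: not_le)
  also have "\<dots> \<le> (\<Sum>n\<in>{1..nat \<lfloor>x\<rfloor>}. ln x)"
  proof (rule sum_mono)
    fix n assume "n \<in> {1..nat \<lfloor>x\<rfloor>}"
    hence n: "n > 0" "real n \<le> x" using assms by (auto simp: le_nat_floor le_nat_iff le_floor_iff)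
    have "(mangoldt n :: real) \<le> ln n" using n by (intro mangoldt_le_ln)
    also have "\<dots> \<le> ln x" using n by simp
    finally show "(mangoldt n :: real) \<le> ln x" .
  qed
  also have "\<dots> = real (nat \<lfloor>x\<rfloor>) * ln x" by simp
  also have "\<dots> \<le> x * ln x" using assms by (intro mult_right_mono) (auto simp: of_nat_nat)
  finally show ?thesis .
qed

definition psi_exp :: "real \<Rightarrow> real" where
  "psi_exp v = (if v < 0 then 0 else psi (exp v))"

definition pos_exp :: "real \<Rightarrow> real" where
  "pos_exp v = (if v < 0 then 0 else exp v)"

lemma psi_exp_bound:
  assumes "v \<ge> 0"
  shows "0 \<le> psi_exp v" "psi_exp v \<le> v * exp v"
  using assms psi_le[of "exp v"] psi_nonneg by (simp_all add: psi_exp_def mult.commute)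

lemma psi_exp_measurable [measurable]: "psi_exp \<in> borel_measurable borel"
proof -
  have "mono (\<lambda>v. psi (exp v))" by (intro monoI psi_mono) simp
  hence [measurable]: "(\<lambda>v. psi (exp v)) \<in> borel_measurable borel" by (rule borel_measurable_mono)
  show ?thesis unfolding psi_exp_def[abs_def] by measurable
qed

lemma pos_exp_measurable [measurable]: "pos_exp \<in> borel_measurable borel"
  unfolding pos_exp_def[abs_def] by measurable

interpretation kernel_psi: laplace_kernel psi_exp
proof
  fix v :: real assume "v \<ge> 0"
  thus "\<bar>psi_exp v\<bar> \<le> (v + 1) * exp v"
    using psi_exp_bound[of v] by (simp add: ring_distribs add_increasing2)
qed (auto simp: psi_exp_def)

interpretation kernel_pos: laplace_kernel pos_exp
  by standard (auto simp: pos_exp_def)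

interpretation kernel_diff: laplace_kernel "\<lambda>v. psi_exp v - pos_exp v"
proof
  show "(\<lambda>v. psi_exp v - pos_exp v) \<in> borel_measurable borel" by measurable
  fix v :: real assume "v \<ge> 0"
  thus "\<bar>psi_exp v - pos_exp v\<bar> \<le> (v + 1) * exp v"
    using psi_exp_bound[of v] by (auto simp: ring_distribs pos_exp_def abs_le_iff intro: add_increasing)
qed (auto simp: psi_exp_def pos_exp_def)

text \<open>\<open>psi (exp v)\<close> collects \<open>mangoldt n\<close> over the
  \<open>n > 0\<close> with \<open>ln n \<le> v\<close>, so each \<open>n\<close> contributes the
  integral of an exponential over \<open>{ln n..}\<close>. Sum and integral commute because the
  integrals of the norms form a convergent Dirichlet series.\<close>

lemma laplace_psi_exp:
  assumes s: "Re s > 1"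
  shows "laplace psi_exp 0 s = dseries mangoldt s / s"
proof -
  define F :: "nat \<Rightarrow> real \<Rightarrow> complex" where
    "F n v = mangoldt n *\<^sub>R (indicator {ln (real n)..} v *\<^sub>R exp (- (s * of_real v)))" for n v
  have s0: "Re s > 0" using s by simp
  have ind0: "mangoldt n *\<^sub>R (indicator {ln (real n)..} v *\<^sub>R z) = 0"
    if "n > nat \<lfloor>exp v\<rfloor> \<or> n = 0" for n v and z :: complex
  proof (cases "n = 0")
    case False
    hence "exp v < real n" using that by (simp add: nat_less_iff floor_less_iff)
    hence "v < ln (real n)" using False by (simp add: exp_less_cancel_iff flip: exp_less_cancel_iff[of v])
    thus ?thesis by simp
  qed simp
  have Fz: "F n v = 0" if "n \<notin> {..nat \<lfloor>exp v\<rfloor>}" for n v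
    unfolding F_def by (rule ind0) (use that in auto)
  have pointwise: "(psi_exp v * v ^ 0) *\<^sub>R exp (- (s * of_real v)) = (\<Sum>n. F n v)" for v
  proof -
    have "(\<Sum>n. F n v) = (\<Sum>n\<le>nat \<lfloor>exp v\<rfloor>. F n v)"
      by (intro suminf_finite Fz) auto
    also have "\<dots> = (\<Sum>n\<le>nat \<lfloor>exp v\<rfloor>. (if v < 0 then 0 else mangoldt n) *\<^sub>R exp (- (s * of_real v)))"
    proof (rule sum.cong)
      fix n assume n: "n \<in> {..nat \<lfloor>exp v\<rfloor>}"
      show "F n v = (if v < 0 then 0 else mangoldt n) *\<^sub>R exp (- (s * of_real v))"
      proof (cases "n = 0")
        case False
        hence le: "real n \<le> exp v" using n by (simp add: le_nat_iff le_floor_iff)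
        hence "ln (real n) \<le> v" using False by (metis exp_gt_zero ln_exp ln_mono of_nat_0_less_iff not_gr0)
        moreover have "ln (real n) \<ge> 0" using False by simp
        ultimately show ?thesis by (simp add: F_def)
      qed (simp add: F_def)
    qed simp
    also have "\<dots> = (psi_exp v * v ^ 0) *\<^sub>R exp (- (s * of_real v))"
      by (simp add: psi_exp_def psi_def scaleR_sum_left)
    finally show ?thesis ..
  qed
  have intF: "integrable lborel (F n)" for n
    unfolding F_def[abs_def] by (intro integrable_scaleR_right exp_tail_integral(1) s0)
  have F_int: "integral\<^sup>L lborel (F n) = of_real (mangoldt n) * negpow n s / s" for n
  proof -
    have "integral\<^sup>L lborel (F n) =
        mangoldt n *\<^sub>R (CLINT v|lborel. indicator {ln (real n)..} v *\<^sub>R exp (- (s * of_real v)))"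
      unfolding F_def by (rule integral_scaleR_right)
    thus ?thesis unfolding exp_tail_integral(2)[OF s0]
      by (simp add: negpow_def scaleR_conv_of_real del: of_real_mangoldt)
  qed
  have F_norm: "(LINT v|lborel. norm (F n v)) = mangoldt n * real n powr (- Re s) / Re s" for n
  proof (cases "n = 0")
    case False
    have "(LINT v|lborel. norm (F n v)) =
        (LINT v|lborel. mangoldt n * (indicator {ln (real n)..} v * exp (- (Re s * v))))"
      by (intro Bochner_Integration.integral_cong) (auto simp: F_def norm_exp_eq_Re mangoldt_nonneg)
    also have "\<dots> = mangoldt n * (exp (- (Re s * ln (real n))) / Re s)"
      by (simp add: exp_tail_integral(4)[OF s0])
    finally show ?thesis using False by (simp add: powr_def)
  qed (simp add: F_def)
  have "laplace psi_exp 0 s = (CLINT v|lborel. (\<Sum>n. F n v))"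
    unfolding laplace_def pointwise ..
  also have "\<dots> = (\<Sum>n. integral\<^sup>L lborel (F n))"
  proof (rule integral_suminf)
    show "AE v in lborel. summable (\<lambda>n. norm (F n v))"
    proof (intro AE_I2)
      fix v :: real
      show "summable (\<lambda>n. norm (F n v))"
        by (rule summable_finite[of "{..nat \<lfloor>exp v\<rfloor>}"]) (auto simp: Fz)
    qed
    have "summable (\<lambda>n. \<bar>mangoldt n\<bar> * real n powr (- Re s) / Re s)"
      by (intro summable_divide mangoldt.c_summable s)
    thus "summable (\<lambda>n. LINT v|lborel. norm (F n v))"
      unfolding F_norm by (simp add: mangoldt_nonneg)
  qed (rule intF)
  also have "\<dots> = dseries mangoldt s / s"
    unfolding F_int dseries_def
    by (rule suminf_divide) (rule sums_summable[OF mangoldt.dseries_sums[OF s]])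
  finally show ?thesis .
qed

lemma laplace_pos_exp:
  assumes s: "Re s > 1"
  shows "laplace pos_exp 0 s = 1 / (s - 1)"
proof -
  have "laplace pos_exp 0 s = (CLINT v|lborel. indicator {0..} v *\<^sub>R exp (- ((s - 1) * of_real v)))"
    unfolding laplace_def
  proof (rule Bochner_Integration.integral_cong)
    fix v :: real
    show "(pos_exp v * v ^ 0) *\<^sub>R exp (- (s * of_real v)) = indicator {0..} v *\<^sub>R exp (- ((s - 1) * of_real v))"
      by (simp add: pos_exp_def indicator_def scaleR_conv_of_real algebra_simps exp_diff exp_minus
            field_simps flip: exp_of_real)
  qed simp
  also have "\<dots> = exp (- ((s - 1) * of_real 0)) / (s - 1)"
    by (rule exp_tail_integral(2)) (use s in simp)
  finally show ?thesis by simp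
qed

lemma laplace_diff:
  assumes s: "Re s > 1"
  shows "laplace (\<lambda>v. psi_exp v - pos_exp v) k s = laplace psi_exp k s - laplace pos_exp k s"
  unfolding laplace_def
  by (subst Bochner_Integration.integral_diff[symmetric])
     (auto intro!: kernel_psi.integrable_complex kernel_pos.integrable_complex s simp: algebra_simps)

lemma laplace_deriv_Qfun:
  assumes s: "Re s > 1"
  shows "norm (laplace (\<lambda>v. psi_exp v - pos_exp v) k s) = norm ((deriv ^^ k) Qfun s)"
proof -
  have "(deriv ^^ k) Qfun s = (- 1) ^ k * laplace (\<lambda>v. psi_exp v - pos_exp v) k s"
    by (rule kernel_diff.laplace_higher_deriv[OF _ s])
       (simp add: laplace_diff laplace_psi_exp laplace_pos_exp Qfun_eq)
  thus ?thesis by (simp add: norm_mult norm_power)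
qed

text \<open>Damping moves the Fourier transform to the line \<open>Re s = r\<close>; the sign of
  \<open>t\<close> changes because characteristic functions use \<open>iexp (t * v)\<close>.\<close>

lemma (in laplace_kernel) ftrans_eq_laplace:
  "ftrans (\<lambda>v. e v * v ^ k * exp (- (r * v))) t = laplace e k (Complex r (- t))"
  unfolding ftrans_def laplace_def
proof (rule Bochner_Integration.integral_cong)
  fix v :: real
  have "complex_of_real (exp (- (r * v))) * iexp (t * v) = exp (- (Complex r (- t) * of_real v))"
    by (simp add: Complex_eq algebra_simps flip: exp_of_real exp_add)
  thus "(e v * v ^ k * exp (- (r * v))) *\<^sub>R iexp (t * v) =
      (e v * v ^ k) *\<^sub>R exp (- (Complex r (- t) * of_real v))"
    by (simp add: scaleR_conv_of_real mult.assoc)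
qed simp

text \<open>What \<open>density_inversion\<close> asks of a density; the lower bound on
  \<open>{1..2}\<close> is the witness for positive mass.\<close>

lemma (in laplace_kernel) density_facts:
  assumes nonneg: "\<And>v. e v \<ge> 0" and c: "c > 0" "\<And>v. 1 \<le> v \<Longrightarrow> v \<le> 2 \<Longrightarrow> e v \<ge> c" and r: "r > 1"
  shows "integrable lborel (\<lambda>v. e v * v ^ k * exp (- (r * v)))"
    and "0 \<le> e v * v ^ k * exp (- (r * v))"
    and "0 < (LINT v|lborel. e v * v ^ k * exp (- (r * v)))"
proof -
  show int: "integrable lborel (\<lambda>v. e v * v ^ k * exp (- (r * v)))"
    using integrable_real[OF r, of k] nonneg by simp
  show pos: "0 \<le> e v * v ^ k * exp (- (r * v))" for v
    using nonneg[of v] e_neg[of v] by (cases "v < 0") auto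
  have "0 < c * exp (- (2 * r))" using c by simp
  also have "\<dots> = (LINT v|lborel. c * exp (- (2 * r)) * indicator {1..2::real} v)" by simp
  also have "\<dots> \<le> (LINT v|lborel. e v * v ^ k * exp (- (r * v)))"
  proof (rule integral_mono)
    show "integrable lborel (\<lambda>v::real. c * exp (- (2 * r)) * indicator {1..2} v)"
      by (intro integrable_mult_right) simp
    fix v :: real
    show "c * exp (- (2 * r)) * indicator {1..2} v \<le> e v * v ^ k * exp (- (r * v))"
    proof (cases "v \<in> {1..2}")
      case True
      have "c * 1 * exp (- (2 * r)) \<le> e v * v ^ k * exp (- (r * v))"
        using True c nonneg[of v] r by (intro mult_mono) auto
      thus ?thesis using True by simp
    qed (use pos in simp)
  qed (use int in simp_all)
  finally show "0 < (LINT v|lborel. e v * v ^ k * exp (- (r * v)))" .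
qed

text \<open>The point is that \<open>C\<close> depends neither on the interval nor on
  \<open>r\<close>: the transforms of the two densities differ, up to sign, by a derivative of
  \<open>Qfun\<close>, which is bounded uniformly up to \<open>Re s = 1\<close>.\<close>

lemma smoothed_bound:
  "\<exists>C\<ge>0. \<forall>r a b. 1 < r \<longrightarrow> r \<le> 2 \<longrightarrow> a \<le> b \<longrightarrow> b \<le> a + 1 \<longrightarrow>
     \<bar>LBINT v:{a<..b}. (psi_exp v - pos_exp v) * v ^ k * exp (- (r * v))\<bar> \<le> C"
proof -
  obtain C where C: "C > 0"
    "\<And>s. 1 < Re s \<Longrightarrow> Re s \<le> 2 \<Longrightarrow> norm ((deriv ^^ k) Qfun s) \<le> C * (1 + \<bar>Im s\<bar>) powr (- 1 / 2)"
    using Qfun_deriv_bound[of k] by blast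
  define I where "I = (LBINT t. (1 + \<bar>t\<bar>) powr (- 3 / 2) :: real)"
  have "\<bar>LBINT v:{a<..b}. (psi_exp v - pos_exp v) * v ^ k * exp (- (r * v))\<bar> \<le> C * I"
    if r: "1 < r" "r \<le> 2" and ab: "a \<le> b" "b \<le> a + 1" for r a b
  proof -
    let ?f = "\<lambda>v. psi_exp v * v ^ k * exp (- (r * v))" and ?g = "\<lambda>v. pos_exp v * v ^ k * exp (- (r * v))"
    have psi2: "psi_exp v \<ge> ln 2" if "1 \<le> v" for v
    proof -
      have "(2::real) \<le> exp 1" using exp_ge_add_one_self[of 1] by simp
      also have "\<dots> \<le> exp v" using that by simp
      finally have "psi 2 \<le> psi (exp v)" by (rule psi_mono)
      moreover have "(mangoldt 2 :: real) \<le> psi 2"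
        unfolding psi_def by (rule member_le_sum) (auto simp: mangoldt_nonneg)
      ultimately show ?thesis using that by (simp add: psi_exp_def)
    qed
    have psi0: "psi_exp v \<ge> 0" for v by (simp add: psi_exp_def psi_nonneg)
    have f: "integrable lborel ?f" "0 \<le> ?f v" "0 < integral\<^sup>L lborel ?f" for v
      by (rule kernel_psi.density_facts[where c = "ln 2"]; use psi2 psi0 r in simp)+
    have pos0: "pos_exp v \<ge> 0" and pos1: "1 \<le> v \<Longrightarrow> pos_exp v \<ge> 1" for v
      by (simp_all add: pos_exp_def)
    have g: "integrable lborel ?g" "0 \<le> ?g v" "0 < integral\<^sup>L lborel ?g" for v
      by (rule kernel_pos.density_facts[where c = 1]; use pos0 pos1 r in simp)+
    have "norm (ftrans ?f t - ftrans ?g t) \<le> C * (1 + \<bar>t\<bar>) powr (- 1 / 2)" for t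
    proof -
      have s: "Re (Complex r (- t)) > 1" using r by simp
      have "ftrans ?f t - ftrans ?g t = laplace (\<lambda>v. psi_exp v - pos_exp v) k (Complex r (- t))"
        unfolding laplace_diff[OF s] kernel_psi.ftrans_eq_laplace kernel_pos.ftrans_eq_laplace ..
      hence "norm (ftrans ?f t - ftrans ?g t) = norm ((deriv ^^ k) Qfun (Complex r (- t)))"
        using laplace_deriv_Qfun[OF s] by simp
      thus ?thesis using C(2)[of "Complex r (- t)"] r by simp
    qed
    hence "\<bar>LBINT v:{a<..b}. ?f v - ?g v\<bar> \<le> C * I"
      unfolding I_def using f g ab C(1) by (intro density_difference_bound) auto
    thus ?thesis by (simp add: algebra_simps)
  qed
  moreover have "C * I \<ge> 0" unfolding I_def using C(1) by (intro mult_nonneg_nonneg integral_nonneg_AE) auto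
  ultimately show ?thesis by (intro exI[of _ "C * I"]) auto
qed

text \<open>Since \<open>psi\<close> is monotone, a relative deviation \<open>\<eta>\<close> from \<open>exp a\<close> at \<open>a\<close> persists
  on an interval of length \<open>\<eta> / 4\<close> next to \<open>a\<close>, which the smoothed bound limits.\<close>

lemma deviation_bound:
  "\<exists>C. \<forall>a \<eta>. 1 \<le> a \<longrightarrow> 0 < \<eta> \<longrightarrow> \<eta> \<le> 1 \<longrightarrow> \<eta> * exp a \<le> \<bar>psi (exp a) - exp a\<bar> \<longrightarrow> \<eta>\<^sup>2 * a ^ k \<le> C"
proof -
  obtain C where C: "C \<ge> 0" "\<And>r a b. 1 < r \<Longrightarrow> r \<le> 2 \<Longrightarrow> a \<le> b \<Longrightarrow> b \<le> a + 1 \<Longrightarrow>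
     \<bar>LBINT v:{a<..b}. (psi_exp v - pos_exp v) * v ^ k * exp (- (r * v))\<bar> \<le> C"
    using smoothed_bound[of k] by blast
  have "\<eta>\<^sup>2 * a ^ k \<le> 8 * exp 1 * 2 ^ k * C"
    if a: "1 \<le> a" and \<eta>: "0 < \<eta>" "\<eta> \<le> 1" and dev: "\<eta> * exp a \<le> \<bar>psi (exp a) - exp a\<bar>" for a \<eta>
  proof -
    \<comment> \<open>So close to 1 that the leftover damping \<open>exp (- ((r - 1) * v))\<close>
      is at least \<open>exp (- 1)\<close> for all \<open>v \<le> a + 1\<close>.\<close>
    define r where "r = 1 + 1 / (a + 1)"
    have r: "1 < r" "r \<le> 2" using a by (auto simp: r_def field_simps)
    \<comment> \<open>For \<open>\<eta> \<le> 1\<close> this gives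
      \<open>(1 + \<eta>) * (1 - h) \<ge> 1 + \<eta> / 2\<close> and
      \<open>(1 - \<eta>) * (1 + 2 * h) \<le> 1 - \<eta> / 2\<close>: half of the deviation
      survives, to the right of \<open>a\<close> for an excess and to the left for a
      deficit.\<close>
    define h where "h = \<eta> / 4"
    have h: "0 < h" "h \<le> 1 / 4" using \<eta> by (auto simp: h_def)
    let ?w = "\<lambda>v. (psi_exp v - pos_exp v) * v ^ k * exp (- (r * v))"
    define c where "c = (\<eta> / 2) * (a / 2) ^ k * exp (- 1)"
    have c0: "c \<ge> 0" unfolding c_def using \<eta> a by simp
    have w_int: "set_integrable lborel {x<..y} ?w" for x y
    proof -
      have "integrable lborel ?w"
        by (rule Bochner_Integration.integrable_bound[OF kernel_diff.integrable_real[OF r(1), of k]])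
           (auto simp: abs_mult intro!: AE_I2)
      thus ?thesis unfolding set_integrable_def by (intro integrable_mult_indicator) auto
    qed
    have weight: "c \<le> z * v ^ k * exp (- ((r - 1) * v))"
      if "a / 2 \<le> v" "v \<le> a + 1" "\<eta> / 2 \<le> z" for v z
    proof -
      have "(r - 1) * v \<le> 1" using that a by (simp add: r_def field_simps)
      hence e: "exp (- 1 :: real) \<le> exp (- ((r - 1) * v))" by simp
      have "(a / 2) ^ k \<le> v ^ k" using that a by (intro power_mono) auto
      thus ?thesis unfolding c_def using e that \<eta> a by (intro mult_mono) auto
    qed
    have w_eq: "?w v = (psi (exp v) * exp (- v) - 1) * v ^ k * exp (- ((r - 1) * v))" if "v \<ge> 0" for v
      using that by (simp add: psi_exp_def pos_exp_def algebra_simps flip: exp_add)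
    have const_int: "set_integrable lborel {x<..y} (\<lambda>_. c)" "(LBINT v:{x<..y}. c) = c * (y - x)"
      if "x \<le> y" for x y :: real
      using that by (auto simp: set_integrable_def set_lebesgue_integral_def)
    have "c * h \<le> C"
    proof (cases "psi (exp a) \<ge> exp a")
      case True
      hence dev: "(1 + \<eta>) * exp a \<le> psi (exp a)" using dev by (simp add: algebra_simps)
      have "c * h = (LBINT v:{a<..a+h}. c)" using h by (simp add: const_int)
      also have "\<dots> \<le> (LBINT v:{a<..a+h}. ?w v)"
      proof (rule set_integral_mono)
        fix v assume v: "v \<in> {a<..a+h}"
        have "(1 + \<eta>) * (1 - h) \<le> (1 + \<eta>) * exp (a - v)"
        proof (rule mult_left_mono)
          have "1 + (a - v) \<le> exp (a - v)" by (rule exp_ge_add_one_self)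
          moreover have "v \<le> a + h" using v by simp
          ultimately show "1 - h \<le> exp (a - v)" by linarith
        qed (use \<eta> in auto)
        also have "\<dots> = (1 + \<eta>) * exp a * exp (- v)" by (simp add: exp_diff exp_minus divide_inverse)
        also have "\<dots> \<le> psi (exp v) * exp (- v)"
          using dev psi_mono[of "exp a" "exp v"] v by (intro mult_right_mono) auto
        finally have "(1 + \<eta>) * (1 - h) \<le> psi (exp v) * exp (- v)" .
        moreover have "\<eta> / 2 + 1 \<le> (1 + \<eta>) * (1 - h)"
        proof -
          have "\<eta> * \<eta> \<le> \<eta> * 1" using \<eta> by (intro mult_left_mono) auto
          thus ?thesis by (simp add: h_def field_simps)
        qed
        ultimately have "\<eta> / 2 \<le> psi (exp v) * exp (- v) - 1" by linarith
        thus "c \<le> ?w v" using v a h by (subst w_eq) (auto intro!: weight)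
      qed (use w_int const_int h in auto)
      also have "\<dots> \<le> \<bar>LBINT v:{a<..a+h}. ?w v\<bar>" by simp
      also have "\<dots> \<le> C" using r h by (intro C(2)) auto
      finally show ?thesis .
    next
      case False
      hence dev: "psi (exp a) \<le> (1 - \<eta>) * exp a" using dev by (simp add: algebra_simps)
      have "(LBINT v:{a-h<..a}. ?w v) \<le> (LBINT v:{a-h<..a}. - c)"
      proof (rule set_integral_mono)
        fix v assume v: "v \<in> {a-h<..a}"
        have "psi (exp v) * exp (- v) \<le> (1 - \<eta>) * exp a * exp (- v)"
          using dev psi_mono[of "exp v" "exp a"] v by (intro mult_right_mono) auto
        also have "\<dots> = (1 - \<eta>) * exp (a - v)" by (simp add: exp_diff exp_minus divide_inverse)
        also have "\<dots> \<le> (1 - \<eta>) * (1 + 2 * h)"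
        proof (rule mult_left_mono)
          have "exp (a - v) \<le> exp h" using v by simp
          also have "\<dots> \<le> 1 + h + h\<^sup>2" using h by (intro exp_bound) auto
          also have "h\<^sup>2 \<le> h * 1" unfolding power2_eq_square using h by (intro mult_left_mono) auto
          finally show "exp (a - v) \<le> 1 + 2 * h" by simp
        qed (use \<eta> in auto)
        also have "\<dots> \<le> 1 - \<eta> / 2" using \<eta> by (simp add: h_def algebra_simps)
        finally have "\<eta> / 2 \<le> - (psi (exp v) * exp (- v) - 1)" by simp
        hence "c \<le> - (psi (exp v) * exp (- v) - 1) * v ^ k * exp (- ((r - 1) * v))"
          using v a h by (intro weight) auto
        hence "(psi (exp v) * exp (- v) - 1) * v ^ k * exp (- ((r - 1) * v)) \<le> - c"
          unfolding mult_minus_left by linarith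
        moreover have "v \<ge> 0" using v a h by auto
        ultimately show "?w v \<le> - c" by (simp only: w_eq)
      next
        show "set_integrable lborel {a-h<..a} (\<lambda>_. - c)"
          using h by (auto simp: set_integrable_def)
      qed (use w_int in auto)
      also have "\<dots> = - (c * h)" using h by (simp add: set_lebesgue_integral_def)
      finally have "c * h \<le> \<bar>LBINT v:{a-h<..a}. ?w v\<bar>" by linarith
      also have "\<dots> \<le> C" using r h by (intro C(2)) auto
      finally show ?thesis .
    qed
    moreover have "\<eta>\<^sup>2 * a ^ k = 8 * exp 1 * 2 ^ k * (c * h)"
      by (simp add: c_def h_def power_divide power2_eq_square exp_minus field_simps)
    ultimately show ?thesis by simp
  qed
  thus ?thesis by blast
qed

text \<open>With weight \<open>2 * Suc N\<close> a deviation \<open>\<eta> = K / a ^ Suc N\<close>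
  with \<open>K ^ 2 > C\<close> contradicts \<open>deviation_bound\<close>. Aiming at
  \<open>Suc N\<close> instead of \<open>N\<close> lets this \<open>\<eta>\<close> fall below 1
  eventually, even for \<open>N = 0\<close>.\<close>

theorem psi_asymp: "(\<lambda>x. psi x - x) \<in> O(\<lambda>x. x / ln x ^ N)"
proof -
  obtain C where C: "\<And>a \<eta>. 1 \<le> a \<Longrightarrow> 0 < \<eta> \<Longrightarrow> \<eta> \<le> 1 \<Longrightarrow> \<eta> * exp a \<le> \<bar>psi (exp a) - exp a\<bar> \<Longrightarrow>
      \<eta>\<^sup>2 * a ^ (2 * Suc N) \<le> C"
    using deviation_bound[of "2 * Suc N"] by blast
  define K where "K = \<bar>C\<bar> + 1"
  have K: "K \<ge> 1" "K\<^sup>2 > C"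
  proof -
    show "K \<ge> 1" by (simp add: K_def)
    hence "K * 1 \<le> K * K" by (intro mult_left_mono) auto
    moreover have "C < K" by (simp add: K_def)
    ultimately show "K\<^sup>2 > C" by (simp add: power2_eq_square)
  qed
  have lim: "filterlim (\<lambda>x::real. ln x ^ Suc N) at_top at_top"
    by (intro filterlim_pow_at_top ln_at_top) auto
  show ?thesis
  proof (rule bigoI[where c = K])
    show "\<forall>\<^sub>F x in at_top. norm (psi x - x) \<le> K * norm (x / ln x ^ N)"
      using eventually_ge_at_top[of "exp 1"] filterlim_at_top[THEN iffD1, OF lim, rule_format, of K]
    proof eventually_elim
      case (elim x)
      define a where "a = ln x"
      have x: "x > 0" using elim(1) exp_gt_zero[of 1] by linarith
      hence xa: "x = exp a" by (simp add: a_def)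
      have a: "a \<ge> 1" using elim(1) unfolding xa by simp
      have aN: "a ^ Suc N > 0" using a by simp
      define \<eta> where "\<eta> = K / a ^ Suc N"
      have \<eta>: "0 < \<eta>" "\<eta> \<le> 1" using elim(2) K aN by (auto simp: \<eta>_def a_def)
      have "\<eta>\<^sup>2 * a ^ (2 * Suc N) = K\<^sup>2"
        unfolding \<eta>_def power_even_eq power_divide using a by (simp del: power_Suc)
      hence "\<not> \<eta> * exp a \<le> \<bar>psi (exp a) - exp a\<bar>" using C[OF a \<eta>] K by linarith
      hence "\<bar>psi x - x\<bar> \<le> \<eta> * x" by (simp add: xa)
      also have "\<dots> \<le> K / a ^ N * x"
        using a K x unfolding \<eta>_def by (intro mult_right_mono divide_left_mono power_increasing) auto
      finally show ?case using x a by (simp add: a_def abs_mult power_abs mult_ac)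
    qed
  qed
qed

section \<open>From prime powers to primes\<close>

definition theta :: "real \<Rightarrow> real" where
  "theta x = (\<Sum>p | prime p \<and> real p \<le> x. ln (real p))"

lemma finite_primes_le: "finite {p::nat. prime p \<and> real p \<le> x}"
  by (rule finite_subset[of _ "{..nat \<lfloor>x\<rfloor>}"]) (auto simp: le_nat_iff le_floor_iff intro: order_trans)

text \<open>A proper prime power \<open>p ^ k \<le> x\<close> has \<open>p \<le> sqrt x\<close> and
  \<open>k \<le> ln x / ln 2\<close>, so these numbers lie in the image of a box, and each
  contributes at most \<open>ln x\<close>.\<close>

lemma psi_theta_diff:
  assumes "x \<ge> 2"
  shows "\<bar>psi x - theta x\<bar> \<le> (sqrt x + 1) * (ln x / ln 2 + 1) * ln x"
proof -
  define S where "S = {n. n \<le> nat \<lfloor>x\<rfloor> \<and> primepow n \<and> \<not> prime n}"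
  define A B where "A = nat \<lfloor>sqrt x\<rfloor>" and "B = nat \<lfloor>ln x / ln 2\<rfloor>"
  have fin: "finite S" unfolding S_def by (rule finite_subset[of _ "{..nat \<lfloor>x\<rfloor>}"]) auto
  have le_x: "n \<le> nat \<lfloor>x\<rfloor> \<longleftrightarrow> real n \<le> x" for n using assms by (simp add: le_nat_iff le_floor_iff)
  have "psi x = (\<Sum>n\<in>{n. n \<le> nat \<lfloor>x\<rfloor> \<and> primepow n}. mangoldt n)"
    unfolding psi_def by (intro sum.mono_neutral_right) (auto simp: mangoldt_def)
  also have "{n. n \<le> nat \<lfloor>x\<rfloor> \<and> primepow n} = {p. prime p \<and> real p \<le> x} \<union> S"
    by (auto simp: S_def le_x)
  also have "(\<Sum>n\<in>\<dots>. mangoldt n) = (\<Sum>p | prime p \<and> real p \<le> x. mangoldt p) + (\<Sum>n\<in>S. mangoldt n)"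
    using fin finite_primes_le by (intro sum.union_disjoint) (auto simp: S_def)
  also have "(\<Sum>p | prime p \<and> real p \<le> x. mangoldt p) = theta x"
    unfolding theta_def by (intro sum.cong) auto
  finally have eq: "psi x - theta x = (\<Sum>n\<in>S. mangoldt n)" by simp
  have sum_le: "(\<Sum>n\<in>S. mangoldt n :: real) \<le> of_nat (card S) * ln x"
  proof (rule sum_bounded_above)
    fix n assume "n \<in> S"
    hence n: "n > 0" "real n \<le> x" by (auto simp: S_def le_x intro!: Nat.gr0I)
    have "(mangoldt n :: real) \<le> ln n" using n by (intro mangoldt_le_ln)
    also have "\<dots> \<le> ln x" using n by simp
    finally show "(mangoldt n :: real) \<le> ln x" .
  qed
  have "S \<subseteq> (\<lambda>(p, k). p ^ k) ` ({..A} \<times> {..B})"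
  proof
    fix n assume n: "n \<in> S"
    hence "primepow n" by (simp add: S_def)
    then obtain p k where pk: "prime p" "k > 0" "n = p ^ k" by (auto simp: primepow_def)
    have nx: "real n \<le> x" using n by (simp add: S_def le_x)
    have "k \<noteq> 1" using n pk by (auto simp: S_def)
    hence k2: "k \<ge> 2" using pk by simp
    have p2: "p \<ge> 2" using pk prime_ge_2_nat by blast
    have "p ^ 2 \<le> p ^ k" using k2 p2 by (intro power_increasing) auto
    hence "real (p ^ 2) \<le> x" using nx pk(3) of_nat_le_iff order_trans by metis
    hence "real p \<le> sqrt x" by (intro real_le_rsqrt) simp
    hence "p \<le> A" unfolding A_def by (rule le_nat_floor)
    have "2 ^ k \<le> p ^ k" using p2 by (intro power_mono) auto
    hence "real (2 ^ k) \<le> x" using nx pk(3) of_nat_le_iff order_trans by metis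
    hence "ln (2 ^ k) \<le> ln x" using assms by (subst ln_le_cancel_iff) auto
    hence "real k \<le> ln x / ln 2" by (simp add: ln_realpow pos_le_divide_eq)
    hence "k \<le> B" unfolding B_def by (rule le_nat_floor)
    with \<open>p \<le> A\<close> show "n \<in> (\<lambda>(p, k). p ^ k) ` ({..A} \<times> {..B})" using pk(3) by auto
  qed
  hence "card S \<le> card ((\<lambda>(p, k). p ^ k) ` ({..A} \<times> {..B}))" by (intro card_mono) auto
  also have "\<dots> \<le> card ({..A} \<times> {..B})" by (intro card_image_le) auto
  also have "\<dots> = (A + 1) * (B + 1)" by (simp add: card_cartesian_product)
  finally have "card S \<le> (A + 1) * (B + 1)" .
  hence "real (card S) \<le> real ((A + 1) * (B + 1))" by (simp only: of_nat_le_iff)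
  also have "\<dots> = (real A + 1) * (real B + 1)" by (simp add: algebra_simps)
  also have "\<dots> \<le> (sqrt x + 1) * (ln x / ln 2 + 1)"
    using assms by (intro mult_mono add_right_mono) (auto simp: A_def B_def of_nat_floor)
  finally have "real (card S) \<le> (sqrt x + 1) * (ln x / ln 2 + 1)" .
  hence "real (card S) * ln x \<le> (sqrt x + 1) * (ln x / ln 2 + 1) * ln x"
    using assms by (intro mult_right_mono) auto
  with sum_le have "psi x - theta x \<le> (sqrt x + 1) * (ln x / ln 2 + 1) * ln x"
    unfolding eq by linarith
  moreover have "psi x - theta x \<ge> 0" unfolding eq by (intro sum_nonneg mangoldt_nonneg)
  ultimately show ?thesis by simp
qed

lemma theta_asymp: "(\<lambda>x. theta x - x) \<in> O(\<lambda>x. x / ln x ^ N)"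
proof -
  have "(\<lambda>x. psi x - theta x) \<in> O(\<lambda>x. (sqrt x + 1) * (ln x / ln 2 + 1) * ln x)"
    by (rule bigoI[where c = 1])
       (use eventually_ge_at_top[of 2] in \<open>eventually_elim, use psi_theta_diff in \<open>fastforce simp: abs_mult\<close>\<close>)
  also have "(\<lambda>x::real. (sqrt x + 1) * (ln x / ln 2 + 1) * ln x) \<in> O(\<lambda>x. x / ln x ^ N)"
    by real_asymp
  finally have "(\<lambda>x. psi x - theta x) \<in> O(\<lambda>x. x / ln x ^ N)" .
  from sum_in_bigo(2)[OF psi_asymp[of N] this] show ?thesis by simp
qed

section \<open>The logarithmic integral\<close>

text \<open>A family in \<open>M\<close> because integration by parts leads from \<open>M\<close> to
  \<open>M + 1\<close>; \<open>Li 1\<close> is the logarithmic integral started at 2.\<close>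

definition Li :: "nat \<Rightarrow> real \<Rightarrow> real" where
  "Li M x = integral {2..x} (\<lambda>t. 1 / ln t ^ M)"

lemma inv_ln_continuous: "a > 1 \<Longrightarrow> continuous_on {a..b} (\<lambda>t::real. 1 / ln t ^ M)"
  by (intro continuous_intros) auto

lemma inv_ln_integrable: "a > 1 \<Longrightarrow> (\<lambda>t::real. 1 / ln t ^ M) integrable_on {a..b}"
  by (intro integrable_continuous_interval inv_ln_continuous)

lemma x_over_ln_deriv:
  assumes "t > 1"
  shows "((\<lambda>t. t / ln t ^ M) has_real_derivative 1 / ln t ^ M - real M / ln t ^ Suc M) (at t within A)"
proof -
  have L: "ln t > 0" using assms by simp
  have "((\<lambda>t. t * (1 / ln t) ^ M) has_real_derivative
      1 * (1 / ln t) ^ M + (real M * (1 / ln t) ^ (M - 1) * (- 1 / t / (ln t)\<^sup>2)) * t) (at t within A)"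
    using assms L by (auto intro!: derivative_eq_intros simp: power2_eq_square)
  moreover have "1 * (1 / ln t) ^ M + (real M * (1 / ln t) ^ (M - 1) * (- 1 / t / (ln t)\<^sup>2)) * t =
      1 / ln t ^ M - real M / ln t ^ Suc M"
    using L assms by (cases M) (simp_all add: power_divide power2_eq_square field_simps)
  ultimately show ?thesis by (simp add: power_divide)
qed

lemma x_over_ln_integral:
  assumes "1 < a" "a \<le> b"
  shows "((\<lambda>t. 1 / ln t ^ M - real M * (1 / ln t ^ Suc M)) has_integral (b / ln b ^ M - a / ln a ^ M)) {a..b}"
proof (rule fundamental_theorem_of_calculus[OF assms(2)])
  fix t assume "t \<in> {a..b}"
  hence "t > 1" using assms by simp
  from x_over_ln_deriv[OF this, of M "{a..b}"]
  show "((\<lambda>t. t / ln t ^ M) has_vector_derivative 1 / ln t ^ M - real M * (1 / ln t ^ Suc M)) (at t within {a..b})"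
    by (simp add: has_real_derivative_iff_has_vector_derivative)
qed

lemma Li_rec:
  assumes "x \<ge> 2"
  shows "Li M x = x / ln x ^ M - 2 / ln 2 ^ M + real M * Li (Suc M) x"
proof -
  have "integral {2..x} (\<lambda>t. 1 / ln t ^ M - real M * (1 / ln t ^ Suc M)) = x / ln x ^ M - 2 / ln 2 ^ M"
    using assms by (intro integral_unique x_over_ln_integral) auto
  moreover have "integral {2..x} (\<lambda>t. 1 / ln t ^ M - real M * (1 / ln t ^ Suc M)) = Li M x - real M * Li (Suc M) x"
  proof -
    have "integral {2..x} (\<lambda>t. 1 / ln t ^ M - real M * (1 / ln t ^ Suc M)) =
        integral {2..x} (\<lambda>t. 1 / ln t ^ M) - integral {2..x} (\<lambda>t. real M * (1 / ln t ^ Suc M))"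
      by (intro Henstock_Kurzweil_Integration.integral_diff integrable_on_mult_right inv_ln_integrable) simp_all
    also have "integral {2..x} (\<lambda>t. real M * (1 / ln t ^ Suc M)) = real M * integral {2..x} (\<lambda>t. 1 / ln t ^ Suc M)"
      by (rule Henstock_Kurzweil_Integration.integral_mult_right)
    finally show ?thesis unfolding Li_def .
  qed
  ultimately show ?thesis by simp
qed

lemma const_bigo: "(\<lambda>_. c) \<in> O(\<lambda>x::real. x / ln x ^ M)"
proof -
  have "(\<lambda>_::real. 1 :: real) \<in> O(\<lambda>x. x / ln x ^ M)" by real_asymp
  from landau_o.big.cmult_in_iff[of c] this show ?thesis
    by (cases "c = 0") (auto intro: landau_o.big_trans[of "\<lambda>_. c" _ "\<lambda>_. 1"])
qed

lemma Li_bigo: "Li M \<in> O(\<lambda>x. x / ln x ^ M)"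
proof -
  \<comment> \<open>From here on \<open>ln t \<ge> 2 * M\<close>, so the integrand is at most twice
    the derivative of \<open>t / ln t ^ M\<close>. The summand 1 secures \<open>a \<ge> 2\<close>
    also for \<open>M = 0\<close>.\<close>
  define a where "a = exp (2 * real M + 1)"
  have "exp (1::real) \<ge> 2" using exp_ge_add_one_self[of 1] by simp
  moreover have "a \<ge> exp 1" by (simp add: a_def)
  ultimately have a: "a \<ge> 2" by linarith
  have "(\<lambda>x. integral {a..x} (\<lambda>t. 1 / ln t ^ M)) \<in> O(\<lambda>x. x / ln x ^ M)"
  proof (rule bigoI[where c = 2])
    show "\<forall>\<^sub>F x in at_top. norm (integral {a..x} (\<lambda>t. 1 / ln t ^ M)) \<le> 2 * norm (x / ln x ^ M)"
      using eventually_ge_at_top[of a]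
    proof eventually_elim
      case (elim x)
      have H: "((\<lambda>t. 2 * (1 / ln t ^ M - real M * (1 / ln t ^ Suc M))) has_integral
          2 * (x / ln x ^ M - a / ln a ^ M)) {a..x}"
        using a elim by (intro has_integral_mult_right x_over_ln_integral) auto
      have "integral {a..x} (\<lambda>t. 1 / ln t ^ M) \<le>
          integral {a..x} (\<lambda>t. 2 * (1 / ln t ^ M - real M * (1 / ln t ^ Suc M)))"
      proof (rule integral_le)
        fix t assume t: "t \<in> {a..x}"
        hence "ln t \<ge> ln a" using a by simp
        hence L: "ln t \<ge> 2 * real M" "ln t > 0" by (simp_all add: a_def)
        hence "2 * real M / ln t \<le> 1" by simp
        hence "(2 * real M / ln t) * (1 / ln t ^ M) \<le> 1 * (1 / ln t ^ M)"
          using L by (intro mult_right_mono) auto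
        thus "1 / ln t ^ M \<le> 2 * (1 / ln t ^ M - real M * (1 / ln t ^ Suc M))"
          by (simp add: algebra_simps)
      next
        show "(\<lambda>t. 2 * (1 / ln t ^ M - real M * (1 / ln t ^ Suc M))) integrable_on {a..x}"
          using H by (rule has_integral_integrable)
      qed (use a in \<open>auto intro!: inv_ln_integrable\<close>)
      also have "\<dots> = 2 * (x / ln x ^ M - a / ln a ^ M)"
        using H by (rule integral_unique)
      also have "\<dots> \<le> 2 * (x / ln x ^ M)" using a by simp
      finally have "integral {a..x} (\<lambda>t. 1 / ln t ^ M) \<le> 2 * (x / ln x ^ M)" .
      moreover have "integral {a..x} (\<lambda>t. 1 / ln t ^ M) \<ge> 0"
        using a by (intro integral_nonneg inv_ln_integrable) auto
      moreover have "norm (x / ln x ^ M) = x / ln x ^ M" using a elim by simp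
      ultimately show ?case by (simp only: real_norm_def abs_of_nonneg)
    qed
  qed
  hence "(\<lambda>x. integral {2..a} (\<lambda>t. 1 / ln t ^ M) + integral {a..x} (\<lambda>t. 1 / ln t ^ M)) \<in> O(\<lambda>x. x / ln x ^ M)"
    by (intro sum_in_bigo const_bigo)
  also have "?this \<longleftrightarrow> Li M \<in> O(\<lambda>x. x / ln x ^ M)"
  proof (rule landau_o.big.in_cong)
    show "\<forall>\<^sub>F x in at_top. integral {2..a} (\<lambda>t. 1 / ln t ^ M) + integral {a..x} (\<lambda>t. 1 / ln t ^ M) = Li M x"
      using eventually_ge_at_top[of a]
      by eventually_elim (use a in \<open>simp add: Li_def inv_ln_integrable Henstock_Kurzweil_Integration.integral_combine\<close>)
  qed
  finally show ?thesis .
qed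

lemma Li_expansion:
  "(\<lambda>x. Li 1 x - (\<Sum>k=1..M. fact (k - 1) * (x / ln x ^ k))) \<in> O(\<lambda>x. x / ln x ^ Suc M)"
proof -
  have "\<exists>c. \<forall>x\<ge>2. Li 1 x = (\<Sum>k=1..M. fact (k - 1) * (x / ln x ^ k)) + c + fact M * Li (Suc M) x"
  proof (induction M)
    case (Suc M)
    then obtain c where c: "\<And>x. x \<ge> 2 \<Longrightarrow>
        Li 1 x = (\<Sum>k=1..M. fact (k - 1) * (x / ln x ^ k)) + c + fact M * Li (Suc M) x" by blast
    have "Li 1 x = (\<Sum>k=1..Suc M. fact (k - 1) * (x / ln x ^ k)) + (c - fact M * (2 / ln 2 ^ Suc M))
        + fact (Suc M) * Li (Suc (Suc M)) x" if "x \<ge> 2" for x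
      unfolding c[OF that] Li_rec[OF that, of "Suc M"] by (simp add: algebra_simps del: power_Suc)
    thus ?case by blast
  qed simp
  then obtain c where c: "\<And>x. x \<ge> 2 \<Longrightarrow>
      Li 1 x = (\<Sum>k=1..M. fact (k - 1) * (x / ln x ^ k)) + c + fact M * Li (Suc M) x" by blast
  have "(\<lambda>x. c + fact M * Li (Suc M) x) \<in> O(\<lambda>x. x / ln x ^ Suc M)"
    by (intro sum_in_bigo const_bigo) (simp add: Li_bigo del: power_Suc)
  also have "?this \<longleftrightarrow> ?thesis"
  proof (rule landau_o.big.in_cong)
    show "\<forall>\<^sub>F x in at_top. c + fact M * Li (Suc M) x = Li 1 x - (\<Sum>k=1..M. fact (k - 1) * (x / ln x ^ k))"
      using eventually_ge_at_top[of 2]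
    proof eventually_elim
      case (elim x)
      show ?case using c[OF elim] by linarith
    qed
  qed
  finally show ?thesis .
qed

text \<open>Subtracting \<open>1 / (t - 1)\<close>, whose principal value over \<open>{0..2}\<close> vanishes, leaves a
  function that extends continuously to \<open>t = 1\<close> and, since \<open>1 / ln 0 = 0\<close>, is continuous at \<open>0\<close>.\<close>

definition li_kernel :: "real \<Rightarrow> real" where
  "li_kernel t = (if t = 1 then 1 / 2 else 1 / ln t - 1 / (t - 1))"

lemma li_kernel_continuous: "continuous_on {0..2} li_kernel"
  unfolding continuous_on_def
proof
  fix t :: real assume t: "t \<in> {0..2}"
  consider "t = 0" | "t = 1" | "t > 0" "t \<noteq> 1" using t by fastforce
  thus "(li_kernel \<longlongrightarrow> li_kernel t) (at t within {0..2})"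
  proof cases
    case 1
    have "((\<lambda>t::real. 1 / ln t - 1 / (t - 1)) \<longlongrightarrow> 1) (at_right 0)" by real_asymp
    moreover have "\<forall>\<^sub>F t in at_right 0. 1 / ln t - 1 / (t - 1) = li_kernel t"
      unfolding eventually_at_right_field by (intro exI[of _ 1]) (auto simp: li_kernel_def)
    ultimately have "(li_kernel \<longlongrightarrow> 1) (at_right 0)" by (rule Lim_transform_eventually)
    hence "(li_kernel \<longlongrightarrow> li_kernel 0) (at 0 within {0..})"
      by (simp add: li_kernel_def at_within_Ici_at_right)
    thus ?thesis unfolding 1 by (rule tendsto_within_subset) auto
  next
    case 2
    have "((\<lambda>t::real. 1 / ln t - 1 / (t - 1)) \<longlongrightarrow> 1 / 2) (at_right 1)"
      and "((\<lambda>t::real. 1 / ln t - 1 / (t - 1)) \<longlongrightarrow> 1 / 2) (at_left 1)" by real_asymp+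
    hence "((\<lambda>t::real. 1 / ln t - 1 / (t - 1)) \<longlongrightarrow> 1 / 2) (at 1)" by (simp add: filterlim_at_split)
    moreover have "\<forall>\<^sub>F t in at 1. 1 / ln t - 1 / (t - 1) = li_kernel t"
      by (auto simp: eventually_at_filter li_kernel_def)
    ultimately have "(li_kernel \<longlongrightarrow> 1 / 2) (at 1)" by (rule Lim_transform_eventually)
    hence "(li_kernel \<longlongrightarrow> li_kernel 1) (at 1)" by (simp add: li_kernel_def)
    thus ?thesis unfolding 2 by (rule tendsto_within_subset) auto
  next
    case 3
    have "isCont (\<lambda>t::real. 1 / ln t - 1 / (t - 1)) t" using 3 by (intro continuous_intros) auto
    hence "((\<lambda>t::real. 1 / ln t - 1 / (t - 1)) \<longlongrightarrow> li_kernel t) (at t)"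
      using 3 by (simp add: isCont_def li_kernel_def)
    moreover have "\<forall>\<^sub>F s in at t. 1 / ln s - 1 / (s - 1) = li_kernel s"
      using 3 t1_space_nhds[of t 1] eventually_at_filter
      by (auto simp: eventually_at_filter li_kernel_def elim!: eventually_mono)
    ultimately have "(li_kernel \<longlongrightarrow> li_kernel t) (at t)" by (rule Lim_transform_eventually)
    thus ?thesis by (rule tendsto_within_subset) auto
  qed
qed

lemma li_eq: "\<exists>c. \<forall>x\<ge>2. li x = c + Li 1 x"
proof -
  let ?K = "\<lambda>h. integral {0..1-h} li_kernel + integral {1+h..2} li_kernel"
  define c where "c = integral {0..2} li_kernel"
  have kint: "li_kernel integrable_on {a..b}" if "a \<ge> 0" "b \<le> 2" for a b
    by (rule integrable_continuous_interval, rule continuous_on_subset[OF li_kernel_continuous])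
       (use that in auto)
  \<comment> \<open>The primitive \<open>ln ((t - 1) ^ 2) / 2\<close> of \<open>1 / (t - 1)\<close>
    serves both sides of 1. It vanishes at 0 and 2, and its values at \<open>1 - h\<close> and
    \<open>1 + h\<close> agree, so the boundary terms cancel for every \<open>h\<close> and the
    principal value is visible without a limit.\<close>
  have split: "integral {a..b} (\<lambda>t. 1 / ln t) =
      integral {a..b} li_kernel + (ln ((b - 1)\<^sup>2) / 2 - ln ((a - 1)\<^sup>2) / 2)"
    if ab: "0 \<le> a" "a \<le> b" "b \<le> 2" "1 \<notin> {a..b}" for a b
  proof -
    have "((\<lambda>t. 1 / (t - 1)) has_integral (ln ((b - 1)\<^sup>2) / 2 - ln ((a - 1)\<^sup>2) / 2)) {a..b}"
    proof (rule fundamental_theorem_of_calculus[OF ab(2)])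
      fix t assume "t \<in> {a..b}"
      hence "t \<noteq> 1" using ab(4) by auto
      hence "((\<lambda>t. ln ((t - 1)\<^sup>2) / 2) has_real_derivative 1 / (t - 1)) (at t within {a..b})"
      proof -
        have "((\<lambda>t. ln ((t - 1)\<^sup>2) / 2) has_real_derivative (4 * t - 4) / ((t - 1)\<^sup>2 * 4)) (at t within {a..b})"
          using \<open>t \<noteq> 1\<close> by (auto intro!: derivative_eq_intros simp: zero_less_power2)
        moreover have "4 * u / (u\<^sup>2 * 4) = 1 / u" if "u \<noteq> 0" for u :: real
          using that by (simp add: power2_eq_square)
        from this[of "t - 1"] have "(4 * t - 4) / ((t - 1)\<^sup>2 * 4) = 1 / (t - 1)"
          using \<open>t \<noteq> 1\<close> by (simp only: right_diff_distrib) simp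
        ultimately show ?thesis by (simp only:)
      qed
      thus "((\<lambda>t. ln ((t - 1)\<^sup>2) / 2) has_vector_derivative 1 / (t - 1)) (at t within {a..b})"
        by (simp add: has_real_derivative_iff_has_vector_derivative)
    qed
    hence "((\<lambda>t. li_kernel t + 1 / (t - 1)) has_integral
        (integral {a..b} li_kernel + (ln ((b - 1)\<^sup>2) / 2 - ln ((a - 1)\<^sup>2) / 2))) {a..b}"
      using ab by (intro has_integral_add integrable_integral kint)
    hence "((\<lambda>t. 1 / ln t) has_integral
        (integral {a..b} li_kernel + (ln ((b - 1)\<^sup>2) / 2 - ln ((a - 1)\<^sup>2) / 2))) {a..b}"
      by (rule has_integral_eq[rotated]) (use ab in \<open>auto simp: li_kernel_def\<close>)
    thus ?thesis by (rule integral_unique)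
  qed
  have cont: "continuous_on {0..2} (\<lambda>x. integral {0..x} li_kernel)"
    by (intro indefinite_integral_continuous_1 kint) auto
  have lim: "((\<lambda>h. ?K h) \<longlongrightarrow> c) (at_right 0)"
  proof -
    have isC: "isCont (\<lambda>x. integral {0..x} li_kernel) 1"
      using cont by (rule continuous_on_interior) (simp add: interior_atLeastAtMost_real)
    have "((\<lambda>h::real. 1 - h) \<longlongrightarrow> 1) (at_right 0)" "((\<lambda>h::real. 1 + h) \<longlongrightarrow> 1) (at_right 0)"
      by (auto intro!: tendsto_eq_intros)
    note isCont_tendsto_compose[OF isC this(1)] isCont_tendsto_compose[OF isC this(2)]
    hence "((\<lambda>h. integral {0..1-h} li_kernel + (c - integral {0..1+h} li_kernel)) \<longlongrightarrow>
        integral {0..1} li_kernel + (c - integral {0..1} li_kernel)) (at_right 0)"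
      by (intro tendsto_intros)
    moreover have "\<forall>\<^sub>F h in at_right 0. integral {0..1-h} li_kernel + (c - integral {0..1+h} li_kernel)
       = ?K h"
      unfolding eventually_at_right_field
    proof (intro exI[of _ 1] conjI allI impI)
      fix h :: real assume "0 < h" "h < 1"
      hence "integral {0..1+h} li_kernel + integral {1+h..2} li_kernel = c"
        unfolding c_def by (intro Henstock_Kurzweil_Integration.integral_combine kint) auto
      thus "integral {0..1-h} li_kernel + (c - integral {0..1+h} li_kernel)
       = ?K h" by simp
    qed simp
    ultimately have "((\<lambda>h. ?K h) \<longlongrightarrow>
        integral {0..1} li_kernel + (c - integral {0..1} li_kernel)) (at_right 0)"
      by (rule Lim_transform_eventually)
    thus ?thesis by simp
  qed
  have "li x = c + Li 1 x" if x: "x \<ge> 2" for x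
    unfolding li_def
  proof (rule tendsto_Lim)
    have "((\<lambda>h. ?K h + Li 1 x) \<longlongrightarrow> c + Li 1 x) (at_right 0)"
      by (intro tendsto_add lim tendsto_const)
    moreover have "\<forall>\<^sub>F h in at_right 0. ?K h + Li 1 x =
        integral {0..1-h} (\<lambda>t. 1 / ln t) + integral {1+h..x} (\<lambda>t. 1 / ln t)"
      unfolding eventually_at_right_field
    proof (intro exI[of _ 1] conjI allI impI)
      fix h :: real assume h: "0 < h" "h < 1"
      have "integral {1+h..2} (\<lambda>t. 1 / ln t) + Li 1 x = integral {1+h..x} (\<lambda>t. 1 / ln t)"
        unfolding Li_def power_one_right using h x inv_ln_integrable[of "1 + h" 1]
        by (intro Henstock_Kurzweil_Integration.integral_combine) auto
      thus "?K h + Li 1 x =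
        integral {0..1-h} (\<lambda>t. 1 / ln t) + integral {1+h..x} (\<lambda>t. 1 / ln t)"
        using split[of 0 "1 - h"] split[of "1 + h" 2] h by simp
    qed simp
    ultimately show "((\<lambda>h. integral {0..1-h} (\<lambda>t. 1 / ln t) + integral {1+h..x} (\<lambda>t. 1 / ln t))
        \<longlongrightarrow> c + Li 1 x) (at_right 0)"
      by (rule Lim_transform_eventually)
  qed simp
  thus ?thesis by blast
qed

section \<open>Partial summation\<close>

text \<open>Partial summation prime by prime: \<open>p\<close> contributes
  \<open>ln p / (t * (ln t) ^ 2)\<close> on \<open>{p..x}\<close>, whose integral is
  \<open>1 - ln p / ln x\<close> because \<open>- 1 / ln t\<close> is a primitive of
  \<open>1 / (t * (ln t) ^ 2)\<close>.\<close>

lemma theta_integral: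
  assumes x: "x \<ge> 2"
  shows "((\<lambda>t. theta t / (t * (ln t)\<^sup>2)) has_integral (prime_pi x - theta x / ln x)) {2..x}"
proof -
  let ?k = "\<lambda>p t. if t \<in> {real p..x} then ln (real p) * (1 / (t * (ln t)\<^sup>2)) else 0"
  define P where "P = {p::nat. prime p \<and> real p \<le> x}"
  have fin: "finite P" unfolding P_def by (rule finite_primes_le)
  have int: "((\<lambda>t. ?k p t) has_integral
      (1 - ln (real p) / ln x)) {2..x}" if p: "p \<in> P" for p
  proof -
    have p2: "real p \<ge> 2" "real p \<le> x" using p prime_ge_2_nat[of p] by (auto simp: P_def)
    have "((\<lambda>t. 1 / (t * (ln t)\<^sup>2)) has_integral (- 1 / ln x - (- 1 / ln (real p)))) {real p..x}"
      using p2 by (intro fundamental_theorem_of_calculus)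
        (auto intro!: derivative_eq_intros simp: power2_eq_square divide_simps
           simp flip: has_real_derivative_iff_has_vector_derivative)
    from has_integral_mult_right[OF this, of "ln (real p)"]
    have "((\<lambda>t. ln (real p) * (1 / (t * (ln t)\<^sup>2))) has_integral
        ln (real p) * (- 1 / ln x - (- 1 / ln (real p)))) {real p..x}" .
    also have "ln (real p) * (- 1 / ln x - (- 1 / ln (real p))) = 1 - ln (real p) / ln x"
      using p2 by (simp add: right_diff_distrib)
    finally have "((\<lambda>t. ln (real p) * (1 / (t * (ln t)\<^sup>2))) has_integral (1 - ln (real p) / ln x)) {real p..x}" .
    moreover have "{real p..x} \<inter> {2..x} = {real p..x}" "{2..x} \<inter> {real p..x} = {real p..x}"
      using p2 by auto
    ultimately show ?thesis by (simp only: has_integral_restrict_Int)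
  qed
  have "((\<lambda>t. \<Sum>p\<in>P. ?k p t) has_integral
      (\<Sum>p\<in>P. 1 - ln (real p) / ln x)) {2..x}"
    by (intro has_integral_sum fin int)
  also have "(\<Sum>p\<in>P. 1 - ln (real p) / ln x) = prime_pi x - theta x / ln x"
    by (simp add: sum_subtractf prime_pi_def theta_def P_def sum_divide_distrib)
  finally show ?thesis
  proof (rule has_integral_eq[rotated])
    fix t assume t: "t \<in> {2..x}"
    have "(\<Sum>p\<in>P. ?k p t) =
        (\<Sum>p | prime p \<and> real p \<le> t. ln (real p) * (1 / (t * (ln t)\<^sup>2)))"
      using t fin by (intro sum.mono_neutral_cong_right) (auto simp: P_def)
    also have "\<dots> = theta t / (t * (ln t)\<^sup>2)" by (simp add: theta_def sum_divide_distrib)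
    finally show "(\<Sum>p\<in>P. ?k p t) =
        theta t / (t * (ln t)\<^sup>2)" .
  qed
qed

text \<open>Up to the constant \<open>2 / ln 2\<close>, the identity of
  \<open>theta_integral\<close> also holds with \<open>t\<close> for \<open>theta t\<close> and
  \<open>Li 1\<close> for \<open>prime_pi\<close>; this is \<open>Li_rec\<close> for
  \<open>M = 1\<close>. Subtracting leaves terms in \<open>theta t - t\<close>, whose integral is
  controlled by \<open>Li (N + 2)\<close>.\<close>

lemma prime_pi_Li: "(\<lambda>x. prime_pi x - Li 1 x) \<in> O(\<lambda>x. x / ln x ^ N)"
proof -
  let ?g = "\<lambda>t. (theta t - t) / (t * (ln t)\<^sup>2)"
  have gint: "(?g has_integral (prime_pi x - theta x / ln x) - Li 2 x) {2..x}" if x: "x \<ge> 2" for x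
  proof -
    have "((\<lambda>t. theta t / (t * (ln t)\<^sup>2) - 1 / ln t ^ 2) has_integral
        (prime_pi x - theta x / ln x) - Li 2 x) {2..x}"
      unfolding Li_def
      by (intro has_integral_diff theta_integral x integrable_integral inv_ln_integrable) simp
    thus ?thesis by (rule has_integral_eq[rotated]) (auto simp: field_simps)
  qed
  have eq: "prime_pi x - Li 1 x = (theta x - x) / ln x + 2 / ln 2 + integral {2..x} ?g" if "x \<ge> 2" for x
    using integral_unique[OF gint[OF that]] Li_rec[OF that, of 1]
    by (simp add: diff_divide_distrib numeral_2_eq_2)
  obtain K where K: "K > 0" "\<forall>\<^sub>F t in at_top. norm (theta t - t) \<le> K * norm (t / ln t ^ N)"
    using theta_asymp[of N] by (elim landau_o.bigE)
  then obtain a0 where a0: "\<And>t. t \<ge> a0 \<Longrightarrow> norm (theta t - t) \<le> K * norm (t / ln t ^ N)"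
    by (auto simp: eventually_at_top_linorder)
  define a where "a = max a0 2"
  have a: "a \<ge> 2" by (simp add: a_def)
  have g_int: "?g integrable_on {u..v}" if "2 \<le> u" for u v
  proof (cases "2 \<le> v")
    case True
    have "?g integrable_on {2..v}" using gint[OF True] by (rule has_integral_integrable)
    thus ?thesis by (rule integrable_on_subinterval) (use that in auto)
  next
    case False
    hence "{u..v} = {}" using that by auto
    thus ?thesis by (simp only: integrable_on_empty)
  qed
  have "(\<lambda>x. integral {a..x} ?g) \<in> O(Li (N + 2))"
  proof (rule bigoI[where c = K])
    show "\<forall>\<^sub>F x in at_top. norm (integral {a..x} ?g) \<le> K * norm (Li (N + 2) x)"
      using eventually_ge_at_top[of a]
    proof eventually_elim
      case (elim x)
      have "norm (integral {a..x} ?g) \<le> integral {a..x} (\<lambda>t. K * (1 / ln t ^ (N + 2)))"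
      proof (rule Henstock_Kurzweil_Integration.integral_norm_bound_integral)
        show "?g integrable_on {a..x}" using a by (rule g_int)
        show "(\<lambda>t. K * (1 / ln t ^ (N + 2))) integrable_on {a..x}"
          using a by (intro integrable_on_mult_right inv_ln_integrable) auto
        fix t assume "t \<in> {a..x}"
        hence t: "t \<ge> 2" "t \<ge> a0" by (auto simp: a_def)
        have L: "ln t > 0" using t by simp
        have "norm (?g t) = norm (theta t - t) / (t * (ln t)\<^sup>2)" using t by (simp add: abs_mult)
        also have "\<dots> \<le> (K * (t / ln t ^ N)) / (t * (ln t)\<^sup>2)"
          using a0[OF t(2)] t L by (intro divide_right_mono) (auto simp: power_abs)
        also have "\<dots> = K * (1 / ln t ^ (N + 2))" using t L by (simp add: power_add power2_eq_square)
        finally show "norm (?g t) \<le> K * (1 / ln t ^ (N + 2))" .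
      qed
      also have "\<dots> = K * integral {a..x} (\<lambda>t. 1 / ln t ^ (N + 2))"
        by (rule Henstock_Kurzweil_Integration.integral_mult_right)
      also have "\<dots> \<le> K * Li (N + 2) x"
        unfolding Li_def using K a
        by (intro mult_left_mono integral_subset_le inv_ln_integrable) auto
      also have "\<dots> \<le> K * norm (Li (N + 2) x)" using K by (intro mult_left_mono) auto
      finally show ?case .
    qed
  qed
  also have "Li (N + 2) \<in> O(\<lambda>x. x / ln x ^ (N + 2))" by (rule Li_bigo)
  also have "(\<lambda>x. x / ln x ^ (N + 2)) \<in> O(\<lambda>x::real. x / ln x ^ N)"
    using landau_o.big.mult[OF landau_o.big_refl[of "\<lambda>x::real. x"] ln_power_bigo[of N "N + 2"]] by simp
  finally have tail: "(\<lambda>x. integral {a..x} ?g) \<in> O(\<lambda>x. x / ln x ^ N)" .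
  have "(\<lambda>x. (theta x - x) * (1 / ln x ^ 1)) \<in> O(\<lambda>x. x / ln x ^ N * (1 / ln x ^ 0))"
    by (intro landau_o.big.mult theta_asymp ln_power_bigo) simp
  hence "(\<lambda>x. (theta x - x) / ln x + 2 / ln 2 + (integral {2..a} ?g + integral {a..x} ?g)) \<in> O(\<lambda>x. x / ln x ^ N)"
    by (intro sum_in_bigo const_bigo tail) simp
  also have "?this \<longleftrightarrow> ?thesis"
  proof (rule landau_o.big.in_cong)
    show "\<forall>\<^sub>F x in at_top. (theta x - x) / ln x + 2 / ln 2 + (integral {2..a} ?g + integral {a..x} ?g) =
        prime_pi x - Li 1 x"
      using eventually_ge_at_top[of a]
    proof eventually_elim
      case (elim x)
      have "integral {2..a} ?g + integral {a..x} ?g = integral {2..x} ?g"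
        using a elim by (intro Henstock_Kurzweil_Integration.integral_combine g_int) auto
      thus ?case using eq[of x] a elim by simp
    qed
  qed
  finally show ?thesis .
qed

section \<open>Asymptotic expansions of the prime density and of li\<close>

lemma div_x_bigo:
  assumes "f \<in> O(\<lambda>x::real. x / ln x ^ M)"
  shows "(\<lambda>x. f x / x) \<in> O(\<lambda>x. 1 / ln x ^ M)"
proof -
  have "(\<lambda>x. f x * (1 / x)) \<in> O(\<lambda>x. x / ln x ^ M * (1 / x))"
    by (intro landau_o.big.mult assms) auto
  also have "(\<lambda>x::real. x / ln x ^ M * (1 / x)) \<in> \<Theta>(\<lambda>x. 1 / ln x ^ M)"
    by (intro bigthetaI_cong) (use eventually_gt_at_top[of 0] in \<open>eventually_elim, simp\<close>)
  finally show ?thesis by simp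
qed

text \<open>Only closeness to \<open>Li 1\<close> enters, so one argument serves
  \<open>prime_pi\<close> and \<open>li\<close>. After the first \<open>n\<close> terms are removed,
  the factor \<open>ln x ^ Suc n / fact n\<close> turns the term
  \<open>fact (n + j) / ln x ^ Suc (n + j)\<close> into the \<open>j\<close>-th term of
  \<open>2F0(n + 1, 1)\<close>.\<close>

lemma expands_of_Li_close:
  assumes G: "\<And>M. (\<lambda>x. G x - Li 1 x) \<in> O(\<lambda>x. x / ln x ^ M)"
    and f: "\<forall>\<^sub>F x in at_top. f x = ln x ^ n / fact n * (G x / x - (\<Sum>k=1..n. fact (k - 1) / ln x ^ k))"
  shows "expands (\<lambda>x. ln x * f x) (hyp_coeff (Suc n) 1)"
  unfolding expands_def
proof
  fix N
  have coeff: "hyp_coeff (Suc n) 1 j = fact (n + j) / fact n" for j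
  proof -
    have "fact (n + j) = (fact n :: real) * pochhammer (1 + real n) j"
      using pochhammer_product'[of "1 :: real" n j] by (simp add: pochhammer_fact)
    thus ?thesis by (simp add: hyp_coeff_def pochhammer_fact add.commute flip: pochhammer_fact)
  qed
  let ?T = "\<lambda>x. \<Sum>k=1..n+N. fact (k - 1) * (x / ln x ^ k)"
  let ?S = "\<lambda>x. \<Sum>k=1..n+N. fact (k - 1) / ln x ^ k"
  have "(\<lambda>x. (G x - Li 1 x) + (Li 1 x - ?T x))
      \<in> O(\<lambda>x. x / ln x ^ Suc (n + N))"
    by (intro sum_in_bigo G Li_expansion)
  from div_x_bigo[OF this]
  have "(\<lambda>x. (G x - ?T x) / x) \<in> O(\<lambda>x. 1 / ln x ^ Suc (n + N))"
    by (simp del: power_Suc)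
  hence "(\<lambda>x. (1 / fact n * ln x ^ Suc n) * ((G x - ?T x) / x)) \<in>
      O(\<lambda>x. ln x ^ Suc n * (1 / ln x ^ Suc (n + N)))"
    by (intro landau_o.big.mult) auto
  also have "?this \<longleftrightarrow> (\<lambda>x. ln x * f x - (\<Sum>j<N. hyp_coeff (Suc n) 1 j / ln x ^ j)) \<in> O(\<lambda>x. 1 / ln x ^ N)"
  proof (rule landau_o.big.cong_ex)
    show "\<forall>\<^sub>F x::real in at_top. ln x ^ Suc n * (1 / ln x ^ Suc (n + N)) = 1 / ln x ^ N"
      using eventually_gt_at_top[of 1] by eventually_elim (simp add: power_add)
    show "\<forall>\<^sub>F x in at_top. (1 / fact n * ln x ^ Suc n) *
        ((G x - ?T x) / x) =
        ln x * f x - (\<Sum>j<N. hyp_coeff (Suc n) 1 j / ln x ^ j)"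
      using eventually_gt_at_top[of 1] f
    proof eventually_elim
      case (elim x)
      have L: "ln x > 0" using elim by simp
      have "(G x - ?T x) / x = G x / x - ?S x"
        using elim by (simp add: diff_divide_distrib sum_divide_distrib)
      also have "?S x = (\<Sum>k=1..n. fact (k - 1) / ln x ^ k) + (\<Sum>k=n+1..n+N. fact (k - 1) / ln x ^ k)"
        by (rule sum.ub_add_nat) simp
      also have "(\<Sum>k=n+1..n+N. fact (k - 1) / ln x ^ k) = (\<Sum>j<N. fact (n + j) / ln x ^ (Suc (n + j)))"
        by (rule sum.reindex_bij_witness[of _ "\<lambda>j. n + 1 + j" "\<lambda>k. k - n - 1"]) auto
      finally have e1: "(G x - ?T x) / x = G x / x -
          ((\<Sum>k=1..n. fact (k - 1) / ln x ^ k) + (\<Sum>j<N. fact (n + j) / ln x ^ (Suc (n + j))))" .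
      have "(1 / fact n * ln x ^ Suc n) * ((G x - ?T x) / x)
         = ln x * (ln x ^ n / fact n * (G x / x - (\<Sum>k=1..n. fact (k - 1) / ln x ^ k)))
           - (1 / fact n * ln x ^ Suc n) * (\<Sum>j<N. fact (n + j) / ln x ^ (Suc (n + j)))"
        unfolding e1 by (simp add: algebra_simps)
      also have "(1 / fact n * ln x ^ Suc n) * (\<Sum>j<N. fact (n + j) / ln x ^ (Suc (n + j))) =
          (\<Sum>j<N. hyp_coeff (Suc n) 1 j / ln x ^ j)"
        unfolding sum_distrib_left using L by (intro sum.cong) (simp_all add: coeff[unfolded One_nat_def] power_add)
      finally show ?case using elim by simp
    qed
  qed
  finally show "(\<lambda>x. ln x * f x - (\<Sum>j<N. hyp_coeff (Suc n) 1 j / ln x ^ j)) \<in> O(\<lambda>x. 1 / ln x ^ N)" .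
qed

lemma li_Li: "(\<lambda>x. li x - Li 1 x) \<in> O(\<lambda>x. x / ln x ^ M)"
proof -
  obtain c where c: "\<And>x. x \<ge> 2 \<Longrightarrow> li x = c + Li 1 x" using li_eq by blast
  have "(\<lambda>x. li x - Li 1 x) \<in> O(\<lambda>x. x / ln x ^ M) \<longleftrightarrow> (\<lambda>_. c) \<in> O(\<lambda>x::real. x / ln x ^ M)"
    by (intro landau_o.big.in_cong)
       (use eventually_ge_at_top[of 2] in \<open>eventually_elim, simp add: c\<close>)
  thus ?thesis using const_bigo by simp
qed

lemma R_minus_F:
  assumes "t > 0"
  shows "(\<lambda>x. R n x - F n x) \<in> o(\<lambda>x. 1 / ln x powr t)"
proof -
  \<comment> \<open>An integer exponent beyond \<open>t\<close>; the error is taken at order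
    \<open>n + M\<close> to pay for the factor \<open>ln x ^ n\<close>.\<close>
  define M where "M = Suc (nat \<lceil>t\<rceil>)"
  have M: "real M > t" unfolding M_def by linarith
  have "(\<lambda>x. (prime_pi x - Li 1 x) - (li x - Li 1 x)) \<in> O(\<lambda>x. x / ln x ^ (n + M))"
    by (intro sum_in_bigo prime_pi_Li li_Li)
  from div_x_bigo[OF this] have "(\<lambda>x. (prime_pi x - li x) / x) \<in> O(\<lambda>x. 1 / ln x ^ (n + M))" by simp
  hence "(\<lambda>x. (1 / fact n * ln x ^ n) * ((prime_pi x - li x) / x)) \<in> O(\<lambda>x. ln x ^ n * (1 / ln x ^ (n + M)))"
    by (intro landau_o.big.mult) auto
  also have "?this \<longleftrightarrow> (\<lambda>x. R n x - F n x) \<in> O(\<lambda>x. 1 / ln x ^ M)"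
  proof (rule landau_o.big.cong_ex)
    show "\<forall>\<^sub>F x in at_top. (1 / fact n * ln x ^ n) * ((prime_pi x - li x) / x) = R n x - F n x"
      using eventually_gt_at_top[of 1]
      by eventually_elim (simp add: R_def F_def pdens_def diff_divide_distrib algebra_simps)
    show "\<forall>\<^sub>F x::real in at_top. ln x ^ n * (1 / ln x ^ (n + M)) = 1 / ln x ^ M"
      using eventually_gt_at_top[of 1] by eventually_elim (simp add: power_add)
  qed
  finally have "(\<lambda>x. R n x - F n x) \<in> O(\<lambda>x. 1 / ln x ^ M)" .
  also have "(\<lambda>x::real. 1 / ln x ^ M) \<in> o(\<lambda>x. 1 / ln x powr t)"
  proof (rule smalloI_tendsto)
    have "((\<lambda>x::real. ln x powr - (real M - t)) \<longlongrightarrow> 0) at_top"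
      using M by (intro tendsto_neg_powr ln_at_top) auto
    moreover have "\<forall>\<^sub>F x::real in at_top. ln x powr - (real M - t) = 1 / ln x ^ M / (1 / ln x powr t)"
      using eventually_gt_at_top[of 1]
      by eventually_elim (simp add: powr_diff powr_realpow)
    ultimately show "((\<lambda>x::real. 1 / ln x ^ M / (1 / ln x powr t)) \<longlongrightarrow> 0) at_top"
      by (rule Lim_transform_eventually)
    show "\<forall>\<^sub>F x::real in at_top. 1 / ln x powr t \<noteq> 0"
      using eventually_gt_at_top[of 1] by eventually_elim simp
  qed
  finally show ?thesis .
qed

theorem theorem5p3:
  fixes n :: nat
  shows "cf_asymp (R n) (cfA1 n) (cfB1 n) \<and>
         cf_asymp (R n) (cfA2 n) (cfB2 n) \<and>
         cf_asymp (F n) (cfA1 n) (cfB1 n) \<and>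
         cf_asymp (F n) (cfA2 n) (cfB2 n) \<and>
         (\<forall>t::real > 0. (\<lambda>x. R n x - F n x) \<in> o[at_top](\<lambda>x. 1 / (ln x) powr t))"
proof -
  have "\<forall>\<^sub>F x in at_top. R n x = ln x ^ n / fact n * (prime_pi x / x - (\<Sum>k=1..n. fact (k - 1) / ln x ^ k))"
    using eventually_gt_at_top[of 1] by eventually_elim (simp add: R_def pdens_def mult.commute)
  hence R: "expands (\<lambda>x. ln x * R n x) (hyp_coeff (Suc n) 1)"
    by (rule expands_of_Li_close[OF prime_pi_Li])
  have F: "expands (\<lambda>x. ln x * F n x) (hyp_coeff (Suc n) 1)"
    by (rule expands_of_Li_close[OF li_Li]) (simp add: F_def)
  show ?thesis
    using cf_asymp_first[OF R] cf_asymp_second[OF R] cf_asymp_first[OF F] cf_asymp_second[OF F]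
      R_minus_F by blast
qed

end
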